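(* Let $r\ge 2$ and let $\mathcal{F}$ be an $r$-graph that covers pairs with $\mathrm{v}(\mathcal{F})\leq t$. If $\pi(\mathcal{F}) < r!\,t^{-r}\binom{t}{r}$, then there exists $n_0$ such that for all $n\geq n_0$, the balanced blowup $\mathcal{K}^{(r)}_t(n)$ is (up to isomorphism) the unique $\mathrm{Ext}(\mathcal{F}^{+(t+1)})$-free $r$-graph on $n$ vertices with the maximum number of edges.
   Context: An $r$-graph is an $r$-uniform hypergraph; $\mathrm{v}(\mathcal{F})$ is its number of vertices; $\mathcal{G}$ is $\mathcal{F}$-free if it contains no (not necessarily induced) subgraph isomorphic to $\mathcal{F}$. $\mathrm{ex}(n,\mathcal{F})$ is the maximum number of edges of an $\mathcal{F}$-free $r$-graph on $n$ vertices, and the Turán density is $\pi(\mathcal{F})=\lim_{n\to\infty}\mathrm{ex}(n,\mathcal{F})/\binom{n}{r}$. A pair of vertices of $\mathcal{G}$ is covered if it is contained in some edge, uncovered otherwise; $\mathcal{G}$ covers pairs if every pair of its vertices is covered. $\mathcal{F}^{+(t+1)}$ is obtained from $\mathcal{F}$ by adding isolated vertices so that it has exactly $t+1$ vertices. The extension $\mathrm{Ext}(\mathcal{G})$ is obtained from $\mathcal{G}$ by adding, for every uncovered pair $P$, $r-2$ new vertices $v^P_1,\dots,v^P_{r-2}$ (distinct for different pairs) and the edge $P\cup\{v^P_1,\dots,v^P_{r-2}\}$. The balanced blowup $\mathcal{K}^{(r)}_t(n)$ is the $r$-graph on $n$ vertices with a partition $(P_1,\dots,P_t)$ of its vertex set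 with $|P_i|\in\{\lfloor n/t\rfloor,\lceil n/t\rceil\}$, in which an $r$-set is an edge iff it contains at most one vertex of each $P_i$. *)

theory Defs
  imports Complex_Main "HOL-Library.Disjoint_Sets"
begin

record 'a hgraph =
  verts :: "'a set"
  edges :: "'a set set"

definition rgraph :: "nat \<Rightarrow> 'a hgraph \<Rightarrow> bool" where
  "rgraph r G \<longleftrightarrow> finite (verts G) \<and> (\<forall>e\<in>edges G. e \<subseteq> verts G \<and> card e = r)"

definition hg_iso :: "'a hgraph \<Rightarrow> 'b hgraph \<Rightarrow> bool" where
  "hg_iso G H \<longleftrightarrow>
     (\<exists>f. bij_betw f (verts G) (verts H) \<and> (\<lambda>e. f ` e) ` edges G = edges H)"

definition subhgraph :: "'a hgraph \<Rightarrow> 'a hgraph \<Rightarrow> bool" where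
  "subhgraph H G \<longleftrightarrow> verts H \<subseteq> verts G \<and> edges H \<subseteq> edges G"

definition hg_free :: "'a hgraph \<Rightarrow> 'b hgraph \<Rightarrow> bool" where
  "hg_free F G \<longleftrightarrow> \<not> (\<exists>H. subhgraph H G \<and> hg_iso F H)"

text \<open>Host graphs have their vertices among the natural numbers; this loses no generality, since
  every finite hypergraph has an isomorphic copy of this form.\<close>

definition free_rgraphs :: "nat \<Rightarrow> nat \<Rightarrow> 'a hgraph \<Rightarrow> nat hgraph set" where
  "free_rgraphs r n F = {G. rgraph r G \<and> card (verts G) = n \<and> hg_free F G}"

text \<open>On \<open>nat\<close>, \<open>Sup\<close> of a finite nonempty set is its maximum, and \<open>Sup {} = 0\<close>. The
  set below is bounded by \<open>n choose r\<close>, and can be empty only when \<open>F\<close> has no edges.\<close>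

definition turan_ex :: "nat \<Rightarrow> nat \<Rightarrow> 'a hgraph \<Rightarrow> nat" where
  "turan_ex r n F = Sup ((\<lambda>G. card (edges G)) ` free_rgraphs r n F)"

definition turan_density :: "nat \<Rightarrow> 'a hgraph \<Rightarrow> real" where
  "turan_density r F = lim (\<lambda>n. real (turan_ex r n F) / real (n choose r))"

definition extremal :: "nat \<Rightarrow> nat \<Rightarrow> 'a hgraph \<Rightarrow> nat hgraph \<Rightarrow> bool" where
  "extremal r n F G \<longleftrightarrow>
     G \<in> free_rgraphs r n F \<and>
     (\<forall>H\<in>free_rgraphs r n F. card (edges H) \<le> card (edges G))"

definition uncovered_pairs :: "'a hgraph \<Rightarrow> 'a set set" where
  "uncovered_pairs G = {P. P \<subseteq> verts G \<and> card P = 2 \<and> \<not> (\<exists>e\<in>edges G. P \<subseteq> e)}"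

definition covers_pairs :: "'a hgraph \<Rightarrow> bool" where
  "covers_pairs G \<longleftrightarrow> uncovered_pairs G = {}"

text \<open>\<open>add_isolated m G\<close> adds isolated vertices \<open>Inr 0, Inr 1, \<dots>\<close> up to a total of
  \<open>m\<close> vertices (for \<open>card (verts G) \<le> m\<close>).\<close>

definition add_isolated :: "nat \<Rightarrow> 'a hgraph \<Rightarrow> ('a + nat) hgraph" where
  "add_isolated m G =
     \<lparr> verts = Inl ` verts G \<union> Inr ` {..<m - card (verts G)},
       edges = (\<lambda>e. Inl ` e) ` edges G \<rparr>"

text \<open>The new vertices attached to an uncovered pair \<open>P\<close> are \<open>Inr (P, i)\<close> with
  \<open>i < r - 2\<close>.\<close>

definition Ext :: "nat \<Rightarrow> 'a hgraph \<Rightarrow> ('a + 'a set \<times> nat) hgraph" where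
  "Ext r G =
     \<lparr> verts = Inl ` verts G \<union> Inr ` (uncovered_pairs G \<times> {..<r - 2}),
       edges = (\<lambda>e. Inl ` e) ` edges G \<union>
               (\<lambda>P. Inl ` P \<union> Inr ` ({P} \<times> {..<r - 2})) ` uncovered_pairs G \<rparr>"

text \<open>The balanced blowup is determined only up to isomorphism, hence a predicate.
  Parts may be empty when \<open>n < t\<close>.\<close>

definition is_balanced_blowup :: "nat \<Rightarrow> nat \<Rightarrow> nat \<Rightarrow> 'a hgraph \<Rightarrow> bool" where
  "is_balanced_blowup r t n K \<longleftrightarrow>
     finite (verts K) \<and> card (verts K) = n \<and>
     (\<exists>P :: nat \<Rightarrow> 'a set.
        disjoint_family_on P {..<t} \<and> (\<Union>i<t. P i) = verts K \<and>
        (\<forall>i<t. int (card (P i)) \<in> {\<lfloor>real n / real t\<rfloor>, \<lceil>real n / real t\<rceil>}) \<and>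
        edges K = {e. e \<subseteq> verts K \<and> card e = r \<and> (\<forall>i<t. card (e \<inter> P i) \<le> 1)})"

end

theory Submission
  imports Defs
begin

text \<open>
  Write $a = \binom{t}{r} / t^r$ and $H$ for the extension in question. A \<^emph>\<open>core\<close> is a set of
  $t+1$ pairwise covered vertices containing a copy of $F$. Deleting $O(n^{r-1})$ edges from an
  $H$-free graph makes it core-free, because a covered pair of large codegree can be extended
  greedily. Core-freeness survives Zykov symmetrization (replacing a vertex by a clone of another one
  not covered with it), and a fully symmetrized core-free graph is either $t$-partite or $F$-free, as
  $F$ covers pairs; in the second case it has at most $(a - \kappa) n^r$ edges.

  The local statement behind stability and exactness is: an $H$-free graph of minimum degree at least
  $(ar - \varepsilon) n^{r-1}$ that contains almost all transversal sets of some $t$-colouring is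
  \<^emph>\<open>exactly\<close> $t$-partite. Because its conclusion is stronger than its hypothesis, closeness to a
  $t$-partite graph propagates backwards along the symmetrization, one vertex at a time. This yields
  stability; applied once more to a subgraph $W$ maximising $e(W) - (a - \varepsilon) |W|^r$, it shows
  that $W$ is everything and that an extremal graph is $t$-partite.
\<close>

section \<open>Embedding extensions\<close>

text \<open>Cloning gives no direct control over the extension itself: a copy in the cloned graph
  may use both a vertex and its clone, and mapping back would identify them. Two vertices of a core
  always lie in a common edge, so they are never identified; this is why the argument runs on
  core-free graphs and pays a cleaning step to reach them. The number \<open>t + 1\<close> works
  from both sides. A \<open>t\<close>-colouring that is injective on edges leaves no room for
  \<open>t + 1\<close> pairwise covered vertices, so the blowup has no core. With more than
  \<open>t\<close> classes of twins, a copy of \<open>F\<close>, whose vertices lie in different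
  classes, can be enlarged to a core. The obstacle in stability is the number of symmetrization
  steps, which admits no bound independent of the graph: a loss per step would accumulate. One step
  alters only the edges at one vertex, a negligible share for large \<open>n\<close>, and exactness
  of the local statement restores the same error each time. That statement needs a minimum degree,
  which a dense graph may lack, so it is applied to a subgraph \<open>W\<close> of maximal surplus;
  the bound a n^r for core-free graphs shows that such a \<open>W\<close> has lost little.\<close>

definition embeds :: "'a hgraph \<Rightarrow> 'v set \<Rightarrow> 'v set set \<Rightarrow> bool" where
  "embeds F V E \<longleftrightarrow> (\<exists>\<phi>. inj_on \<phi> (verts F) \<and> \<phi> ` verts F \<subseteq> V \<and> (\<forall>e\<in>edges F. \<phi> ` e \<in> E))"

definition unif :: "nat \<Rightarrow> 'v set \<Rightarrow> 'v set set \<Rightarrow> bool" where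
  "unif r V E \<longleftrightarrow> finite V \<and> (\<forall>e\<in>E. e \<subseteq> V \<and> card e = r)"

lemma hg_free_iff_embeds:
  assumes "\<And>e. e \<in> edges F \<Longrightarrow> e \<subseteq> verts F"
  shows "hg_free F G \<longleftrightarrow> \<not> embeds F (verts G) (edges G)"
proof -
  have "embeds F (verts G) (edges G) \<longleftrightarrow> (\<exists>H. subhgraph H G \<and> hg_iso F H)"
  proof
    assume "embeds F (verts G) (edges G)"
    then obtain \<phi> where \<phi>: "inj_on \<phi> (verts F)" "\<phi> ` verts F \<subseteq> verts G" "\<forall>e\<in>edges F. \<phi> ` e \<in> edges G"
      unfolding embeds_def by blast
    define H where "H = \<lparr>verts = \<phi> ` verts F, edges = (\<lambda>e. \<phi> ` e) ` edges F\<rparr>"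
    have "subhgraph H G" using \<phi> by (auto simp: subhgraph_def H_def)
    moreover have "hg_iso F H" unfolding hg_iso_def
      by (rule exI[of _ \<phi>]) (use \<phi> in \<open>auto simp: H_def bij_betw_def\<close>)
    ultimately show "\<exists>H. subhgraph H G \<and> hg_iso F H" by blast
  next
    assume "\<exists>H. subhgraph H G \<and> hg_iso F H"
    then obtain H f where "subhgraph H G" "bij_betw f (verts F) (verts H)"
      "(\<lambda>e. f ` e) ` edges F = edges H" unfolding hg_iso_def by blast
    then have "inj_on f (verts F)" "f ` verts F \<subseteq> verts G" "\<forall>e\<in>edges F. f ` e \<in> edges G"
      by (auto simp: subhgraph_def bij_betw_def)
    then show "embeds F (verts G) (edges G)" unfolding embeds_def by blast
  qed
  then show ?thesis by (simp add: hg_free_def)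
qed

lemma embeds_mono: "embeds F V E \<Longrightarrow> V \<subseteq> V' \<Longrightarrow> E \<subseteq> E' \<Longrightarrow> embeds F V' E'"
  unfolding embeds_def
  apply (elim exE)
  subgoal for \<phi> by (rule exI[of _ \<phi>]) auto
  done

lemma unif_finite_edges: "unif r V E \<Longrightarrow> finite E"
  unfolding unif_def by (auto intro: finite_subset[of E "Pow V"])

lemma unif_mono: "unif r V E \<Longrightarrow> E' \<subseteq> E \<Longrightarrow> unif r V E'"
  unfolding unif_def by blast

lemma unif_restrict: "unif r V E \<Longrightarrow> W \<subseteq> V \<Longrightarrow> unif r W {e \<in> E. e \<subseteq> W}"
  unfolding unif_def by (auto intro: finite_subset)

definition covered :: "'v set set \<Rightarrow> 'v \<Rightarrow> 'v \<Rightarrow> bool" where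
  "covered E x y \<longleftrightarrow> (\<exists>e\<in>E. x \<in> e \<and> y \<in> e)"

lemma covered_sym: "covered E x y \<longleftrightarrow> covered E y x"
  by (auto simp: covered_def)

text \<open>The vertices of \<open>S\<close> outside the image of \<phi> stand for the isolated
  vertices of the enlarged \<open>F\<close>. Unlike in the extension, the edges covering different
  pairs may overlap or meet \<open>S\<close> in further vertices.\<close>

definition has_core :: "nat \<Rightarrow> 'a hgraph \<Rightarrow> 'v set \<Rightarrow> 'v set set \<Rightarrow> bool" where
  "has_core t F V E \<longleftrightarrow> (\<exists>S \<phi>. S \<subseteq> V \<and> card S = t + 1 \<and> (\<forall>x\<in>S. \<forall>y\<in>S. x \<noteq> y \<longrightarrow> covered E x y) \<and>
      inj_on \<phi> (verts F) \<and> \<phi> ` verts F \<subseteq> S \<and> (\<forall>e\<in>edges F. \<phi> ` e \<in> E))"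

lemma covered_mono: "covered E x y \<Longrightarrow> E \<subseteq> E' \<Longrightarrow> covered E' x y"
  by (auto simp: covered_def)

lemma has_coreE:
  assumes "has_core t F V E"
  obtains S \<phi> where "S \<subseteq> V" "card S = t + 1"
    "\<And>x y. x \<in> S \<Longrightarrow> y \<in> S \<Longrightarrow> x \<noteq> y \<Longrightarrow> covered E x y"
    "inj_on \<phi> (verts F)" "\<phi> ` verts F \<subseteq> S" "\<And>e. e \<in> edges F \<Longrightarrow> \<phi> ` e \<in> E"
  using assms unfolding has_core_def by metis

lemma has_coreI:
  assumes "S \<subseteq> V" "card S = t + 1"
    "\<And>x y. x \<in> S \<Longrightarrow> y \<in> S \<Longrightarrow> x \<noteq> y \<Longrightarrow> covered E x y"
    "inj_on \<phi> (verts F)" "\<phi> ` verts F \<subseteq> S" "\<And>e. e \<in> edges F \<Longrightarrow> \<phi> ` e \<in> E"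
  shows "has_core t F V E"
  unfolding has_core_def by (rule exI[of _ S], rule exI[of _ \<phi>]) (use assms in auto)

lemma has_core_mono:
  assumes "has_core t F V E" "V \<subseteq> V'" "E \<subseteq> E'"
  shows "has_core t F V' E'"
  using assms(1)
proof (rule has_coreE)
  fix S \<phi>
  assume *: "S \<subseteq> V" "card S = t + 1" "\<And>x y. x \<in> S \<Longrightarrow> y \<in> S \<Longrightarrow> x \<noteq> y \<Longrightarrow> covered E x y"
    "inj_on \<phi> (verts F)" "\<phi> ` verts F \<subseteq> S" "\<And>e. e \<in> edges F \<Longrightarrow> \<phi> ` e \<in> E"
  show ?thesis
    by (rule has_coreI[of S]) (use * assms covered_mono[OF _ assms(3)] in auto)
qed

text \<open>The robust form of being covered: edges through \<open>P\<close> can be chosen one after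
  another while avoiding up to \<open>q\<close> vertices already in use.\<close>

definition rich :: "nat \<Rightarrow> 'v set set \<Rightarrow> 'v set \<Rightarrow> bool" where
  "rich q E P \<longleftrightarrow> (\<forall>Q. finite Q \<longrightarrow> card Q \<le> q \<longrightarrow> (\<exists>e\<in>E. P \<subseteq> e \<and> e \<inter> Q \<subseteq> P))"

lemma card_verts_add_isolated:
  fixes F :: "'a hgraph"
  assumes "finite (verts F)" "card (verts F) \<le> m"
  shows "card (verts (add_isolated m F)) = m" "finite (verts (add_isolated m F))"
proof -
  have "card (Inl ` verts F \<union> Inr ` {..<m - card (verts F)} :: ('a + nat) set)
      = card (Inl ` verts F :: ('a + nat) set) + card (Inr ` {..<m - card (verts F)} :: ('a + nat) set)"
    using assms by (intro card_Un_disjoint) auto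
  then show "card (verts (add_isolated m F)) = m"
    using assms by (simp add: add_isolated_def card_image)
qed (use assms in \<open>auto simp: add_isolated_def\<close>)

lemma edges_add_isolated_subset:
  assumes "rgraph r F" "e \<in> edges (add_isolated m F)"
  shows "e \<subseteq> verts (add_isolated m F)"
  using assms by (auto simp: add_isolated_def rgraph_def)

lemma edges_Ext_subset:
  assumes "\<And>e. e \<in> edges G \<Longrightarrow> e \<subseteq> verts G" "e \<in> edges (Ext r G)"
  shows "e \<subseteq> verts (Ext r G)"
proof -
  have "\<And>P. P \<in> uncovered_pairs G \<Longrightarrow> P \<subseteq> verts G" by (auto simp: uncovered_pairs_def)
  then show ?thesis using assms by (auto simp: Ext_def; blast)
qed

text \<open>The images of the old vertices form the core: two old vertices share either an old edge
  or the new edge attached to them. Hence every core-free graph is free of the extension.\<close>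

lemma embeds_Ext_imp_has_core:
  fixes F :: "'a hgraph"
  assumes F: "rgraph r F" "card (verts F) \<le> t"
    and emb: "embeds (Ext r (add_isolated (t + 1) F)) V E"
  shows "has_core t F V E"
proof -
  let ?A = "add_isolated (t + 1) F"
  obtain \<psi> where \<psi>: "inj_on \<psi> (verts (Ext r ?A))" "\<psi> ` verts (Ext r ?A) \<subseteq> V"
    "\<forall>e\<in>edges (Ext r ?A). \<psi> ` e \<in> E"
    using emb unfolding embeds_def by blast
  have sub: "Inl ` verts ?A \<subseteq> verts (Ext r ?A)" by (auto simp: Ext_def)
  define S where "S = \<psi> ` Inl ` verts ?A"
  define \<phi> where "\<phi> = (\<lambda>x. \<psi> (Inl (Inl x)))"
  have fin: "finite (verts F)" using F by (simp add: rgraph_def)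
  have "card S = card (verts ?A)"
    unfolding S_def using inj_on_subset[OF \<psi>(1) sub]
    by (simp add: card_image inj_on_def)
  then have cS: "card S = t + 1" using card_verts_add_isolated[OF fin, of "t+1"] F by simp
  have SV: "S \<subseteq> V" using sub \<psi>(2) unfolding S_def by blast
  have inA: "Inl ` verts F \<subseteq> verts ?A" by (auto simp: add_isolated_def)
  have i\<phi>: "inj_on \<phi> (verts F)"
    using inj_on_subset[OF \<psi>(1) sub] inA unfolding \<phi>_def inj_on_def by blast
  have \<phi>S: "\<phi> ` verts F \<subseteq> S" using inA unfolding S_def \<phi>_def by blast
  have \<phi>E: "\<phi> ` e \<in> E" if "e \<in> edges F" for e
  proof -
    have "Inl ` Inl ` e \<in> edges (Ext r ?A)" using that by (auto simp: Ext_def add_isolated_def)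
    with \<psi>(3) show ?thesis unfolding \<phi>_def by (auto simp: image_image)
  qed
  have "covered E x y" if xy: "x \<in> S" "y \<in> S" "x \<noteq> y" for x y
  proof -
    from xy obtain a b where ab: "x = \<psi> (Inl a)" "y = \<psi> (Inl b)" "a \<in> verts ?A" "b \<in> verts ?A"
      unfolding S_def by blast
    with xy have "a \<noteq> b" by blast
    have "\<exists>e\<in>edges (Ext r ?A). Inl a \<in> e \<and> Inl b \<in> e"
    proof (cases "{a,b} \<in> uncovered_pairs ?A")
      case True
      then have "Inl ` {a,b} \<union> Inr ` ({{a,b}} \<times> {..<r - 2}) \<in> edges (Ext r ?A)"
        unfolding Ext_def by (simp only: hgraph.simps) (intro UnI2 imageI)
      then show ?thesis by (rule rev_bexI) simp
    next
      case False
      then obtain e where "e \<in> edges ?A" "{a,b} \<subseteq> e"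
        using ab \<open>a \<noteq> b\<close> by (auto simp: uncovered_pairs_def)
      then have "Inl ` e \<in> edges (Ext r ?A)" unfolding Ext_def by simp
      then show ?thesis by (rule rev_bexI) (use \<open>{a,b} \<subseteq> e\<close> in auto)
    qed
    then show ?thesis using \<psi>(3) ab unfolding covered_def by blast
  qed
  then show ?thesis using cS SV i\<phi> \<phi>S \<phi>E by (intro has_coreI[of S]) auto
qed

text \<open>Each edge uses at most \<open>r\<close> vertices, so \<open>Q0\<close> and all edges
  chosen before never exceed \<open>q\<close> vertices, and richness yields an edge avoiding them
  outside its own \<open>P\<close>.\<close>

lemma greedy_disjoint_edges:
  assumes "finite \<P>" "finite Q0" "card Q0 + r * card \<P> \<le> q"
    and "\<And>e. e \<in> E \<Longrightarrow> finite e \<and> card e \<le> r"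
    and "\<And>P. P \<in> \<P> \<Longrightarrow> rich q E P"
  shows "\<exists>h. \<forall>P\<in>\<P>. h P \<in> E \<and> P \<subseteq> h P \<and> h P \<inter> Q0 \<subseteq> P \<and>
           (\<forall>P'\<in>\<P>. P' \<noteq> P \<longrightarrow> (h P - P) \<inter> (h P' - P') = {})"
  using assms(1,3,5)
proof (induction \<P> rule: finite_induct)
  case empty
  then show ?case by simp
next
  case (insert P \<P>)
  then obtain h where h: "\<forall>P\<in>\<P>. h P \<in> E \<and> P \<subseteq> h P \<and> h P \<inter> Q0 \<subseteq> P \<and>
           (\<forall>P'\<in>\<P>. P' \<noteq> P \<longrightarrow> (h P - P) \<inter> (h P' - P') = {})"
    by (auto)
  define Q where "Q = Q0 \<union> (\<Union>P\<in>\<P>. h P)"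
  have fQ: "finite Q" unfolding Q_def using assms(2,4) h insert(1) by auto
  have "card (\<Union>P\<in>\<P>. h P) \<le> (\<Sum>P\<in>\<P>. card (h P))" by (rule card_UN_le[OF insert(1)])
  also have "\<dots> \<le> (\<Sum>P\<in>\<P>. r)" by (rule sum_mono) (use assms(4) h in auto)
  finally have "card Q \<le> q"
    using insert card_Un_le[of Q0 "\<Union>P\<in>\<P>. h P"] unfolding Q_def by (auto simp: mult.commute)
  then obtain e where e: "e \<in> E" "P \<subseteq> e" "e \<inter> Q \<subseteq> P"
    using insert(5)[of P] fQ unfolding rich_def by blast
  show ?case
    apply (rule exI[of _ "h(P := e)"])
    using e h insert(2) unfolding Q_def by (auto; blast)
qed

text \<open>The single pair \<open>P0\<close> need not be rich: one edge \<open>e0\<close> meeting \<open>S\<close> only in \<open>P0\<close> suffices for it.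
  To have no exceptional pair, take \<open>P0 = e0 = {}\<close>. The bound on \<open>q\<close> counts the vertices used up by
  the greedy choice of the other edges.\<close>

lemma core_embeds_Ext:
  fixes F :: "'a hgraph"
  assumes r: "r \<ge> 2" and F: "rgraph r F" "card (verts F) \<le> t"
    and E: "unif r V E" and S: "S \<subseteq> V" "card S = t + 1"
    and \<phi>: "inj_on \<phi> (verts F)" "\<phi> ` verts F \<subseteq> S" "\<And>e. e \<in> edges F \<Longrightarrow> \<phi> ` e \<in> E"
    and e0: "finite e0" "card e0 \<le> r" "card P0 = 2 \<Longrightarrow> e0 \<in> E \<and> P0 \<subseteq> e0 \<and> e0 \<inter> S \<subseteq> P0"
    and rich: "\<And>P. P \<subseteq> S \<Longrightarrow> card P = 2 \<Longrightarrow> P \<noteq> P0 \<Longrightarrow> rich q E P"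
    and q: "t + 1 + r + r * 2 ^ (t + 1) \<le> q"
  shows "embeds (Ext r (add_isolated (t + 1) F)) V E"
proof -
  have finS: "finite S" using S E unfolding unif_def by (auto intro: finite_subset)
  have finF: "finite (verts F)" using F by (simp add: rgraph_def)
  have fe: "finite e" "card e = r" "e \<subseteq> V" if "e \<in> E" for e
    using E that unfolding unif_def by (auto intro: finite_subset)
  define \<P> where "\<P> = {P. P \<subseteq> S \<and> card P = 2 \<and> P \<noteq> P0}"
  have f\<P>: "finite \<P>" unfolding \<P>_def using finS by auto
  have "card \<P> \<le> card (Pow S)" unfolding \<P>_def by (rule card_mono) (use finS in auto)
  then have c\<P>: "card \<P> \<le> 2 ^ (t+1)" using finS S by (simp add: card_Pow)
  have "card (S \<union> e0) + r * card \<P> \<le> t + 1 + r + r * 2 ^ (t+1)"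
    using card_Un_le[of S e0] S e0(2) c\<P> by (intro add_mono mult_le_mono) auto
  then have "card (S \<union> e0) + r * card \<P> \<le> q" using q by linarith
  moreover have "rich q E P" if "P \<in> \<P>" for P using that rich unfolding \<P>_def by blast
  ultimately obtain h0 where h0: "\<forall>P\<in>\<P>. h0 P \<in> E \<and> P \<subseteq> h0 P \<and> h0 P \<inter> (S \<union> e0) \<subseteq> P \<and>
           (\<forall>P'\<in>\<P>. P' \<noteq> P \<longrightarrow> (h0 P - P) \<inter> (h0 P' - P') = {})"
    using greedy_disjoint_edges[OF f\<P>, of "S \<union> e0" r q E] finS e0(1) fe by auto
  \<comment> \<open>The greedy edges were kept away from \<open>e0\<close> as well as from
    \<open>S\<close>, so assigning \<open>e0\<close> to the exceptional pair preserves
    disjointness.\<close>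
  define h where "h = h0(P0 := e0)"
  define prs where "prs = {P. P \<subseteq> S \<and> card P = 2}"
  have prs_cases: "P \<in> \<P> \<or> P = P0" if "P \<in> prs" for P using that unfolding prs_def \<P>_def by blast
  have h: "h P \<in> E" "P \<subseteq> h P" "h P \<inter> S \<subseteq> P" if "P \<in> prs" for P
    using prs_cases[OF that] h0 e0(3) that unfolding h_def prs_def by (auto; blast)+
  have P0not: "P \<noteq> P0" if "P \<in> \<P>" for P using that unfolding \<P>_def by blast
  have hd: "(h P - P) \<inter> (h P' - P') = {}" if "P \<in> prs" "P' \<in> prs" "P \<noteq> P'" for P P'
    using prs_cases[OF that(1)] prs_cases[OF that(2)] h0 that(3) P0not unfolding h_def
    by (auto; blast)
  have "\<exists>g. bij_betw g {..<r-2} (h P - P)" if "P \<in> prs" for P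
  proof (rule finite_same_card_bij)
    have "card P = 2" "finite P" using that finS unfolding prs_def by (auto intro: finite_subset)
    then show "card {..<r-2} = card (h P - P)" using h[OF that] fe by (simp add: card_Diff_subset)
    show "finite (h P - P)" using h[OF that] fe by auto
  qed auto
  then obtain \<gamma> where \<gamma>: "\<And>P. P \<in> prs \<Longrightarrow> bij_betw (\<gamma> P) {..<r-2} (h P - P)" by metis
  have "\<exists>\<beta>. bij_betw \<beta> {..<t + 1 - card (verts F)} (S - \<phi> ` verts F)"
    by (rule finite_same_card_bij)
      (use finS \<phi> S finF in \<open>auto simp: card_Diff_subset card_image\<close>)
  then obtain \<beta> where \<beta>: "bij_betw \<beta> {..<t + 1 - card (verts F)} (S - \<phi> ` verts F)" by blast
  let ?A = "add_isolated (t + 1) F"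
  define \<phi>' where "\<phi>' = case_sum \<phi> \<beta>"
  have i\<phi>': "inj_on \<phi>' (verts ?A)"
  proof (rule inj_onI)
    fix a b assume ab: "a \<in> verts ?A" "b \<in> verts ?A" "\<phi>' a = \<phi>' b"
    have \<beta>i: "\<beta> k \<in> S - \<phi> ` verts F" if "k < t + 1 - card (verts F)" for k
      using \<beta> that unfolding bij_betw_def by blast
    have \<beta>inj: "inj_on \<beta> {..<t + 1 - card (verts F)}" using \<beta> unfolding bij_betw_def by blast
    show "a = b"
      using ab \<phi>(1) \<beta>i \<beta>inj unfolding \<phi>'_def add_isolated_def
      by (auto simp: inj_on_eq_iff) (metis DiffD2 imageI)+
  qed
  have \<phi>'S: "\<phi>' ` verts ?A \<subseteq> S"
    using \<phi>(2) \<beta> unfolding \<phi>'_def add_isolated_def bij_betw_def by auto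
  define U where "U = uncovered_pairs ?A"
  have U: "P \<subseteq> verts ?A" "card P = 2" if "P \<in> U" for P
    using that unfolding U_def uncovered_pairs_def by auto
  have Uprs: "\<phi>' ` P \<in> prs" if "P \<in> U" for P
    using U[OF that] \<phi>'S i\<phi>' unfolding prs_def by (auto simp: card_image inj_on_subset)
  have Uinj: "P = P'" if "P \<in> U" "P' \<in> U" "\<phi>' ` P = \<phi>' ` P'" for P P'
    using inj_on_image_eq_iff[OF i\<phi>' U(1)[OF that(1)] U(1)[OF that(2)]] that(3) by blast
  \<comment> \<open>The new vertices of an uncovered pair go to the \<open>r - 2\<close> remaining
    vertices of the edge chosen for the image of that pair. These lie outside \<open>S\<close>,
    since the edge meets \<open>S\<close> only in its pair.\<close>
  define \<psi> where "\<psi> = case_sum \<phi>' (\<lambda>(P,i). \<gamma> (\<phi>' ` P) i)"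
  have vE: "verts (Ext r ?A) = Inl ` verts ?A \<union> Inr ` (U \<times> {..<r-2})"
    by (simp add: Ext_def U_def)
  have new: "\<gamma> (\<phi>' ` P) i \<in> h (\<phi>' ` P) - \<phi>' ` P" if "P \<in> U" "i < r - 2" for P i
    using \<gamma>[OF Uprs[OF that(1)]] that(2) unfolding bij_betw_def by blast
  have newS: "\<gamma> (\<phi>' ` P) i \<notin> S" if "P \<in> U" "i < r - 2" for P i
    using new[OF that] h(3)[OF Uprs[OF that(1)]] by blast
  have newinj: "P = P' \<and> i = i'"
    if "P \<in> U" "i < r - 2" "P' \<in> U" "i' < r - 2" "\<gamma> (\<phi>' ` P) i = \<gamma> (\<phi>' ` P') i'" for P i P' i'
  proof -
    have "\<phi>' ` P = \<phi>' ` P'"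
      using hd[OF Uprs[OF that(1)] Uprs[OF that(3)]] new[OF that(1,2)] new[OF that(3,4)] that(5)
      by auto
    then have "P = P'" using Uinj that by blast
    moreover have "i = i'"
      using \<gamma>[OF Uprs[OF that(1)]] that calculation unfolding bij_betw_def inj_on_def by auto
    ultimately show ?thesis by blast
  qed
  have i\<psi>: "inj_on \<psi> (verts (Ext r ?A))"
  proof (rule inj_onI)
    fix a b assume ab: "a \<in> verts (Ext r ?A)" "b \<in> verts (Ext r ?A)" "\<psi> a = \<psi> b"
    have S': "\<phi>' c \<in> S" if "c \<in> verts ?A" for c using \<phi>'S that by blast
    show "a = b"
    proof (cases a; cases b)
      fix c d assume "a = Inl c" "b = Inl d"
      then show ?thesis using ab inj_onD[OF i\<phi>', of c d] unfolding vE \<psi>_def by auto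
    next
      fix c d assume "a = Inl c" "b = Inr d"
      then show ?thesis using ab S'[of c] newS unfolding vE \<psi>_def by (auto; metis)
    next
      fix c d assume "a = Inr c" "b = Inl d"
      then show ?thesis using ab S'[of d] newS unfolding vE \<psi>_def by (auto; metis)
    next
      fix c d assume "a = Inr c" "b = Inr d"
      then show ?thesis using ab newinj unfolding vE \<psi>_def by auto
    qed
  qed
  have \<psi>V: "\<psi> ` verts (Ext r ?A) \<subseteq> V"
  proof -
    have "\<gamma> (\<phi>' ` P) i \<in> V" if "P \<in> U" "i < r - 2" for P i
      using new[OF that] h(1)[OF Uprs[OF that(1)]] fe by blast
    moreover have "\<phi>' c \<in> V" if "c \<in> verts ?A" for c using that \<phi>'S S(1) by blast
    ultimately show ?thesis unfolding vE \<psi>_def by auto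
  qed
  have \<psi>E: "\<psi> ` e \<in> E" if "e \<in> edges (Ext r ?A)" for e
  proof -
    from that consider e' where "e' \<in> edges F" "e = Inl ` Inl ` e'"
      | P where "P \<in> U" "e = Inl ` P \<union> Inr ` ({P} \<times> {..<r-2})"
      unfolding Ext_def add_isolated_def U_def by auto
    then show ?thesis
    proof cases
      case 1
      then have "\<psi> ` e = \<phi> ` e'" by (auto simp: \<psi>_def \<phi>'_def image_image)
      then show ?thesis using \<phi>(3) 1 by simp
    next
      case 2
      have "\<psi> ` e = \<phi>' ` P \<union> \<gamma> (\<phi>' ` P) ` {..<r-2}"
        unfolding 2 \<psi>_def by (force simp: image_Un image_image)
      also have "\<gamma> (\<phi>' ` P) ` {..<r-2} = h (\<phi>' ` P) - \<phi>' ` P"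
        using \<gamma>[OF Uprs[OF 2(1)]] unfolding bij_betw_def by blast
      also have "\<phi>' ` P \<union> (h (\<phi>' ` P) - \<phi>' ` P) = h (\<phi>' ` P)"
        using h(2)[OF Uprs[OF 2(1)]] by blast
      finally show ?thesis using h(1)[OF Uprs[OF 2(1)]] by simp
    qed
  qed
  show ?thesis unfolding embeds_def using i\<psi> \<psi>V \<psi>E by blast
qed

section \<open>Elementary symmetric functions of part sizes\<close>

text \<open>The elementary symmetric polynomial of degree \<open>k\<close>; for part sizes
  \<open>N\<close> it counts the \<open>k\<close>-sets with at most one vertex in each part.\<close>

definition esym :: "nat \<Rightarrow> nat set \<Rightarrow> (nat \<Rightarrow> nat) \<Rightarrow> nat" where
  "esym k J N = (\<Sum>I | I \<subseteq> J \<and> card I = k. \<Prod>i\<in>I. N i)"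

lemma esym_0 [simp]: "finite J \<Longrightarrow> esym 0 J N = 1"
proof -
  assume "finite J"
  then have "{I. I \<subseteq> J \<and> card I = 0} = {{}}" by (auto dest: finite_subset)
  then show ?thesis by (simp add: esym_def)
qed

lemma esym_empty [simp]: "esym (Suc k) {} N = 0"
proof -
  have "{I :: nat set. I \<subseteq> {} \<and> card I = Suc k} = {}" by auto
  then show ?thesis unfolding esym_def by (metis sum.empty)
qed

lemma esym_Suc_insert:
  assumes "finite J" "j \<notin> J"
  shows "esym (Suc k) (insert j J) N = esym (Suc k) J N + N j * esym k J N"
proof -
  let ?A = "{I. I \<subseteq> J \<and> card I = Suc k}" and ?B = "{I. I \<subseteq> J \<and> card I = k}"
  have fin: "finite I" if "I \<subseteq> insert j J" for I using that assms(1) by (auto intro: finite_subset)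
  have eq: "{I. I \<subseteq> insert j J \<and> card I = Suc k} = ?A \<union> insert j ` ?B"
  proof (intro equalityI subsetI)
    fix I assume I: "I \<in> {I. I \<subseteq> insert j J \<and> card I = Suc k}"
    show "I \<in> ?A \<union> insert j ` ?B"
    proof (cases "j \<in> I")
      case True
      then have "I = insert j (I - {j})" by blast
      moreover have "I - {j} \<in> ?B" using I True fin[of I] by auto
      ultimately show ?thesis by blast
    next
      case False
      then show ?thesis using I by auto
    qed
  next
    fix I assume "I \<in> ?A \<union> insert j ` ?B"
    then show "I \<in> {I. I \<subseteq> insert j J \<and> card I = Suc k}"
      using assms by (auto simp: card_insert_if finite_subset)
  qed
  have inj: "inj_on (insert j) ?B" using assms(2) by (auto simp: inj_on_def)
  have disj: "?A \<inter> insert j ` ?B = {}" using assms(2) by auto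
  have "(\<Sum>I\<in>insert j ` ?B. \<Prod>i\<in>I. N i) = (\<Sum>I\<in>?B. \<Prod>i\<in>insert j I. N i)"
    by (simp add: sum.reindex[OF inj])
  also have "\<dots> = (\<Sum>I\<in>?B. N j * (\<Prod>i\<in>I. N i))"
    using assms by (intro sum.cong refl prod.insert) (auto intro: finite_subset)
  finally have "(\<Sum>I\<in>insert j ` ?B. \<Prod>i\<in>I. N i) = N j * esym k J N"
    by (simp add: esym_def sum_distrib_left)
  then show ?thesis unfolding esym_def eq using assms(1) disj
    by (subst sum.union_disjoint) auto
qed

lemma esym_mono: "finite J \<Longrightarrow> (\<And>i. i \<in> J \<Longrightarrow> N i \<le> M i) \<Longrightarrow> esym k J N \<le> esym k J M"
  unfolding esym_def by (intro sum_mono prod_mono) auto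

lemma esym_cong: "(\<And>i. i \<in> J \<Longrightarrow> N i = M i) \<Longrightarrow> esym k J N = esym k J M"
  unfolding esym_def by (intro sum.cong prod.cong) auto

lemma esym_const: "finite J \<Longrightarrow> esym k J (\<lambda>_. q) = (card J choose k) * q ^ k"
  unfolding esym_def by (simp add: n_subsets)

lemma esym_scale: "esym k J (\<lambda>i. c * N i) = c ^ k * esym k J N"
  unfolding esym_def by (simp add: prod.distrib sum_distrib_left)

lemma esym_reindex:
  assumes "bij_betw \<sigma> J J'"
  shows "esym k J (\<lambda>i. N (\<sigma> i)) = esym k J' N"
proof -
  have inj: "inj_on \<sigma> J" and im: "\<sigma> ` J = J'" using assms by (auto simp: bij_betw_def)
  have "bij_betw ((`) \<sigma>) {I. I \<subseteq> J \<and> card I = k} {I. I \<subseteq> J' \<and> card I = k}"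
    unfolding bij_betw_def
  proof
    show "inj_on ((`) \<sigma>) {I. I \<subseteq> J \<and> card I = k}"
      by (rule inj_onI) (use inj_on_image_eq_iff[OF inj] in auto)
    show "(`) \<sigma> ` {I. I \<subseteq> J \<and> card I = k} = {I. I \<subseteq> J' \<and> card I = k}"
    proof (intro equalityI subsetI)
      fix I assume "I \<in> (`) \<sigma> ` {I. I \<subseteq> J \<and> card I = k}"
      then show "I \<in> {I. I \<subseteq> J' \<and> card I = k}"
        using im inj by (auto simp: card_image inj_on_subset)
    next
      fix I assume I: "I \<in> {I. I \<subseteq> J' \<and> card I = k}"
      then have "I \<subseteq> \<sigma> ` J" "card I = k" using im by auto
      then obtain I' where "I' \<subseteq> J" "I = \<sigma> ` I'" by (auto elim: subset_imageE)
      moreover have "card I' = k" using calculation \<open>card I = k\<close> card_image[OF inj_on_subset[OF inj, of I']]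
        by simp
      ultimately show "I \<in> (`) \<sigma> ` {I. I \<subseteq> J \<and> card I = k}" by blast
    qed
  qed
  then have "esym k J' N = (\<Sum>I | I \<subseteq> J \<and> card I = k. \<Prod>i\<in>\<sigma> ` I. N i)"
    unfolding esym_def by (rule sum.reindex_bij_betw[symmetric])
  also have "\<dots> = esym k J (\<lambda>i. N (\<sigma> i))"
    unfolding esym_def
    by (rule sum.cong[OF refl]) (use inj in \<open>auto simp: prod.reindex inj_on_subset\<close>)
  finally show ?thesis by simp
qed

text \<open>Fewer than \<open>k\<close> of the values are nonzero. This serves the balancing
  argument, where a move without gain has to mean that the whole sum vanishes.\<close>

lemma esym_eq_0_Suc:
  assumes "finite J" "esym k J N = 0"
  shows "esym (Suc k) J N = 0"
proof -
  have z: "(\<Prod>i\<in>I. N i) = 0" if "I \<subseteq> J" "card I = k" for I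
    using assms that unfolding esym_def by (subst (asm) sum_eq_0_iff) auto
  have "(\<Prod>i\<in>I. N i) = 0" if I: "I \<subseteq> J" "card I = Suc k" for I
  proof -
    have fI: "finite I" using I assms(1) finite_subset by blast
    obtain x where x: "x \<in> I" using I(2) by fastforce
    have "(\<Prod>i\<in>I - {x}. N i) = 0" using z[of "I - {x}"] I fI x by auto
    then show ?thesis using fI x by (simp add: prod.remove[OF fI x])
  qed
  then show ?thesis unfolding esym_def by auto
qed

text \<open>For a fixed sum \<open>N i + N j\<close> only the last term depends on how it is split,
  and it does so through the product \<open>N i * N j\<close>.\<close>

lemma esym_pair:
  assumes "finite J" "i \<notin> J" "j \<notin> J" "i \<noteq> j"
  shows "esym (Suc (Suc k)) (insert i (insert j J)) N =
    esym (Suc (Suc k)) J N + (N i + N j) * esym (Suc k) J N + N i * N j * esym k J N"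
  using assms by (simp add: esym_Suc_insert algebra_simps)

definition near_equal :: "nat \<Rightarrow> nat \<Rightarrow> (nat \<Rightarrow> nat) \<Rightarrow> bool" where
  "near_equal t m N \<longleftrightarrow> (\<Sum>i<t. N i) = m \<and> (\<forall>i<t. N i = m div t \<or> N i = m div t + 1)"

text \<open>If \<open>q\<close> is the smallest part, then fewer than \<open>t\<close> parts have
  size \<open>q + 1\<close>, so \<open>q\<close> is the quotient of \<open>m\<close> by
  \<open>t\<close>.\<close>

lemma near_equalI:
  assumes "t > 0" "(\<Sum>i<t. N i) = m" "\<And>i j. i < t \<Longrightarrow> j < t \<Longrightarrow> N i \<le> N j + 1"
  shows "near_equal t m N"
proof -
  obtain i0 where i0: "i0 < t" "\<forall>i<t. N i0 \<le> N i"
  proof -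
    have "finite (N ` {..<t})" "N ` {..<t} \<noteq> {}" using assms(1) by auto
    then have "Min (N ` {..<t}) \<in> N ` {..<t}" "\<forall>i<t. Min (N ` {..<t}) \<le> N i" by auto
    then obtain i0 where "i0 < t" "Min (N ` {..<t}) = N i0" by auto
    with \<open>\<forall>i<t. Min (N ` {..<t}) \<le> N i\<close> show ?thesis using that by auto
  qed
  define q where "q = N i0"
  have N: "N i = q \<or> N i = q + 1" if "i < t" for i
    using assms(3)[OF that i0(1)] i0(2) that unfolding q_def by (metis Suc_eq_plus1 le_SucE le_antisym)
  let ?S = "{i \<in> {..<t}. N i = q + 1}"
  have "(\<Sum>i<t. N i) = (\<Sum>i<t. q + (if N i = q + 1 then 1 else 0))"
    by (rule sum.cong) (use N in auto)
  also have "\<dots> = t * q + card ?S" by (simp add: sum.distrib sum.If_cases Int_def)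
  finally have m: "m = t * q + card ?S" using assms(2) by simp
  have "i0 \<notin> ?S" by (simp add: q_def)
  then have "?S \<subset> {..<t}" using i0(1) by auto
  then have "card ?S < t" using psubset_card_mono[of "{..<t}" ?S] by simp
  then have "m div t = q" using m assms(1) by simp
  then show ?thesis unfolding near_equal_def using assms(2) N by simp
qed

lemma near_equal_count:
  assumes "near_equal t m N"
  shows "card {i \<in> {..<t}. N i = m div t + 1} = m mod t"
proof -
  have "(\<Sum>i<t. N i) = (\<Sum>i<t. m div t + (if N i = m div t + 1 then 1 else 0))"
    by (rule sum.cong) (use assms in \<open>auto simp: near_equal_def\<close>)
  also have "\<dots> = t * (m div t) + card {i \<in> {..<t}. N i = m div t + 1}"
    by (simp add: sum.distrib sum.If_cases Int_def)
  finally have "m = t * (m div t) + card {i \<in> {..<t}. N i = m div t + 1}"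
    using assms by (simp add: near_equal_def)
  then show ?thesis by (metis add_left_cancel mult_div_mod_eq)
qed

text \<open>Both distributions have exactly \<open>m mod t\<close> parts of size
  \<open>m div t + 1\<close>, so large parts can be matched with large ones and small with
  small.\<close>

lemma near_equal_perm:
  assumes "near_equal t m N" "near_equal t m B"
  obtains \<sigma> where "bij_betw \<sigma> {..<t} {..<t}" "\<And>i. i < t \<Longrightarrow> N i = B (\<sigma> i)"
proof -
  let ?A = "\<lambda>M. {i \<in> {..<t}. M i = m div t + 1}" and ?C = "\<lambda>M. {i \<in> {..<t}. M i = m div t}"
  have un: "?A M \<union> ?C M = {..<t}" "?A M \<inter> ?C M = {}" if "near_equal t m M" for M
    using that by (auto simp: near_equal_def)
  have "card (?A N) = card (?A B)" using near_equal_count assms by metis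
  then obtain f where f: "bij_betw f (?A N) (?A B)"
    using finite_same_card_bij[of "?A N" "?A B"] by auto
  have cc: "card (?C M) = t - card (?A M)" if "near_equal t m M" for M
    using un[OF that] card_Un_disjoint[of "?A M" "?C M"] by simp
  have "card (?C N) = card (?C B)"
    unfolding cc[OF assms(1)] cc[OF assms(2)] \<open>card (?A N) = card (?A B)\<close> ..
  then obtain g where g: "bij_betw g (?C N) (?C B)"
    using finite_same_card_bij[of "?C N" "?C B"] by auto
  define \<sigma> where "\<sigma> = (\<lambda>i. if i \<in> ?A N then f i else g i)"
  have 1: "bij_betw \<sigma> (?A N) (?A B)"
    using f by (rule iffD1[OF bij_betw_cong, rotated]) (simp add: \<sigma>_def)
  have 2: "bij_betw \<sigma> (?C N) (?C B)"
    using g by (rule iffD1[OF bij_betw_cong, rotated]) (simp add: \<sigma>_def)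
  have "bij_betw \<sigma> (?A N \<union> ?C N) (?A B \<union> ?C B)"
    using 1 2 un(2)[OF assms(2)] by (rule bij_betw_combine)
  then have "bij_betw \<sigma> {..<t} {..<t}" unfolding un(1)[OF assms(1)] un(1)[OF assms(2)] .
  moreover have "N i = B (\<sigma> i)" if "i < t" for i
  proof -
    have "i \<in> ?A N \<or> i \<in> ?C N" using un(1)[OF assms(1)] that by blast
    then show ?thesis
    proof
      assume "i \<in> ?A N"
      moreover from this have "\<sigma> i \<in> ?A B" using 1 unfolding bij_betw_def by blast
      ultimately show ?thesis by simp
    next
      assume "i \<in> ?C N"
      moreover from this have "\<sigma> i \<in> ?C B" using 2 unfolding bij_betw_def by blast
      ultimately show ?thesis by simp
    qed
  qed
  ultimately show ?thesis using that by blast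
qed

definition even_parts :: "nat \<Rightarrow> nat \<Rightarrow> nat \<Rightarrow> nat" where
  "even_parts t m i = m div t + (if i < m mod t then 1 else 0)"

lemma near_equal_even_parts: "t > 0 \<Longrightarrow> near_equal t m (even_parts t m)"
proof -
  assume t: "t > 0"
  then have "m mod t < t" by simp
  then have "{..<t} \<inter> {i. i < m mod t} = {..<m mod t}" by auto
  then have "(\<Sum>i<t. even_parts t m i) = t * (m div t) + m mod t"
    unfolding even_parts_def by (simp add: sum.distrib sum.If_cases)
  then show ?thesis by (auto simp: near_equal_def even_parts_def)
qed

text \<open>The number of edges of the balanced blowup on \<open>m\<close> vertices.\<close>

definition turan_num :: "nat \<Rightarrow> nat \<Rightarrow> nat \<Rightarrow> nat" where
  "turan_num r t m = esym r {..<t} (even_parts t m)"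

lemma esym_near_equal: "t > 0 \<Longrightarrow> near_equal t m N \<Longrightarrow> esym r {..<t} N = turan_num r t m"
proof -
  assume "t > 0" "near_equal t m N"
  then obtain \<sigma> where \<sigma>: "bij_betw \<sigma> {..<t} {..<t}" "\<And>i. i < t \<Longrightarrow> N i = even_parts t m (\<sigma> i)"
    using near_equal_perm near_equal_even_parts by metis
  have "esym r {..<t} N = esym r {..<t} (\<lambda>i. even_parts t m (\<sigma> i))" by (rule esym_cong) (use \<sigma> in auto)
  then show ?thesis using esym_reindex[OF \<sigma>(1)] by (simp add: turan_num_def)
qed

text \<open>Balancing: moving one vertex from a part to one that is smaller by at least two lowers
  the sum of squares and does not lower \<open>esym\<close>. The alternative \<open>= 0\<close> is
  unavoidable, since with fewer than \<open>r\<close> nonempty parts a move may gain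
  nothing.\<close>

lemma esym_le_turan_num_aux:
  assumes "r \<ge> 2" "t > 0"
  shows "(\<Sum>i<t. N i) = m \<Longrightarrow> esym r {..<t} N \<le> turan_num r t m \<and>
     (near_equal t m N \<or> esym r {..<t} N < turan_num r t m \<or> esym r {..<t} N = 0)"
proof (induction "\<Sum>i<t. N i ^ 2" arbitrary: N rule: less_induct)
  case less
  show ?case
  proof (cases "\<forall>i<t. \<forall>j<t. N i \<le> N j + 1")
    case True
    then have "near_equal t m N" using near_equalI assms less by blast
    then show ?thesis using esym_near_equal assms by auto
  next
    case False
    then obtain i j where ij: "i < t" "j < t" "N i \<ge> N j + 2" by force
    define N' where "N' = N(i := N i - 1, j := N j + 1)"
    obtain d where d: "N i = N j + 2 + d" using ij(3) nat_le_iff_add by blast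
    have ne: "i \<noteq> j" using ij by auto
    define J where "J = {..<t} - {i,j}"
    have J: "finite J" "i \<notin> J" "j \<notin> J" "{..<t} = insert i (insert j J)"
      using ij by (auto simp: J_def)
    have sm: "(\<Sum>k<t. f (N k)) = f (N i) + f (N j) + (\<Sum>k\<in>J. f (N k))"
      "(\<Sum>k<t. f (N' k)) = f (N i - 1) + f (N j + 1) + (\<Sum>k\<in>J. f (N k))" for f :: "nat \<Rightarrow> nat"
    proof -
      show "(\<Sum>k<t. f (N k)) = f (N i) + f (N j) + (\<Sum>k\<in>J. f (N k))"
        using J ne by simp
      have "(\<Sum>k\<in>J. f (N' k)) = (\<Sum>k\<in>J. f (N k))"
        by (rule sum.cong) (use J in \<open>auto simp: N'_def\<close>)
      then show "(\<Sum>k<t. f (N' k)) = f (N i - 1) + f (N j + 1) + (\<Sum>k\<in>J. f (N k))"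
        using J ne by (simp add: N'_def)
    qed
    have "(\<Sum>i<t. N' i ^ 2) < (\<Sum>i<t. N i ^ 2)"
      unfolding sm[of "\<lambda>x. x^2"] using d by (simp add: power2_eq_square algebra_simps)
    moreover have "(\<Sum>i<t. N' i) = m"
      using less(2) unfolding sm[of "\<lambda>x. x"] using d by simp
    ultimately have IH: "esym r {..<t} N' \<le> turan_num r t m" using less(1) by blast
    obtain k where k: "r = Suc (Suc k)" using assms(1) by (metis add_2_eq_Suc le_Suc_ex)
    have c: "esym l J N' = esym l J N" for l by (rule esym_cong) (use J in \<open>auto simp: N'_def\<close>)
    \<comment> \<open>The product of the two altered parts grows by
      \<open>N i - N j - 1 = d + 1\<close>.\<close>
    have "esym r {..<t} N' = esym r {..<t} N + (d + 1) * esym k J N"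
      unfolding k J(4) esym_pair[OF J(1-3) ne] c using d ne by (simp add: N'_def algebra_simps)
    moreover have "esym r {..<t} N = 0" if "esym k J N = 0"
      unfolding k J(4) esym_pair[OF J(1-3) ne] using that esym_eq_0_Suc[OF J(1)] by simp
    ultimately show ?thesis using IH by (cases "esym k J N = 0") auto
  qed
qed

lemma turan_num_ge: "t > 0 \<Longrightarrow> (t choose r) * (m div t) ^ r \<le> turan_num r t m"
  using esym_mono[of "{..<t}" "\<lambda>_. m div t" "even_parts t m" r]
  by (simp add: esym_const turan_num_def even_parts_def)

lemma esym_le_turan_num:
  assumes "r \<ge> 2" "t > 0" "(\<Sum>i<t. N i) = m"
  shows "esym r {..<t} N \<le> turan_num r t m"
  using esym_le_turan_num_aux[OF assms] by blast

text \<open>For \<open>m >= t\<close> every part of the balanced distribution is nonempty, so the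
  maximum is positive and the degenerate alternative of the balancing lemma is excluded.\<close>

lemma esym_eq_turan_num_imp:
  assumes "r \<ge> 2" "t \<ge> r" "(\<Sum>i<t. N i) = m" "esym r {..<t} N = turan_num r t m" "m \<ge> t"
  shows "near_equal t m N"
proof -
  have t: "t > 0" using assms by simp
  have "0 < (t choose r) * (m div t) ^ r"
    using assms t by (simp add: div_greater_zero_iff)
  then have "0 < turan_num r t m" using turan_num_ge[OF t] by (metis le_less_trans not_le)
  then show ?thesis using esym_le_turan_num_aux[OF assms(1) t assms(3)] assms(4) by auto
qed

text \<open>A vertex added to part \<open>0\<close> of the even distribution lies in all transversal
  sets formed with \<open>r - 1\<close> of the other \<open>t - 1\<close> parts, each of size at
  least \<open>m div t\<close>. The new distribution need not be optimal, but it is bounded by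
  \<open>turan_num\<close>.\<close>

lemma turan_num_Suc:
  assumes "r \<ge> 2" "t > 0"
  shows "turan_num r t m + ((t-1) choose (r-1)) * (m div t) ^ (r-1) \<le> turan_num r t (Suc m)"
proof -
  let ?B = "even_parts t m" and ?J = "{..<t} - {0}"
  let ?N = "?B(0 := ?B 0 + 1)"
  have J: "finite ?J" "0 \<notin> ?J" "{..<t} = insert 0 ?J" using assms by auto
  have cJ: "card ?J = t - 1" using assms by simp
  obtain k where k: "r = Suc k" using assms by (cases r) auto
  have sB: "(\<Sum>i<t. ?B i) = m" using near_equal_even_parts[OF assms(2)] by (simp add: near_equal_def)
  have "(\<Sum>i<t. ?N i) = ?N 0 + (\<Sum>i\<in>?J. ?N i)" by (subst J(3), subst sum.insert[OF J(1,2)]) simp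
  also have "(\<Sum>i\<in>?J. ?N i) = (\<Sum>i\<in>?J. ?B i)" by (rule sum.cong) auto
  also have "?N 0 + (\<Sum>i\<in>?J. ?B i) = Suc (?B 0 + (\<Sum>i\<in>?J. ?B i))" by simp
  also have "?B 0 + (\<Sum>i\<in>?J. ?B i) = (\<Sum>i<t. ?B i)" by (subst (2) J(3), subst sum.insert[OF J(1,2)]) simp
  finally have "(\<Sum>i<t. ?N i) = Suc m" using sB by simp
  then have le: "esym r {..<t} ?N \<le> turan_num r t (Suc m)" by (rule esym_le_turan_num[OF assms])
  have c: "esym l ?J ?N = esym l ?J ?B" for l by (rule esym_cong) auto
  have "esym r {..<t} ?N = esym r {..<t} ?B + esym k ?J ?B"
  proof -
    have "esym r {..<t} M = esym r ?J M + M 0 * esym k ?J M" for M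
      unfolding k by (subst J(3)) (rule esym_Suc_insert[OF J(1,2)])
    then show ?thesis using c by simp
  qed
  moreover have "esym k ?J (\<lambda>_. m div t) \<le> esym k ?J ?B"
    by (rule esym_mono) (auto simp: even_parts_def)
  moreover have "esym k ?J (\<lambda>_. m div t) = ((t-1) choose (r-1)) * (m div t) ^ (r-1)"
    using esym_const[OF J(1), of k "m div t"] cJ k by simp
  ultimately show ?thesis using le unfolding turan_num_def by linarith
qed

text \<open>The number a of the overview: edges are measured against \<open>n ^ r\<close>. Measured
  against \<open>n choose r\<close> the limit is larger by the factor \<open>fact r\<close>, which
  gives the threshold of the theorem.\<close>

definition tdens :: "nat \<Rightarrow> nat \<Rightarrow> real" where
  "tdens r t = real (t choose r) / real t ^ r"

text \<open>Multiplying all part sizes by the number of parts makes the perfectly balanced distribution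
  available, so the integral optimum gives the real bound.\<close>

lemma esym_le_tdens:
  assumes "r \<ge> 2" "finite J" "J \<noteq> {}"
  shows "real (esym r J N) \<le> tdens r (card J) * real (\<Sum>i\<in>J. N i) ^ r"
proof -
  let ?t = "card J"
  have t: "?t > 0" using assms by (simp add: card_gt_0_iff)
  obtain \<sigma> where \<sigma>: "bij_betw \<sigma> {..<?t} J"
    using finite_same_card_bij[of "{..<?t}" J] assms by auto
  let ?m = "\<Sum>i\<in>J. N i"
  let ?M = "\<lambda>i. ?t * N (\<sigma> i)"
  have "(\<Sum>i<?t. N (\<sigma> i)) = ?m" using sum.reindex_bij_betw[OF \<sigma>] by metis
  then have sM: "(\<Sum>i<?t. ?M i) = ?t * ?m" by (simp add: sum_distrib_left[symmetric])
  have "?t ^ r * esym r J N = esym r {..<?t} ?M" by (simp add: esym_scale esym_reindex[OF \<sigma>])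
  also have "\<dots> \<le> turan_num r ?t (?t * ?m)" by (rule esym_le_turan_num[OF assms(1) t sM])
  also have "\<dots> = esym r {..<?t} (\<lambda>_. ?m)"
    unfolding turan_num_def by (rule esym_cong) (use t in \<open>simp add: even_parts_def\<close>)
  also have "\<dots> = (?t choose r) * ?m ^ r" by (simp add: esym_const)
  finally have "real (?t ^ r * esym r J N) \<le> real ((?t choose r) * ?m ^ r)"
    by (simp only: of_nat_le_iff)
  then show ?thesis using t unfolding tdens_def by (simp add: field_simps)
qed

lemma turan_num_le_tdens:
  assumes "r \<ge> 2" "t > 0"
  shows "real (turan_num r t m) \<le> tdens r t * real m ^ r"
  using esym_le_tdens[of r "{..<t}" "even_parts t m"] near_equal_even_parts[OF assms(2), of m] assms
  by (simp add: turan_num_def near_equal_def lessThan_empty_iff del: of_nat_sum)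

text \<open>The quotient of the two sides is \<open>(1 - r * x) / (1 - x) ^ r\<close> with
  \<open>x = 1 / t\<close>. Bernoulli is applied with exponent \<open>k = r - 1\<close> only; the
  remaining factor \<open>1 - x\<close> leaves the surplus \<open>k * x^2\<close>, hence strictness.
  The gap is what keeps all parts of a near-optimal colouring linearly large.\<close>

lemma tdens_less:
  assumes "r \<ge> 2" "t \<ge> r"
  shows "tdens r (t - 1) < tdens r t"
proof -
  define x where "x = 1 / real t"
  have t: "t \<ge> 2" using assms by simp
  have x: "0 < x" "x \<le> 1/2" using t unfolding x_def by (auto simp: field_simps)
  obtain k where k: "r = Suc k" "k \<ge> 1" using assms(1) by (cases r) auto
  have "1 + real k * (- x) \<le> (1 + - x) ^ k" by (rule Bernoulli_inequality) (use x in auto)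
  then have "(1 - x) * (1 - real k * x) \<le> (1 - x) * (1 - x) ^ k"
    using x by (intro mult_left_mono) auto
  moreover have "1 - real r * x < (1 - x) * (1 - real k * x)"
    using x k by (simp add: algebra_simps)
  ultimately have B: "1 - real r * x < (1 - x) ^ r" using k by simp
  have "t * (t - 1 choose r) = (t - r) * (t choose r)"
    using binomial_absorb_comp[of t r] by simp
  then have "real t * real (t - 1 choose r) = real (t - r) * real (t choose r)"
    by (metis of_nat_mult)
  then have e: "real (t - 1 choose r) = (1 - real r * x) * real (t choose r)"
    using t assms by (simp add: x_def of_nat_diff field_simps)
  have "real (t - 1) = real t * (1 - x)" using t by (simp add: x_def of_nat_diff field_simps)
  then have "tdens r (t - 1) = (1 - real r * x) / (1 - x) ^ r * tdens r t"
    unfolding tdens_def e by (simp add: power_mult_distrib)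
  moreover have "(1 - real r * x) / (1 - x) ^ r < 1"
    using B x by (simp add: divide_less_eq)
  moreover have "tdens r t > 0" using assms t by (simp add: tdens_def)
  ultimately show ?thesis using mult_strict_right_mono by fastforce
qed

section \<open>Transversal sets of a colouring\<close>

definition transv :: "('v \<Rightarrow> nat) \<Rightarrow> 'v set \<Rightarrow> nat set \<Rightarrow> nat \<Rightarrow> 'v set set" where
  "transv \<chi> V J k = {A. A \<subseteq> V \<and> card A = k \<and> inj_on \<chi> A \<and> \<chi> ` A \<subseteq> J}"

definition part :: "('v \<Rightarrow> nat) \<Rightarrow> 'v set \<Rightarrow> nat \<Rightarrow> 'v set" where
  "part \<chi> V i = {v \<in> V. \<chi> v = i}"

lemma finite_transv: "finite V \<Longrightarrow> finite (transv \<chi> V J k)"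
  unfolding transv_def by (rule finite_subset[of _ "Pow V"]) auto

lemma card_transv_insert_pairs:
  assumes "finite V" "j \<notin> J"
  shows "card ((\<lambda>(v,A). insert v A) ` (part \<chi> V j \<times> transv \<chi> V J k)) = card (part \<chi> V j) * card (transv \<chi> V J k)"
proof -
  have "inj_on (\<lambda>(v,A). insert v A) (part \<chi> V j \<times> transv \<chi> V J k)"
  proof (rule inj_onI; clarsimp)
    fix v A w B assume *: "v \<in> part \<chi> V j" "A \<in> transv \<chi> V J k" "w \<in> part \<chi> V j" "B \<in> transv \<chi> V J k"
      "insert v A = insert w B"
    have no: "x \<notin> C" if "x \<in> part \<chi> V j" "C \<in> transv \<chi> V J k" for x C
      using that assms(2) by (auto simp: part_def transv_def)
    have n: "v \<notin> A" "w \<notin> B" "v \<notin> B" using * no by blast+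
    have "v = w" using *(5) n(3) by (metis insertE insertI1)
    moreover have "A = B" using *(5) n calculation by (metis insert_ident)
    ultimately show "v = w \<and> A = B" ..
  qed
  then show ?thesis by (simp add: card_image card_cartesian_product)
qed

text \<open>Follows the recursion \<open>esym_Suc_insert\<close>: a transversal set omits colour
  \<open>j\<close>, or it is a smaller one without \<open>j\<close> plus a vertex of part
  \<open>j\<close>.\<close>

lemma card_transv:
  assumes "finite V" "finite J"
  shows "card (transv \<chi> V J k) = esym k J (\<lambda>i. card (part \<chi> V i))"
  using assms(2)
proof (induction J arbitrary: k rule: finite_induct)
  case empty
  show ?case
  proof (cases k)
    case 0
    have "transv \<chi> V {} 0 = {{}}" unfolding transv_def by auto
    then show ?thesis using 0 by simp
  next
    case (Suc l)
    have "transv \<chi> V {} (Suc l) = {}" unfolding transv_def by auto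
    then show ?thesis using Suc by simp
  qed
next
  case (insert j J)
  show ?case
  proof (cases k)
    case 0
    have "transv \<chi> V (insert j J) 0 = {{}}" using finite_subset[OF _ assms(1)] unfolding transv_def by auto
    then show ?thesis using 0 insert by simp
  next
    case (Suc l)
    let ?B = "(\<lambda>(v,A). insert v A) ` (part \<chi> V j \<times> transv \<chi> V J l)"
    have eq: "transv \<chi> V (insert j J) (Suc l) = transv \<chi> V J (Suc l) \<union> ?B"
    proof (intro equalityI subsetI)
      fix A assume A: "A \<in> transv \<chi> V (insert j J) (Suc l)"
      then have A': "A \<subseteq> V" "card A = Suc l" "inj_on \<chi> A" "\<chi> ` A \<subseteq> insert j J" "finite A"
        using assms(1) by (auto simp: transv_def intro: finite_subset)
      show "A \<in> transv \<chi> V J (Suc l) \<union> ?B"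
      proof (cases "j \<in> \<chi> ` A")
        case True
        then obtain v where v: "v \<in> A" "\<chi> v = j" by auto
        have "A - {v} \<in> transv \<chi> V J l"
          using A' v unfolding transv_def by (auto simp: inj_on_def)
        moreover have "v \<in> part \<chi> V j" using v A' by (auto simp: part_def)
        moreover have "A = insert v (A - {v})" using v by auto
        ultimately show ?thesis by (metis (mono_tags, lifting) UnI2 case_prod_conv image_eqI mem_Sigma_iff)
      next
        case False
        then show ?thesis using A' by (auto simp: transv_def)
      qed
    next
      fix A assume "A \<in> transv \<chi> V J (Suc l) \<union> ?B"
      then show "A \<in> transv \<chi> V (insert j J) (Suc l)"
      proof
        assume "A \<in> transv \<chi> V J (Suc l)"
        then show ?thesis by (auto simp: transv_def)
      next
        assume "A \<in> ?B"
        then obtain v A' where v: "v \<in> part \<chi> V j" "A' \<in> transv \<chi> V J l" "A = insert v A'" by auto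
        then have "\<chi> v \<notin> \<chi> ` A'" "v \<notin> A'" "finite A'" using insert(2) assms(1)
          by (auto simp: transv_def part_def intro: finite_subset)
        then show ?thesis using v by (auto simp: transv_def part_def)
      qed
    qed
    have "transv \<chi> V J (Suc l) \<inter> ?B = {}"
      using insert(2) by (auto simp: transv_def part_def)
    moreover have "finite ?B" using assms(1) by (simp add: finite_transv part_def)
    ultimately have "card (transv \<chi> V (insert j J) (Suc l)) = card (transv \<chi> V J (Suc l)) + card ?B"
      unfolding eq by (intro card_Un_disjoint finite_transv assms(1)) auto
    then show ?thesis using insert card_transv_insert_pairs[OF assms(1) insert(2)] Suc
      by (simp add: esym_Suc_insert)
  qed
qed

lemma sum_card_part:
  assumes "finite V" "finite J" "\<chi> ` V \<subseteq> J"
  shows "(\<Sum>i\<in>J. card (part \<chi> V i)) = card V"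
proof -
  have "V = (\<Union>i\<in>J. part \<chi> V i)" using assms(3) by (auto simp: part_def)
  then have "card V = card (\<Union>i\<in>J. part \<chi> V i)" by simp
  also have "\<dots> = (\<Sum>i\<in>J. card (part \<chi> V i))"
    by (rule card_UN_disjoint) (use assms in \<open>auto simp: part_def\<close>)
  finally show ?thesis by simp
qed

lemma sum_card_part_le:
  assumes "finite V" "finite J"
  shows "(\<Sum>i\<in>J. card (part \<chi> V i)) \<le> card V"
proof -
  have "(\<Sum>i\<in>J. card (part \<chi> V i)) = card (\<Union>i\<in>J. part \<chi> V i)"
    by (rule card_UN_disjoint[symmetric]) (use assms in \<open>auto simp: part_def\<close>)
  also have "\<dots> \<le> card V" by (rule card_mono) (use assms in \<open>auto simp: part_def\<close>)
  finally show ?thesis .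
qed

text \<open>The set \<open>J\<close> may omit colours that occur in \<open>V\<close>; with one
  colour left out the bound yields the lower estimate for part sizes.\<close>

lemma card_transv_le:
  assumes "r \<ge> 2" "finite V" "finite J" "J \<noteq> {}"
  shows "real (card (transv \<chi> V J r)) \<le> tdens r (card J) * real (card V) ^ r"
proof -
  have "real (card (transv \<chi> V J r)) \<le> tdens r (card J) * real (\<Sum>i\<in>J. card (part \<chi> V i)) ^ r"
    unfolding card_transv[OF assms(2,3)] by (rule esym_le_tdens) (use assms in auto)
  also have "\<dots> \<le> tdens r (card J) * real (card V) ^ r"
    using sum_card_part_le[OF assms(2,3), of \<chi>]
    by (intro mult_left_mono power_mono) (auto simp: tdens_def simp flip: of_nat_sum)
  finally show ?thesis .
qed

section \<open>Convergence to the Turan density\<close>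

lemma free_rgraphs_card_le: "G \<in> free_rgraphs r n F \<Longrightarrow> card (edges G) \<le> n choose r"
proof -
  assume "G \<in> free_rgraphs r n F"
  then have G: "finite (verts G)" "card (verts G) = n" "edges G \<subseteq> {e. e \<subseteq> verts G \<and> card e = r}"
    by (auto simp: free_rgraphs_def rgraph_def)
  have "card (edges G) \<le> card {e. e \<subseteq> verts G \<and> card e = r}"
    by (rule card_mono[OF _ G(3)]) (use G(1) in auto)
  then show ?thesis using G by (simp add: n_subsets)
qed

lemma finite_free_cards: "finite ((\<lambda>G. card (edges G)) ` free_rgraphs r n F)"
  by (rule finite_subset[of _ "{..n choose r}"]) (use free_rgraphs_card_le in auto)

lemma card_le_turan_ex: "G \<in> free_rgraphs r n F \<Longrightarrow> card (edges G) \<le> turan_ex r n F"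
  unfolding turan_ex_def by (rule cSup_upper) (auto intro: finite_free_cards bdd_above_finite)

lemma turan_ex_attained:
  assumes "turan_ex r n F > 0"
  obtains G where "G \<in> free_rgraphs r n F" "card (edges G) = turan_ex r n F"
proof -
  let ?X = "(\<lambda>G. card (edges G)) ` free_rgraphs r n F"
  have "?X \<noteq> {}" using assms unfolding turan_ex_def by (auto simp: Sup_nat_def)
  then have "turan_ex r n F \<in> ?X"
    using Max_in[OF finite_free_cards] unfolding turan_ex_def Sup_nat_def by auto
  then show ?thesis using that by auto
qed

text \<open>Averaging over vertex deletions: an edge of an optimal graph on \<open>Suc n\<close>
  vertices survives exactly \<open>Suc n - r\<close> of them, and every deletion leaves a free graph
  on \<open>n\<close> vertices.\<close>

lemma turan_ex_Suc: "turan_ex r (Suc n) F * (Suc n - r) \<le> Suc n * turan_ex r n F"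
proof (cases "turan_ex r (Suc n) F = 0")
  case True
  then show ?thesis by simp
next
  case False
  then obtain G where G: "G \<in> free_rgraphs r (Suc n) F" "card (edges G) = turan_ex r (Suc n) F"
    using turan_ex_attained by blast
  let ?V = "verts G" and ?E = "edges G"
  have V: "finite ?V" "card ?V = Suc n" and E: "\<And>e. e \<in> ?E \<Longrightarrow> e \<subseteq> ?V \<and> card e = r"
    using G(1) by (auto simp: free_rgraphs_def rgraph_def)
  have fE: "finite ?E" by (rule finite_subset[of _ "Pow ?V"]) (use E V in auto)
  have le: "card {e \<in> ?E. v \<notin> e} \<le> turan_ex r n F" if v: "v \<in> ?V" for v
  proof -
    let ?H = "\<lparr>verts = ?V - {v}, edges = {e \<in> ?E. v \<notin> e}\<rparr>"
    have "hg_free F ?H"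
      using G(1) unfolding free_rgraphs_def hg_free_def subhgraph_def by auto
    then have "?H \<in> free_rgraphs r n F"
      using V E v unfolding free_rgraphs_def rgraph_def by auto
    then show ?thesis using card_le_turan_ex by fastforce
  qed
  have "(\<Sum>v\<in>?V. card {e \<in> ?E. v \<notin> e}) = (\<Sum>e\<in>?E. card {v \<in> ?V. v \<notin> e})"
    unfolding card_eq_sum using V fE by (subst sum.swap_restrict) auto
  also have "\<dots> = (\<Sum>e\<in>?E. Suc n - r)"
  proof (rule sum.cong[OF refl])
    fix e assume "e \<in> ?E"
    then have "e \<subseteq> ?V" "card e = r" "finite e" using E V finite_subset by blast+
    moreover have "{v \<in> ?V. v \<notin> e} = ?V - e" by auto
    ultimately show "card {v \<in> ?V. v \<notin> e} = Suc n - r" using V by (simp add: card_Diff_subset)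
  qed
  finally have "turan_ex r (Suc n) F * (Suc n - r) = (\<Sum>v\<in>?V. card {e \<in> ?E. v \<notin> e})"
    using G(2) by simp
  also have "\<dots> \<le> (\<Sum>v\<in>?V. turan_ex r n F)" by (rule sum_mono) (use le in auto)
  finally show ?thesis using V by simp
qed

text \<open>\<open>turan_density\<close> is defined through \<open>lim\<close>, which says nothing
  until convergence is known. The ratios decrease and are nonnegative.\<close>

lemma turan_density_limit:
  "(\<lambda>n. real (turan_ex r n F) / real (n choose r)) \<longlonglongrightarrow> turan_density r F"
proof -
  let ?f = "\<lambda>n. real (turan_ex r n F) / real (n choose r)"
  have step: "?f (Suc n) \<le> ?f n" if n: "n \<ge> r" for n
  proof -
    have pos: "n choose r > 0" "Suc n choose r > 0" "Suc n - r > 0" using n by auto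
    have b: "(Suc n - r) * (Suc n choose r) = Suc n * (n choose r)"
      using binomial_absorb_comp[of "Suc n" r] by simp
    have "turan_ex r (Suc n) F * (n choose r) * Suc n
        = turan_ex r (Suc n) F * (Suc n - r) * (Suc n choose r)"
      using b by (metis mult.assoc mult.commute)
    also have "\<dots> \<le> Suc n * turan_ex r n F * (Suc n choose r)"
      by (rule mult_right_mono[OF turan_ex_Suc]) simp
    finally have "Suc n * (turan_ex r (Suc n) F * (n choose r)) \<le> Suc n * (turan_ex r n F * (Suc n choose r))"
      by (simp only: ac_simps)
    then have "turan_ex r (Suc n) F * (n choose r) \<le> turan_ex r n F * (Suc n choose r)"
      by (simp only: Suc_mult_le_cancel1)
    then have "real (turan_ex r (Suc n) F) * real (n choose r) \<le> real (turan_ex r n F) * real (Suc n choose r)"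
      by (metis of_nat_le_iff of_nat_mult)
    then show ?thesis using pos by (simp add: divide_simps del: binomial_Suc_Suc)
  qed
  \<comment> \<open>Shifted by \<open>r\<close>, because monotonicity needs
    \<open>n choose r > 0\<close>.\<close>
  have "decseq (\<lambda>n. ?f (n + r))" unfolding decseq_Suc_iff using step by simp
  then obtain L where "(\<lambda>n. ?f (n + r)) \<longlonglongrightarrow> L"
    by (rule decseq_convergent[where B = 0]) auto
  then have "?f \<longlonglongrightarrow> L" by (rule LIMSEQ_offset)
  then show ?thesis unfolding turan_density_def by (simp add: limI)
qed

lemma turan_density_nonneg: "turan_density r F \<ge> 0"
  by (rule tendsto_lowerbound[OF turan_density_limit]) auto

text \<open>With \<open>c\<close> halfway between the density and \<open>fact r * d\<close>, the
  ratios are eventually below \<open>c\<close>; \<open>n choose r <= n^r / r!\<close> then gives the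
  bound with the margin \<kappa> \<open>= d - c / fact r\<close>.\<close>

lemma embeds_free_edge_bound:
  fixes F :: "'a hgraph"
  assumes F: "rgraph r F" and dens: "turan_density r F < fact r * d"
  obtains \<kappa> n1 where "\<kappa> > 0"
    "\<And>(V :: nat set) E. unif r V E \<Longrightarrow> card V \<ge> n1 \<Longrightarrow> \<not> embeds F V E \<Longrightarrow>
       real (card E) \<le> (d - \<kappa>) * real (card V) ^ r"
proof -
  define c where "c = (turan_density r F + fact r * d) / 2"
  have c: "turan_density r F < c" "c < fact r * d" "c \<ge> 0"
    using dens turan_density_nonneg[of r F] unfolding c_def by argo+
  have "\<forall>\<^sub>F n in at_top. real (turan_ex r n F) / real (n choose r) < c"
    using order_tendstoD(2)[OF turan_density_limit c(1)] .
  then obtain n0 where n0: "\<And>n. n \<ge> n0 \<Longrightarrow> real (turan_ex r n F) / real (n choose r) < c"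
    by (auto simp: eventually_at_top_linorder)
  show ?thesis
  proof (rule that[of "d - c / fact r" "max n0 r"])
    show "d - c / fact r > 0" using c by (simp add: field_simps)
  next
    fix V :: "nat set" and E assume E: "unif r V E" "card V \<ge> max n0 r" "\<not> embeds F V E"
    let ?n = "card V"
    have "\<lparr>verts = V, edges = E\<rparr> \<in> free_rgraphs r ?n F"
      using E F hg_free_iff_embeds[of F "\<lparr>verts = V, edges = E\<rparr>"]
      by (auto simp: free_rgraphs_def rgraph_def unif_def)
    then have "card E \<le> turan_ex r ?n F" using card_le_turan_ex by fastforce
    then have "real (card E) \<le> real (turan_ex r ?n F)" by simp
    also have "\<dots> \<le> c * real (?n choose r)"
      using n0[of ?n] E by (simp add: divide_less_eq split: if_splits)
    also have "\<dots> \<le> c * (real ?n ^ r / fact r)"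
    proof (rule mult_left_mono[OF _ c(3)])
      have "real ((?n choose r) * fact r) \<le> real (?n ^ r)"
        using binomial_fact_pow of_nat_le_iff by blast
      then show "real (?n choose r) \<le> real ?n ^ r / fact r" by (simp add: field_simps)
    qed
    finally show "real (card E) \<le> (d - (d - c / fact r)) * real ?n ^ r" by simp
  qed
qed

section \<open>Degrees and cleaning\<close>

definition deg :: "'v set set \<Rightarrow> 'v set \<Rightarrow> nat" where
  "deg \<A> X = card {A \<in> \<A>. X \<subseteq> A}"

lemma card_subsets_le_pow: "finite V \<Longrightarrow> card {B. B \<subseteq> V \<and> card B = k} \<le> card V ^ k"
proof -
  assume "finite V"
  have "(card V choose k) * 1 \<le> (card V choose k) * fact k" by (intro mult_le_mono2) simp
  also have "\<dots> \<le> card V ^ k" by (rule binomial_fact_pow)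
  finally show ?thesis using \<open>finite V\<close> by (simp add: n_subsets)
qed

text \<open>Removing \<open>X\<close> is injective on the members containing it and yields sets of
  size \<open>r - card X\<close>. The multiplied form stays correct for \<open>card X > r\<close>,
  where no member contains \<open>X\<close>.\<close>

lemma deg_mult_le:
  assumes "unif r V \<A>" "finite X"
  shows "deg \<A> X * card V ^ card X \<le> card V ^ r"
proof (cases "{A \<in> \<A>. X \<subseteq> A} = {}")
  case True
  then show ?thesis unfolding deg_def by (simp only: card.empty)
next
  case False
  have V: "finite V" and A: "\<And>A. A \<in> \<A> \<Longrightarrow> A \<subseteq> V \<and> card A = r \<and> finite A"
    using assms finite_subset unfolding unif_def by blast+
  from False obtain A0 where A0: "A0 \<in> \<A>" "X \<subseteq> A0" by blast
  then have le: "card X \<le> r" using A[of A0] by (metis card_mono)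
  let ?B = "{B. B \<subseteq> V \<and> card B = r - card X}"
  have "inj_on (\<lambda>A. A - X) {A \<in> \<A>. X \<subseteq> A}" by (rule inj_onI) blast
  moreover have "(\<lambda>A. A - X) ` {A \<in> \<A>. X \<subseteq> A} \<subseteq> ?B"
    using A assms(2) by (auto simp: card_Diff_subset)
  ultimately have "deg \<A> X \<le> card ?B"
    unfolding deg_def using V by (intro card_inj_on_le) auto
  also have "\<dots> \<le> card V ^ (r - card X)" by (rule card_subsets_le_pow[OF V])
  finally have "deg \<A> X * card V ^ card X \<le> card V ^ (r - card X) * card V ^ card X"
    by (rule mult_le_mono1)
  then show ?thesis using le by (simp flip: power_add)
qed

lemma ex_max_on:
  fixes f :: "'b \<Rightarrow> real"
  assumes "finite S" "S \<noteq> {}"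
  obtains x where "x \<in> S" "\<And>y. y \<in> S \<Longrightarrow> f y \<le> f x"
proof -
  have "Max (f ` S) \<in> f ` S" using assms by simp
  then obtain x where "x \<in> S" "f x = Max (f ` S)" by auto
  then show ?thesis using that assms by simp
qed

text \<open>If \<open>Q\<close> witnesses the failure, every edge through \<open>x\<close> and
  \<open>y\<close> contains a third vertex in \<open>Q\<close>. Each of the at most \<open>q\<close>
  resulting triples lies in at most \<open>n^(r-3)\<close> edges.\<close>

lemma not_rich_deg:
  assumes E: "unif r V E" and xy: "x \<noteq> y" and nr: "\<not> rich q E {x,y}"
  shows "deg E {x,y} * card V ^ 3 \<le> q * card V ^ r"
proof -
  obtain Q where Q: "finite Q" "card Q \<le> q" "\<And>e. e \<in> E \<Longrightarrow> {x,y} \<subseteq> e \<Longrightarrow> \<not> e \<inter> Q \<subseteq> {x,y}"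
    using nr unfolding rich_def by metis
  have fE: "finite E" using E by (rule unif_finite_edges)
  have "{e \<in> E. {x,y} \<subseteq> e} \<subseteq> (\<Union>z\<in>Q - {x,y}. {e \<in> E. {x,y,z} \<subseteq> e})"
  proof
    fix e assume "e \<in> {e \<in> E. {x,y} \<subseteq> e}"
    then have e: "e \<in> E" "{x,y} \<subseteq> e" by auto
    with Q(3)[of e] obtain z where "z \<in> e" "z \<in> Q" "z \<notin> {x,y}" by blast
    then show "e \<in> (\<Union>z\<in>Q - {x,y}. {e \<in> E. {x,y,z} \<subseteq> e})" using e by blast
  qed
  then have "deg E {x,y} \<le> card (\<Union>z\<in>Q - {x,y}. {e \<in> E. {x,y,z} \<subseteq> e})"
    unfolding deg_def by (rule card_mono[rotated]) (use Q fE in auto)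
  also have "\<dots> \<le> (\<Sum>z\<in>Q - {x,y}. deg E {x,y,z})"
    unfolding deg_def by (rule card_UN_le) (use Q in auto)
  finally have "deg E {x,y} * card V ^ 3 \<le> (\<Sum>z\<in>Q - {x,y}. deg E {x,y,z}) * card V ^ 3"
    by (rule mult_le_mono1)
  also have "\<dots> \<le> (\<Sum>z\<in>Q - {x,y}. card V ^ r)"
    unfolding sum_distrib_right
  proof (rule sum_mono)
    fix z assume "z \<in> Q - {x,y}"
    then have "card {x,y,z} = 3" using xy by auto
    then show "deg E {x,y,z} * card V ^ 3 \<le> card V ^ r"
      using deg_mult_le[OF E, of "{x,y,z}"] by simp
  qed
  also have "\<dots> \<le> q * card V ^ r"
    using card_mono[OF Q(1), of "Q - {x,y}"] Q(2) by simp
  finally show ?thesis .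
qed

text \<open>\<open>E'\<close> maximises the number of edges plus a multiple \<open>K\<close> of the number of uncovered pairs:
  uncovering a pair that is not rich would cost fewer than \<open>K\<close> edges.\<close>

lemma clean:
  assumes E: "unif r V E" and r: "r \<ge> 2"
  obtains E' where "E' \<subseteq> E" "\<And>x y. x \<noteq> y \<Longrightarrow> covered E' x y \<Longrightarrow> rich q E' {x,y}"
    "(real (card E) - real (card E')) * real (card V) \<le> real (q + 1) * real (card V) ^ r"
proof (cases "\<forall>x y. x \<noteq> y \<longrightarrow> covered E x y \<longrightarrow> rich q E {x,y}")
  case True
  then show ?thesis using that[of E] by simp
next
  case False
  then obtain x y where xy: "x \<noteq> y" "covered E x y" by blast
  let ?n = "real (card V)"
  have V: "finite V" and fE: "finite E" using E unif_finite_edges unfolding unif_def by auto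
  \<comment> \<open>The covered pair serves only to make the division by \<open>n^3\<close> in
    \<open>K\<close> meaningful.\<close>
  have "V \<noteq> {}" using xy E unfolding covered_def unif_def by blast
  then have n: "?n \<ge> 1" using V by (simp add: card_gt_0_iff Suc_leI)
  \<comment> \<open>By \<open>not_rich_deg\<close> a pair that is not rich lies in at most
    \<open>q * n^r / n^3\<close> edges; the added \<open>1\<close> makes \<open>K\<close> strictly
    larger.\<close>
  define K where "K = (real q * ?n ^ r + 1) / ?n ^ 3"
  define U where "U = (\<lambda>E0. {P. P \<subseteq> V \<and> card P = 2 \<and> \<not> (\<exists>e\<in>E0. P \<subseteq> e)})"
  define \<Phi> where "\<Phi> = (\<lambda>E0 :: 'a set set. real (card E0) + K * real (card (U E0)))"
  have fU: "finite (U E0)" for E0 unfolding U_def using V by auto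
  have K: "K \<ge> 0" unfolding K_def using n by simp
  obtain E' where E': "E' \<subseteq> E" "\<And>E0. E0 \<subseteq> E \<Longrightarrow> \<Phi> E0 \<le> \<Phi> E'"
    using ex_max_on[of "Pow E" \<Phi>] fE by auto
  have fE': "finite E'" using E'(1) fE by (rule finite_subset)
  have uE': "unif r V E'" using E E'(1) by (rule unif_mono)
  have rich: "rich q E' {x,y}" if xy: "x \<noteq> y" "covered E' x y" for x y
  proof (rule ccontr)
    assume nr: "\<not> rich q E' {x,y}"
    define D where "D = {e \<in> E'. {x,y} \<subseteq> e}"
    have fD: "finite D" "D \<subseteq> E'" using fE' by (auto simp: D_def)
    have "card D * card V ^ 3 \<le> q * card V ^ r"
      using not_rich_deg[OF uE' xy(1) nr] unfolding D_def deg_def .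
    then have "real (card D * card V ^ 3) \<le> real (q * card V ^ r)" by (simp only: of_nat_le_iff)
    then have "real (card D) < K" unfolding K_def using n by (simp add: less_divide_eq)
    moreover have "insert {x,y} (U E') \<subseteq> U (E' - D)" and "{x,y} \<notin> U E'"
    proof -
      obtain e where e: "e \<in> E'" "x \<in> e" "y \<in> e" using xy unfolding covered_def by blast
      then have "{x,y} \<subseteq> V" using uE' unfolding unif_def by blast
      then show "insert {x,y} (U E') \<subseteq> U (E' - D)" using xy(1) by (auto simp: U_def D_def)
      show "{x,y} \<notin> U E'" using e by (auto simp: U_def)
    qed
    then have "card (U E') + 1 \<le> card (U (E' - D))"
      using card_mono[OF fU[of "E' - D"]] fU by (metis Suc_eq_plus1 card_insert_disjoint)
    then have "K * (real (card (U E')) + 1) \<le> K * real (card (U (E' - D)))"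
      using K by (intro mult_left_mono) auto
    moreover have "real (card (E' - D)) = real (card E') - real (card D)"
      using fD card_mono[OF fE' fD(2)] by (simp add: card_Diff_subset of_nat_diff)
    ultimately have "\<Phi> (E' - D) > \<Phi> E'" unfolding \<Phi>_def by (simp add: algebra_simps)
    then show False using E'(2)[of "E' - D"] E'(1) by force
  qed
  \<comment> \<open>Since at most \<open>n^2\<close> pairs are uncovered, maximality limits the loss
    to \<open>K * n^2\<close>, which is of order \<open>n^(r-1)\<close>.\<close>
  have "card (U E') \<le> card {B. B \<subseteq> V \<and> card B = 2}" by (rule card_mono) (use V in \<open>auto simp: U_def\<close>)
  also have "\<dots> \<le> card V ^ 2" by (rule card_subsets_le_pow[OF V])
  finally have cU: "real (card (U E')) \<le> ?n ^ 2" by (metis of_nat_le_iff of_nat_power)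
  have "\<Phi> E \<le> \<Phi> E'" using E'(2) by blast
  moreover have "0 \<le> K * real (card (U E))" using K by simp
  ultimately have "real (card E) - real (card E') \<le> K * real (card (U E'))" unfolding \<Phi>_def by linarith
  also have "\<dots> \<le> K * ?n ^ 2" using K cU by (rule mult_left_mono[rotated])
  finally have "(real (card E) - real (card E')) * ?n \<le> K * ?n ^ 2 * ?n"
    by (rule mult_right_mono) simp
  also have "\<dots> = real q * ?n ^ r + 1" unfolding K_def using n by (simp add: field_simps power3_eq_cube power2_eq_square)
  also have "\<dots> \<le> real (q + 1) * ?n ^ r" using n by (simp add: algebra_simps)
  finally show ?thesis using that[OF E'(1) rich] by blast
qed

text \<open>All pairs of a core in \<open>E'\<close> are covered, hence rich, so the core would
  extend to a copy of the extension with no exceptional pair.\<close>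

lemma rich_no_core:
  assumes "r \<ge> 2" "rgraph r F" "card (verts F) \<le> t" "unif r V E"
    and nemb: "\<not> embeds (Ext r (add_isolated (t + 1) F)) V E"
    and E': "E' \<subseteq> E" "\<And>x y. x \<noteq> y \<Longrightarrow> covered E' x y \<Longrightarrow> rich q E' {x,y}"
    and q: "t + 1 + r + r * 2 ^ (t + 1) \<le> q"
  shows "\<not> has_core t F V E'"
proof
  assume "has_core t F V E'"
  then obtain S \<phi> where S: "S \<subseteq> V" "card S = t + 1" "\<And>x y. x \<in> S \<Longrightarrow> y \<in> S \<Longrightarrow> x \<noteq> y \<Longrightarrow> covered E' x y"
    "inj_on \<phi> (verts F)" "\<phi> ` verts F \<subseteq> S" "\<And>e. e \<in> edges F \<Longrightarrow> \<phi> ` e \<in> E'"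
    by (rule has_coreE) blast
  have rich: "rich q E' P" if P: "P \<subseteq> S" "card P = 2" for P
  proof -
    obtain x y where xy: "P = {x,y}" "x \<noteq> y" using P(2) by (meson card_2_iff)
    then have "covered E' x y" using P S(3) by auto
    then show ?thesis using xy E'(2) by simp
  qed
  have "embeds (Ext r (add_isolated (t + 1) F)) V E'"
    using core_embeds_Ext[OF assms(1-3) unif_mono[OF assms(4) E'(1)] S(1,2) S(4,5), of "{}" "{}" q] S(6) q rich
    by simp
  then show False using nemb embeds_mono[OF _ subset_refl E'(1)] by blast
qed

section \<open>Symmetrization\<close>

definition link :: "'v set set \<Rightarrow> 'v \<Rightarrow> 'v set set" where
  "link E u = {B. u \<notin> B \<and> insert u B \<in> E}"

text \<open>The edge set is pulled back along the map sending \<open>v\<close> to \<open>u\<close>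
  and fixing all else: the old edges at \<open>v\<close> disappear and \<open>v\<close> receives
  those of \<open>u\<close>. Injectivity on edges excludes edges containing both.\<close>

definition clone :: "'v set \<Rightarrow> 'v set set \<Rightarrow> 'v \<Rightarrow> 'v \<Rightarrow> 'v set set" where
  "clone V E u v = {e. e \<subseteq> V \<and> inj_on (id(v := u)) e \<and> id(v := u) ` e \<in> E}"

text \<open>A common edge without \<open>x\<close> belongs to the link of \<open>x\<close> and
  contains \<open>y\<close>, so it cannot belong to the link of \<open>y\<close>. Thus vertices with
  equal links form an independent class.\<close>

lemma covered_imp_link_neq:
  assumes "covered E x y" "x \<noteq> y"
  shows "link E x \<noteq> link E y"
proof
  assume eq: "link E x = link E y"
  obtain e where e: "e \<in> E" "x \<in> e" "y \<in> e" using assms by (auto simp: covered_def)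
  then have "e - {x} \<in> link E x" by (auto simp: link_def insert_absorb)
  then have "y \<notin> e - {x}" unfolding eq by (simp add: link_def)
  then show False using e assms by blast
qed

lemma unif_clone: "unif r V E \<Longrightarrow> unif r V (clone V E u v)"
  unfolding unif_def clone_def by (auto dest!: card_image[symmetric])

lemma clone_agree: "unif r V E \<Longrightarrow> v \<notin> e \<Longrightarrow> e \<in> clone V E u v \<longleftrightarrow> e \<in> E"
proof -
  assume "unif r V E" "v \<notin> e"
  moreover have "id(v := u) ` e = e" using \<open>v \<notin> e\<close> by auto
  moreover have "inj_on (id(v := u)) e" using \<open>v \<notin> e\<close> by (auto simp: inj_on_def)
  ultimately show ?thesis unfolding clone_def unif_def by auto
qed

lemma card_edges_at: "card {e \<in> E. v \<in> e} = card (link E v)"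
proof -
  have "{e \<in> E. v \<in> e} = insert v ` link E v"
  proof (intro equalityI subsetI)
    fix e assume "e \<in> {e \<in> E. v \<in> e}"
    then have "e - {v} \<in> link E v" "e = insert v (e - {v})" by (auto simp: link_def insert_absorb)
    then show "e \<in> insert v ` link E v" by blast
  qed (auto simp: link_def)
  moreover have "inj_on (insert v) (link E v)" by (auto simp: inj_on_def link_def)
  ultimately show ?thesis by (simp add: card_image)
qed

lemma link_uncovered: "\<not> covered E u v \<Longrightarrow> B \<in> link E u \<Longrightarrow> v \<notin> B"
  unfolding covered_def link_def by blast

text \<open>The new link is determined by the old one and membership of \<open>a\<close> in
  \<open>V\<close>. Hence vertices of \<open>V\<close> other than \<open>v\<close> with equal links
  keep equal links.\<close>

lemma link_clone:
  assumes "a \<noteq> v"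
  shows "link (clone V E u v) a =
    {B. insert a B \<subseteq> V \<and> inj_on (id(v := u)) B \<and> id(v := u) ` B \<in> link E a}"
proof -
  let ?f = "id(v := u)"
  have fa: "?f a = a" using assms by simp
  have "B \<in> link (clone V E u v) a \<longleftrightarrow> insert a B \<subseteq> V \<and> inj_on ?f B \<and> ?f ` B \<in> link E a" for B
  proof -
    have "?f ` insert a B = insert a (?f ` B)" unfolding image_insert fa ..
    moreover have "a \<notin> ?f ` B \<Longrightarrow> a \<notin> B" using fa by force
    moreover have "a \<notin> B \<Longrightarrow> inj_on ?f (insert a B) \<longleftrightarrow> inj_on ?f B \<and> a \<notin> ?f ` B"
      using fa by (simp add: inj_on_insert)
    ultimately show ?thesis unfolding link_def clone_def by auto
  qed
  then show ?thesis by blast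
qed

context
  fixes r :: nat and V :: "'v set" and E u v
  assumes E: "unif r V E" and uv: "u \<in> V" "v \<in> V" "u \<noteq> v" "\<not> covered E u v"
begin

lemma link_clone_self: "link (clone V E u v) v = link E u"
proof (intro equalityI subsetI)
  let ?f = "id(v := u)"
  fix B assume "B \<in> link (clone V E u v) v"
  then have B: "v \<notin> B" "insert v B \<subseteq> V" "inj_on ?f (insert v B)" "?f ` insert v B \<in> E"
    by (auto simp: link_def clone_def)
  have im: "?f ` B = B" using B(1) by auto
  have "u \<notin> B"
  proof
    assume "u \<in> B"
    then have "?f u = ?f v" "u \<in> insert v B" "v \<in> insert v B" by auto
    then show False using B(3) uv(3) unfolding inj_on_def by blast
  qed
  moreover have "?f ` insert v B = insert u B" unfolding image_insert im by simp
  ultimately show "B \<in> link E u" using B(4) unfolding link_def by simp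
next
  let ?f = "id(v := u)"
  fix B assume B: "B \<in> link E u"
  then have B': "u \<notin> B" "insert u B \<in> E" "v \<notin> B" using link_uncovered[OF uv(4)] by (auto simp: link_def)
  then have "insert v B \<subseteq> V" using E uv unfolding unif_def by blast
  moreover have "inj_on ?f (insert v B)" using B' by (auto simp: inj_on_def)
  moreover have "?f ` insert v B = insert u B" using B' by auto
  ultimately show "B \<in> link (clone V E u v) v" using B' unfolding link_def clone_def by auto
qed

lemma link_clone_source: "link (clone V E u v) u = link E u"
proof (intro equalityI subsetI)
  let ?f = "id(v := u)"
  fix B assume "B \<in> link (clone V E u v) u"
  then have B: "?f ` B \<in> link E u" using link_clone[OF uv(3)] by blast
  then have "v \<notin> B" by (auto simp: link_def)
  then have "?f ` B = B" by auto
  then show "B \<in> link E u" using B by simp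
next
  let ?f = "id(v := u)"
  fix B assume B: "B \<in> link E u"
  then have "v \<notin> B" using link_uncovered[OF uv(4)] by blast
  then have "?f ` B = B" "inj_on ?f B" by (auto simp: inj_on_def)
  moreover have "insert u B \<subseteq> V" using B E unfolding link_def unif_def by blast
  ultimately show "B \<in> link (clone V E u v) u" using B link_clone[OF uv(3), of V E u] by simp
qed

text \<open>Edges avoiding \<open>v\<close> do not change, and those at \<open>v\<close> become as
  many as the link of \<open>u\<close> has members.\<close>

lemma card_clone: "card (clone V E u v) + card (link E v) = card E + card (link E u)"
proof -
  let ?C = "clone V E u v"
  have split: "card A = card {e \<in> A. v \<notin> e} + card {e \<in> A. v \<in> e}" if "finite A" for A :: "'v set set"
    using that by (subst card_Un_disjoint[symmetric]) (auto intro: arg_cong[where f = card])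
  have "{e \<in> ?C. v \<notin> e} = {e \<in> E. v \<notin> e}" using clone_agree[OF E] by blast
  moreover have "finite E" using E by (rule unif_finite_edges)
  moreover have "finite ?C" using unif_clone[OF E] by (rule unif_finite_edges)
  ultimately show ?thesis
    using split[of ?C] split[of E] card_edges_at[of ?C v] card_edges_at[of E v] link_clone_self by simp
qed

text \<open>The map sending \<open>v\<close> to \<open>u\<close> takes edges of the clone to edges
  of \<open>E\<close>. It is injective on a core, because any two core vertices lie in a common edge
  and the map is injective on edges.\<close>

lemma has_core_clone:
  assumes "has_core t F V (clone V E u v)"
  shows "has_core t F V E"
proof -
  let ?f = "id(v := u)" and ?C = "clone V E u v"
  obtain S \<phi> where S: "S \<subseteq> V" "card S = t + 1" "\<And>x y. x \<in> S \<Longrightarrow> y \<in> S \<Longrightarrow> x \<noteq> y \<Longrightarrow> covered ?C x y"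
    "inj_on \<phi> (verts F)" "\<phi> ` verts F \<subseteq> S" "\<And>e. e \<in> edges F \<Longrightarrow> \<phi> ` e \<in> ?C"
    using assms by (rule has_coreE) blast
  have cov: "?f x \<noteq> ?f y \<and> covered E (?f x) (?f y)" if xy: "x \<in> S" "y \<in> S" "x \<noteq> y" for x y
  proof -
    obtain e where e: "e \<in> ?C" "x \<in> e" "y \<in> e" using S(3) xy unfolding covered_def by blast
    then have "inj_on ?f e" "?f ` e \<in> E" unfolding clone_def by auto
    then show ?thesis using e xy(3) unfolding covered_def inj_on_def by blast
  qed
  then have inj: "inj_on ?f S" unfolding inj_on_def by blast
  have cov': "covered E x' y'" if xy: "x' \<in> ?f ` S" "y' \<in> ?f ` S" "x' \<noteq> y'" for x' y'
  proof -
    obtain x y where "x \<in> S" "x' = ?f x" "y \<in> S" "y' = ?f y" using xy by blast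
    moreover have "x \<noteq> y" using xy(3) calculation by blast
    ultimately show ?thesis using cov by blast
  qed
  have 1: "?f ` S \<subseteq> V" using S(1) uv by auto
  have 2: "card (?f ` S) = t + 1" unfolding card_image[OF inj] by (rule S(2))
  have 3: "inj_on (?f \<circ> \<phi>) (verts F)" using S(4,5) inj by (meson comp_inj_on inj_on_subset)
  have 4: "(?f \<circ> \<phi>) ` verts F \<subseteq> ?f ` S" unfolding image_comp[symmetric] by (rule image_mono[OF S(5)])
  have 5: "(?f \<circ> \<phi>) ` e \<in> E" if "e \<in> edges F" for e
  proof -
    have "\<phi> ` e \<in> ?C" using S(6) that by blast
    then show ?thesis unfolding image_comp[symmetric] clone_def by blast
  qed
  show ?thesis using 1 2 cov' 3 4 5 by (rule has_coreI)
qed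

end

definition twins :: "'v set \<Rightarrow> 'v set set \<Rightarrow> 'v \<Rightarrow> 'v set" where
  "twins V E u = {a \<in> V. link E a = link E u}"

text \<open>Ordered pairs, so the cardinality is the sum of the squares of the class sizes.\<close>

definition twin_pairs :: "'v set \<Rightarrow> 'v set set \<Rightarrow> ('v \<times> 'v) set" where
  "twin_pairs V E = {(a,b). a \<in> V \<and> b \<in> V \<and> link E a = link E b}"

lemma finite_twin_pairs: "finite V \<Longrightarrow> finite (twin_pairs V E)"
  by (rule finite_subset[of _ "V \<times> V"]) (auto simp: twin_pairs_def)

text \<open>The vertex \<open>v\<close> moves from its class to that of \<open>u\<close>, which is
  at least as large. It occurs in \<open>2 * card (twins V E v) - 1\<close> pairs before and in at
  least \<open>2 * card (twins V E u)\<close> afterwards; pairs without \<open>v\<close>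
  survive.\<close>

lemma twin_pairs_clone:
  assumes E: "unif r V E" and uv: "u \<in> V" "v \<in> V" "u \<noteq> v" "\<not> covered E u v"
    and ne: "link E u \<noteq> link E v" and le: "card (twins V E v) \<le> card (twins V E u)"
  shows "card (twin_pairs V E) < card (twin_pairs V (clone V E u v))"
proof -
  let ?C = "clone V E u v"
  have V: "finite V" using E by (simp add: unif_def)
  define T0 where "T0 = {p \<in> twin_pairs V E. fst p \<noteq> v \<and> snd p \<noteq> v}"
  let ?Cv = "twins V E v" and ?Cu = "twins V E u"
  have fin: "finite T0" "finite ?Cv" "finite ?Cu"
    using V finite_twin_pairs[OF V, of E] by (auto simp: T0_def twins_def)
  have vCu: "v \<notin> ?Cu" and vCv: "v \<in> ?Cv" using ne uv by (auto simp: twins_def)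
  have "twin_pairs V E \<subseteq> T0 \<union> {v} \<times> ?Cv \<union> (?Cv - {v}) \<times> {v}"
  proof
    fix p assume p: "p \<in> twin_pairs V E"
    obtain a b where ab: "p = (a,b)" by fastforce
    then have "a \<in> V" "b \<in> V" "link E a = link E b" using p by (auto simp: twin_pairs_def)
    moreover have "p \<in> T0" if "a \<noteq> v" "b \<noteq> v" using p that by (simp add: T0_def ab)
    ultimately show "p \<in> T0 \<union> {v} \<times> ?Cv \<union> (?Cv - {v}) \<times> {v}"
      unfolding ab by (cases "a = v"; cases "b = v") (simp_all add: twins_def)
  qed
  then have "card (twin_pairs V E) \<le> card (T0 \<union> {v} \<times> ?Cv \<union> (?Cv - {v}) \<times> {v})"
    by (rule card_mono[rotated]) (use fin in auto)
  also have "\<dots> \<le> card T0 + card ?Cv + card (?Cv - {v})"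
    by (intro order_trans[OF card_Un_le] add_mono) (auto simp: card_cartesian_product)
  also have "card (?Cv - {v}) < card ?Cv" by (rule card_Diff1_less[OF fin(2) vCv])
  finally have 1: "card (twin_pairs V E) < card T0 + card ?Cv + card ?Cv" by simp
  have disj: "T0 \<inter> {v} \<times> ?Cu = {}" "(T0 \<union> {v} \<times> ?Cu) \<inter> ?Cu \<times> {v} = {}"
    using vCu by (auto simp: T0_def)
  have "card T0 + card ?Cu + card ?Cu = card (T0 \<union> {v} \<times> ?Cu \<union> ?Cu \<times> {v})"
    using fin disj by (simp add: card_Un_disjoint card_cartesian_product)
  also have "\<dots> \<le> card (twin_pairs V ?C)"
  proof (rule card_mono[OF finite_twin_pairs[OF V]], rule subsetI)
    fix p assume p: "p \<in> T0 \<union> {v} \<times> ?Cu \<union> ?Cu \<times> {v}"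
    have keep: "link ?C a = link ?C b" if "a \<in> V" "b \<in> V" "a \<noteq> v" "b \<noteq> v" "link E a = link E b" for a b
      using that by (simp add: link_clone)
    have keepu: "link ?C a = link ?C v" if "a \<in> ?Cu" for a
    proof -
      have "a \<in> V" "a \<noteq> v" "link E a = link E u" using that vCu by (auto simp: twins_def)
      then have "link ?C a = link ?C u" using keep uv by blast
      then show ?thesis using link_clone_self[OF E uv] link_clone_source[OF E uv] by simp
    qed
    from p consider "p \<in> T0" | a where "p = (v,a)" "a \<in> ?Cu" | a where "p = (a,v)" "a \<in> ?Cu" by blast
    then show "p \<in> twin_pairs V ?C"
    proof cases
      case 1
      obtain a b where ab: "p = (a,b)" by fastforce
      then have "a \<in> V" "b \<in> V" "a \<noteq> v" "b \<noteq> v" "link E a = link E b"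
        using 1 by (auto simp: T0_def twin_pairs_def)
      then show ?thesis using keep[of a b] by (simp add: twin_pairs_def ab)
    next
      case 2
      then show ?thesis using keepu[of a] uv by (auto simp: twin_pairs_def twins_def)
    next
      case 3
      then show ?thesis using keepu[of a] uv by (auto simp: twin_pairs_def twins_def)
    qed
  qed
  finally show ?thesis using 1 le by linarith
qed

text \<open>The vertex with the larger link is copied, and on a tie the one with more twins. So the
  number of edges never drops, and when it stays the same the twin pairs increase.\<close>

lemma symmetrization_step:
  assumes E: "unif r V E" and core: "\<not> has_core t F V E"
    and ab: "a \<in> V" "b \<in> V" "a \<noteq> b" "\<not> covered E a b" "link E a \<noteq> link E b"
  obtains v E' where "v \<in> V" "unif r V E'" "\<not> has_core t F V E'" "\<And>e. v \<notin> e \<Longrightarrow> e \<in> E' \<longleftrightarrow> e \<in> E"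
    "card E \<le> card E'" "card E < card E' \<or> card (twin_pairs V E) < card (twin_pairs V E')"
proof -
  have "\<exists>u v. u \<in> V \<and> v \<in> V \<and> u \<noteq> v \<and> \<not> covered E u v \<and> link E u \<noteq> link E v \<and>
     card (link E v) \<le> card (link E u) \<and>
     (card (link E v) = card (link E u) \<longrightarrow> card (twins V E v) \<le> card (twins V E u))"
  proof (cases "card (link E b) < card (link E a) \<or>
      (card (link E b) = card (link E a) \<and> card (twins V E b) \<le> card (twins V E a))")
    case True
    then show ?thesis using ab by (intro exI[of _ a] exI[of _ b]) auto
  next
    case False
    then show ?thesis using ab covered_sym[of E a b] by (intro exI[of _ b] exI[of _ a]) auto
  qed
  then obtain u v where uv: "u \<in> V" "v \<in> V" "u \<noteq> v" "\<not> covered E u v" "link E u \<noteq> link E v"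
    "card (link E v) \<le> card (link E u)"
    "card (link E v) = card (link E u) \<Longrightarrow> card (twins V E v) \<le> card (twins V E u)" by blast
  have c: "card (clone V E u v) + card (link E v) = card E + card (link E u)"
    by (rule card_clone[OF E uv(1-4)])
  show ?thesis
  proof (rule that[of v "clone V E u v"])
    show "card E < card (clone V E u v) \<or> card (twin_pairs V E) < card (twin_pairs V (clone V E u v))"
      using c uv(6) twin_pairs_clone[OF E uv(1-5)] uv(7) by linarith
    show "v \<in> V" by (rule uv(2))
    show "unif r V (clone V E u v)" by (rule unif_clone[OF E])
    show "\<not> has_core t F V (clone V E u v)" using core has_core_clone[OF E uv(1-4)] by metis
    show "e \<in> clone V E u v \<longleftrightarrow> e \<in> E" if "v \<notin> e" for e by (rule clone_agree[OF E that])
    show "card E \<le> card (clone V E u v)" using c uv(6) by linarith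
  qed
qed

text \<open>The potential is lexicographic: first the number of edges, then the number of twin pairs.\<close>

lemma symmetrization_induct [consumes 2, case_names terminal step]:
  assumes E: "unif r V E" and core: "\<not> has_core t F V E"
    and terminal: "\<And>E. unif r V E \<Longrightarrow> \<not> has_core t F V E \<Longrightarrow>
      (\<And>u v. u \<in> V \<Longrightarrow> v \<in> V \<Longrightarrow> u \<noteq> v \<Longrightarrow> \<not> covered E u v \<Longrightarrow> link E u = link E v) \<Longrightarrow> P E"
    and step: "\<And>E E' v. unif r V E \<Longrightarrow> \<not> has_core t F V E \<Longrightarrow> unif r V E' \<Longrightarrow> \<not> has_core t F V E' \<Longrightarrow>
      v \<in> V \<Longrightarrow> (\<And>e. v \<notin> e \<Longrightarrow> e \<in> E' \<longleftrightarrow> e \<in> E) \<Longrightarrow> card E \<le> card E' \<Longrightarrow> P E' \<Longrightarrow> P E"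
  shows "P E"
proof -
  \<comment> \<open>Exceeds the possible number of twin pairs, so one extra edge outweighs any
    change of the second coordinate.\<close>
  define M where "M = card V * card V + 1"
  define pot where "pot = (\<lambda>E :: 'a set set. card E * M + card (twin_pairs V E))"
  have V: "finite V" using E by (simp add: unif_def)
  have tw: "card (twin_pairs V E) < M" for E
  proof -
    have "twin_pairs V E \<subseteq> V \<times> V" by (auto simp: twin_pairs_def)
    then show ?thesis
      using card_mono[of "V \<times> V" "twin_pairs V E"] V by (simp add: M_def card_cartesian_product)
  qed
  have bound: "pot E \<le> card (Pow V) * M + M" if "unif r V E" for E
  proof -
    have "card E \<le> card (Pow V)" by (rule card_mono) (use V that in \<open>auto simp: unif_def\<close>)
    then show ?thesis unfolding pot_def using tw[of E] by (intro add_mono mult_le_mono1) auto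
  qed
  from E core show ?thesis
  proof (induction "card (Pow V) * M + M - pot E" arbitrary: E rule: less_induct)
    case less
    show ?case
    proof (cases "\<exists>u v. u \<in> V \<and> v \<in> V \<and> u \<noteq> v \<and> \<not> covered E u v \<and> link E u \<noteq> link E v")
      case False
      then show ?thesis using terminal[OF less(2,3)] by blast
    next
      case True
      then obtain a b where ab: "a \<in> V" "b \<in> V" "a \<noteq> b" "\<not> covered E a b" "link E a \<noteq> link E b" by blast
      obtain v E' where *: "v \<in> V" "unif r V E'" "\<not> has_core t F V E'" "\<And>e. v \<notin> e \<Longrightarrow> e \<in> E' \<longleftrightarrow> e \<in> E"
        "card E \<le> card E'" "card E < card E' \<or> card (twin_pairs V E) < card (twin_pairs V E')"
        using symmetrization_step[OF less(2,3) ab] by metis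
      have "pot E < pot E'"
      proof (cases "card E < card E'")
        case True
        then have "(card E + 1) * M \<le> card E' * M" by (intro mult_le_mono1) simp
        then show ?thesis unfolding pot_def using tw[of E] by simp
      next
        case False
        then show ?thesis unfolding pot_def using * by simp
      qed
      then have "P E'" using less(1)[OF _ *(2,3)] bound[OF *(2)] by (simp add: diff_less_mono2)
      then show ?thesis using step[OF less(2,3) *(2,3,1,4,5)] by blast
    qed
  qed
qed

text \<open>Used with \<open>f\<close> the link map, to enlarge a copy of \<open>F\<close> to
  \<open>t + 1\<close> vertices that are pairwise not twins.\<close>

lemma extend_inj_on:
  assumes "finite V" "S0 \<subseteq> V" "inj_on f S0" "card S0 \<le> m" "m \<le> card (f ` V)"
  obtains S where "S0 \<subseteq> S" "S \<subseteq> V" "inj_on f S" "card S = m"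
proof -
  have "\<exists>S. S0 \<subseteq> S \<and> S \<subseteq> V \<and> inj_on f S \<and> card S = m"
    using assms(2-4)
  proof (induction "m - card S0" arbitrary: S0)
    case 0
    then show ?case by (intro exI[of _ S0]) auto
  next
    case (Suc k)
    then have "card S0 < m" by simp
    then have "card (f ` S0) < card (f ` V)" using Suc assms by (simp add: card_image)
    then have "\<not> f ` V \<subseteq> f ` S0" using assms(1) Suc(3) card_mono[of "f ` S0" "f ` V"]
      by (meson finite_imageI finite_subset not_le)
    then obtain x where x: "x \<in> V" "f x \<notin> f ` S0" by blast
    have "x \<notin> S0" using x by blast
    then have c: "card (insert x S0) = Suc (card S0)" using Suc assms(1) by (simp add: finite_subset)
    have "\<exists>S. insert x S0 \<subseteq> S \<and> S \<subseteq> V \<and> inj_on f S \<and> card S = m"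
    proof (rule Suc(1))
      show "k = m - card (insert x S0)" using Suc(2) c by simp
      show "inj_on f (insert x S0)" using x Suc(4) \<open>x \<notin> S0\<close> by (simp add: inj_on_insert)
    qed (use c \<open>card S0 < m\<close> x Suc in auto)
    then show ?case by blast
  qed
  then show ?thesis using that by blast
qed

text \<open>Classes of equal links serve as colour classes if there are at most \<open>t\<close> of
  them. Otherwise the vertices of a copy of \<open>F\<close> have distinct links, since
  \<open>F\<close> covers pairs; the copy extends to \<open>t + 1\<close> vertices with distinct
  links, which by \<open>sym\<close> are pairwise covered and form a core.\<close>

lemma symmetrized_structure:
  assumes E: "unif r V E" and core: "\<not> has_core t F V E"
    and F: "rgraph r F" "covers_pairs F" "card (verts F) \<le> t"
    and sym: "\<And>u v. u \<in> V \<Longrightarrow> v \<in> V \<Longrightarrow> u \<noteq> v \<Longrightarrow> \<not> covered E u v \<Longrightarrow> link E u = link E v"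
  shows "(\<exists>\<chi>. \<chi> ` V \<subseteq> {..<t} \<and> (\<forall>e\<in>E. inj_on \<chi> e)) \<or> \<not> embeds F V E"
proof (cases "card (link E ` V) \<le> t")
  case True
  have V: "finite V" using E by (simp add: unif_def)
  then obtain g where g: "inj_on g (link E ` V)" "g ` link E ` V \<subseteq> {..<t}"
    using True card_le_inj[of "link E ` V" "{..<t}"] by auto
  have "inj_on (g \<circ> link E) e" if e: "e \<in> E" for e
  proof (rule inj_onI, rule ccontr)
    fix x y assume *: "x \<in> e" "y \<in> e" "(g \<circ> link E) x = (g \<circ> link E) y" "x \<noteq> y"
    then have "x \<in> V" "y \<in> V" using E e by (auto simp: unif_def)
    then have "link E x = link E y" using * g(1) by (simp add: inj_on_def)
    then show False using covered_imp_link_neq[of E x y] * e by (auto simp: covered_def)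
  qed
  moreover have "(g \<circ> link E) ` V \<subseteq> {..<t}" using g(2) by (simp add: image_comp)
  ultimately show ?thesis by blast
next
  case False
  have V: "finite V" using E by (simp add: unif_def)
  have "\<not> embeds F V E"
  proof
    assume "embeds F V E"
    then obtain \<phi> where \<phi>: "inj_on \<phi> (verts F)" "\<phi> ` verts F \<subseteq> V" "\<forall>e\<in>edges F. \<phi> ` e \<in> E"
      unfolding embeds_def by blast
    have "inj_on (link E) (\<phi> ` verts F)"
    proof (rule inj_onI, rule ccontr)
      fix x y assume *: "x \<in> \<phi> ` verts F" "y \<in> \<phi> ` verts F" "link E x = link E y" "x \<noteq> y"
      then obtain a b where ab: "a \<in> verts F" "b \<in> verts F" "x = \<phi> a" "y = \<phi> b" by blast
      then have "a \<noteq> b" using * by auto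
      then have "{a,b} \<subseteq> verts F" "card {a,b} = 2" using ab by auto
      then obtain e where e: "e \<in> edges F" "{a,b} \<subseteq> e"
        using F(2) unfolding covers_pairs_def uncovered_pairs_def by blast
      then have "\<phi> ` e \<in> E" "x \<in> \<phi> ` e" "y \<in> \<phi> ` e" using \<phi>(3) ab by auto
      then have "covered E x y" unfolding covered_def by blast
      then show False using covered_imp_link_neq[OF _ *(4)] *(3) by metis
    qed
    moreover have "card (\<phi> ` verts F) \<le> t + 1" using F(3) \<phi>(1) by (simp add: card_image)
    moreover have "t + 1 \<le> card (link E ` V)" using False by simp
    ultimately obtain S where S: "\<phi> ` verts F \<subseteq> S" "S \<subseteq> V" "inj_on (link E) S" "card S = t + 1"
      using extend_inj_on[OF V \<phi>(2)] by metis
    have "covered E x y" if "x \<in> S" "y \<in> S" "x \<noteq> y" for x y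
      using sym[of x y] that S unfolding inj_on_def by blast
    then have "has_core t F V E" using S \<phi> by (intro has_coreI[of S V t E \<phi>]) auto
    then show False using core by blast
  qed
  then show ?thesis by blast
qed

lemma partite_card_le:
  assumes "unif r V E" "r \<ge> 2" "t > 0" "\<chi> ` V \<subseteq> {..<t}" "\<forall>e\<in>E. inj_on \<chi> e"
  shows "E \<subseteq> transv \<chi> V {..<t} r" "card E \<le> turan_num r t (card V)"
proof -
  have V: "finite V" using assms by (simp add: unif_def)
  show sub: "E \<subseteq> transv \<chi> V {..<t} r" using assms unfolding unif_def transv_def by blast
  have "card E \<le> card (transv \<chi> V {..<t} r)" using sub V by (intro card_mono finite_transv)
  also have "\<dots> \<le> turan_num r t (card V)"
    unfolding card_transv[OF V finite_lessThan]
    by (rule esym_le_turan_num[OF assms(2,3) sum_card_part[OF V finite_lessThan assms(4)]])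
  finally show "card E \<le> turan_num r t (card V)" .
qed

section \<open>Selecting well-attached vertices\<close>

text \<open>\<open>X\<close> is contained in at most a $\delta$-fraction of $n^{r-|X|}$ members of \<open>\<A>\<close>. The inequality is
  multiplied by $n^{|X|}$ so that it also makes sense, and holds trivially, for $|X| > r$.\<close>

definition fine :: "'v set \<Rightarrow> nat \<Rightarrow> 'v set set \<Rightarrow> real \<Rightarrow> 'v set \<Rightarrow> bool" where
  "fine V r \<A> \<delta> X \<longleftrightarrow> real (deg \<A> X) * real (card V) ^ card X \<le> \<delta> * real (card V) ^ r"

lemma fine_mono: "fine V r \<A> \<delta> X \<Longrightarrow> \<delta> \<le> \<delta>' \<Longrightarrow> fine V r \<A> \<delta>' X"
  unfolding fine_def by (meson mult_right_mono of_nat_0_le_iff order_trans zero_le_power)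

text \<open>For \<open>card X = r\<close> the inequality compares an integer degree with \<delta>
  \<open>< 1\<close>, so the degree is zero.\<close>

lemma fine_not_mem:
  assumes "fine V r \<A> \<delta> X" "\<delta> < 1" "finite \<A>" "card X = r" "card V > 0"
  shows "X \<notin> \<A>"
proof
  assume "X \<in> \<A>"
  then have "{X} \<subseteq> {A \<in> \<A>. X \<subseteq> A}" by auto
  then have "1 \<le> deg \<A> X" unfolding deg_def using assms(3) card_mono[of "{A \<in> \<A>. X \<subseteq> A}" "{X}"] by simp
  then have "1 * real (card V) ^ r \<le> real (deg \<A> X) * real (card V) ^ r"
    by (intro mult_right_mono) auto
  then have "real (card V) ^ r \<le> \<delta> * real (card V) ^ r"
    using assms(1,4) unfolding fine_def by simp
  then show False using assms(2,5) by simp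
qed

text \<open>Double counting: a member \<open>A\<close> containing \<open>X\<close> is counted once
  for each vertex of \<open>A - X\<close>.\<close>

lemma sum_deg_insert_le:
  assumes "unif r V \<A>"
  shows "(\<Sum>x\<in>V - X. deg \<A> (insert x X)) \<le> r * deg \<A> X"
proof -
  let ?A = "{A \<in> \<A>. X \<subseteq> A}"
  have fin: "finite (V - X)" "finite ?A"
    using assms unif_finite_edges[OF assms] by (simp_all add: unif_def)
  have "(\<Sum>x\<in>V - X. deg \<A> (insert x X)) = (\<Sum>x\<in>V - X. card {A \<in> ?A. x \<in> A})"
    unfolding deg_def by (intro sum.cong arg_cong[where f = card]) auto
  also have "\<dots> = (\<Sum>A\<in>?A. card {x \<in> V - X. x \<in> A})"
    unfolding card_eq_sum using fin by (rule sum.swap_restrict)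
  also have "\<dots> \<le> (\<Sum>A\<in>?A. r)"
  proof (rule sum_mono)
    fix A assume "A \<in> ?A"
    then have A: "finite A" "card A = r" using assms unfolding unif_def by (auto intro: finite_subset)
    have "card {x \<in> V - X. x \<in> A} \<le> card A" by (rule card_mono[OF A(1)]) auto
    then show "card {x \<in> V - X. x \<in> A} \<le> r" using A by simp
  qed
  also have "\<dots> = r * deg \<A> X" by (simp add: deg_def)
  finally show ?thesis .
qed

text \<open>Markov's inequality applied to the degrees of the sets \<open>insert x X\<close>, whose
  sum is controlled by the degree of \<open>X\<close>.\<close>

lemma few_bad:
  assumes A: "unif r V \<A>" and X: "X \<subseteq> V" "fine V r \<A> \<delta> X" and \<delta>': "\<delta>' > 0"
  shows "\<delta>' * real (card {x \<in> V - X. \<not> fine V r \<A> \<delta>' (insert x X)}) \<le> real r * \<delta> * real (card V)"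
proof (cases "card V = 0")
  case True
  then have "V = {}" using A by (simp add: unif_def)
  then show ?thesis by simp
next
  case False
  let ?n = "real (card V)" and ?B = "{x \<in> V - X. \<not> fine V r \<A> \<delta>' (insert x X)}"
  have V: "finite V" using A by (simp add: unif_def)
  have n: "?n > 0" using False by simp
  have "real (card ?B) * (\<delta>' * ?n ^ r) = (\<Sum>x\<in>?B. \<delta>' * ?n ^ r)" by simp
  also have "\<dots> \<le> (\<Sum>x\<in>?B. real (deg \<A> (insert x X)) * ?n ^ (card X + 1))"
  proof (rule sum_mono)
    fix x assume x: "x \<in> ?B"
    then have "card (insert x X) = card X + 1" using X V by (simp add: finite_subset)
    then show "\<delta>' * ?n ^ r \<le> real (deg \<A> (insert x X)) * ?n ^ (card X + 1)"
      using x unfolding fine_def by simp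
  qed
  also have "\<dots> \<le> (\<Sum>x\<in>V - X. real (deg \<A> (insert x X)) * ?n ^ (card X + 1))"
    by (rule sum_mono2) (use V in auto)
  also have "\<dots> = real (\<Sum>x\<in>V - X. deg \<A> (insert x X)) * ?n ^ (card X + 1)"
    by (simp add: sum_distrib_right)
  also have "\<dots> \<le> real (r * deg \<A> X) * ?n ^ (card X + 1)"
  proof (rule mult_right_mono)
    show "real (\<Sum>x\<in>V - X. deg \<A> (insert x X)) \<le> real (r * deg \<A> X)"
      unfolding of_nat_le_iff by (rule sum_deg_insert_le[OF A])
  qed simp
  also have "\<dots> = real r * ?n * (real (deg \<A> X) * ?n ^ card X)" by simp
  also have "\<dots> \<le> real r * ?n * (\<delta> * ?n ^ r)"
    using X(2) unfolding fine_def by (intro mult_left_mono) auto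
  finally have "(\<delta>' * real (card ?B)) * ?n ^ r \<le> (real r * \<delta> * ?n) * ?n ^ r"
    by (simp only: ac_simps)
  then show ?thesis using n by (simp add: mult_le_cancel_right)
qed

text \<open>The vertices \<open>x j\<close> are chosen one by one. At each choice at most
  \<open>card\<close> \<X> \<open>* 2 ^ m\<close> sets have to stay fine; by \<open>few_bad\<close>
  each forbids at most \<open>r *\<close> \<rho> \<open>* n\<close> vertices, and each choice
  weakens the constant by the factor \<open>1 /\<close> \<rho>.\<close>

lemma select_aux:
  fixes A :: "nat \<Rightarrow> 'v set"
  assumes \<A>: "unif r V \<A>" and \<X>: "finite \<X>" "\<And>X. X \<in> \<X> \<Longrightarrow> X \<subseteq> V \<and> fine V r \<A> \<delta> X"
    and \<rho>: "0 < \<rho>" "\<rho> \<le> 1" and \<delta>: "\<delta> > 0"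
    and J: "finite J" "card J \<le> m"
      "\<And>j. j \<in> J \<Longrightarrow> A j \<subseteq> V \<and> real (card \<X>) * 2 ^ m * (real r * \<rho> * real (card V)) < real (card (A j))"
  shows "\<exists>x. (\<forall>j\<in>J. x j \<in> A j) \<and> (\<forall>X\<in>\<X>. \<forall>I. I \<subseteq> J \<longrightarrow> fine V r \<A> (\<delta> / \<rho> ^ card J) (X \<union> x ` I))"
  using J
proof (induction J rule: finite_induct)
  case empty
  then show ?case using \<X> by auto
next
  case (insert j J)
  have "\<exists>x. (\<forall>j\<in>J. x j \<in> A j) \<and> (\<forall>X\<in>\<X>. \<forall>I. I \<subseteq> J \<longrightarrow> fine V r \<A> (\<delta> / \<rho> ^ card J) (X \<union> x ` I))"
    using insert by (intro insert(3)) auto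
  then obtain x where x: "\<And>j. j \<in> J \<Longrightarrow> x j \<in> A j"
    "\<And>X I. X \<in> \<X> \<Longrightarrow> I \<subseteq> J \<Longrightarrow> fine V r \<A> (\<delta> / \<rho> ^ card J) (X \<union> x ` I)" by blast
  define \<delta>k where "\<delta>k = \<delta> / \<rho> ^ card J"
  have \<delta>k: "\<delta>k > 0" using \<delta> \<rho> by (simp add: \<delta>k_def)
  have \<delta>km: "\<delta>k \<le> \<delta>k / \<rho>" using \<delta>k \<rho> by (simp add: field_simps)
  have next_eq: "\<delta> / \<rho> ^ card (insert j J) = \<delta>k / \<rho>" using insert by (simp add: \<delta>k_def)
  let ?n = "real (card V)"
  have V: "finite V" using \<A> by (simp add: unif_def)
  \<comment> \<open>All sets built so far; the new vertex has to be good for every one of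
    them.\<close>
  define \<Y> where "\<Y> = (\<lambda>(X,I). X \<union> x ` I) ` (\<X> \<times> Pow J)"
  define bad where "bad = (\<lambda>Y. {z \<in> V - Y. \<not> fine V r \<A> (\<delta>k / \<rho>) (insert z Y)})"
  have f\<Y>: "finite \<Y>" using \<X> insert by (simp add: \<Y>_def)
  have "card \<Y> \<le> card (\<X> \<times> Pow J)" unfolding \<Y>_def using \<X> insert by (intro card_image_le) auto
  also have "\<dots> = card \<X> * 2 ^ card J" using insert by (simp add: card_cartesian_product card_Pow)
  also have "\<dots> \<le> card \<X> * 2 ^ m" using insert by (intro mult_le_mono2 power_increasing) auto
  finally have "real (card \<Y>) \<le> real (card \<X> * 2 ^ m)" by (simp only: of_nat_le_iff)
  then have c\<Y>: "real (card \<Y>) \<le> real (card \<X>) * 2 ^ m" by simp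
  have Y: "Y \<subseteq> V" "fine V r \<A> \<delta>k Y" if Y\<Y>: "Y \<in> \<Y>" for Y
  proof -
    obtain X I where XI: "X \<in> \<X>" "I \<subseteq> J" "Y = X \<union> x ` I" using Y\<Y> unfolding \<Y>_def by auto
    have "x ` I \<subseteq> V" using XI(2) x(1) insert by blast
    then show "Y \<subseteq> V" using XI \<X> by auto
    show "fine V r \<A> \<delta>k Y" using x(2)[OF XI(1,2)] XI(3) by (simp add: \<delta>k_def)
  qed
  have cb: "real (card (bad Y)) \<le> real r * \<rho> * ?n" if "Y \<in> \<Y>" for Y
  proof -
    have "\<delta>k / \<rho> * real (card (bad Y)) \<le> real r * \<delta>k * ?n"
      unfolding bad_def using few_bad[OF \<A> Y[OF that], of "\<delta>k / \<rho>"] \<delta>k \<rho> by simp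
    then show ?thesis using \<delta>k \<rho> by (simp add: field_simps)
  qed
  have "real (card (\<Union>Y\<in>\<Y>. bad Y)) \<le> real (\<Sum>Y\<in>\<Y>. card (bad Y))"
    using card_UN_le[OF f\<Y>, of bad] by (simp del: of_nat_sum)
  also have "\<dots> \<le> (\<Sum>Y\<in>\<Y>. real r * \<rho> * ?n)" unfolding of_nat_sum by (rule sum_mono) (rule cb)
  also have "\<dots> = real (card \<Y>) * (real r * \<rho> * ?n)" by simp
  also have "\<dots> \<le> real (card \<X>) * 2 ^ m * (real r * \<rho> * ?n)"
    using c\<Y> \<rho> by (intro mult_right_mono) auto
  also have "\<dots> < real (card (A j))" using insert by blast
  finally have "card (\<Union>Y\<in>\<Y>. bad Y) < card (A j)" by simp
  then have "\<not> A j \<subseteq> (\<Union>Y\<in>\<Y>. bad Y)"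
    using card_mono[of "\<Union>Y\<in>\<Y>. bad Y" "A j"] V f\<Y> by (auto simp: bad_def)
  then obtain z where z: "z \<in> A j" "\<And>Y. Y \<in> \<Y> \<Longrightarrow> z \<notin> bad Y" by blast
  have zV: "z \<in> V" using z insert by blast
  define x' where "x' = x(j := z)"
  have "fine V r \<A> (\<delta>k / \<rho>) (X \<union> x' ` I)" if XI: "X \<in> \<X>" "I \<subseteq> insert j J" for X I
  proof -
    define Y where "Y = X \<union> x ` (I - {j})"
    have "I - {j} \<subseteq> J" using XI by blast
    then have Y\<Y>: "Y \<in> \<Y>" using XI unfolding Y_def \<Y>_def by force
    have fY: "fine V r \<A> (\<delta>k / \<rho>) Y" using fine_mono[OF Y(2)[OF Y\<Y>] \<delta>km] .
    have im: "x' ` (I - {j}) = x ` (I - {j})" unfolding x'_def by auto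
    show ?thesis
    proof (cases "j \<in> I")
      case True
      then have "x' ` I = insert z (x' ` (I - {j}))" unfolding x'_def by auto
      then have eq: "X \<union> x' ` I = insert z Y" unfolding im Y_def by simp
      show ?thesis
      proof (cases "z \<in> Y")
        case True
        then show ?thesis unfolding eq using fY by (simp add: insert_absorb)
      next
        case False
        then show ?thesis unfolding eq using z(2)[OF Y\<Y>] zV unfolding bad_def by blast
      qed
    next
      case False
      then have "I - {j} = I" by simp
      then show ?thesis using fY im unfolding Y_def by simp
    qed
  qed
  moreover have "x' i \<in> A i" if "i \<in> insert j J" for i using that z x unfolding x'_def by auto
  ultimately show ?case unfolding next_eq by blast
qed

text \<open>The loss factor \<rho> is small enough for the forbidden vertices to number fewer than
  \<open>c * n\<close>, and \<delta>' \<open>*\<close> \<rho> \<open>^ m\<close> pays in advance for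
  \<open>m\<close> choices. The constant does not depend on the graph, so it can be fixed before the
  graph is given.\<close>

lemma selection:
  fixes c \<delta>' :: real and K m r :: nat
  assumes "c > 0" "\<delta>' > 0"
  obtains \<delta> where "\<delta> > 0" "\<delta> \<le> \<delta>'"
    "\<And>(V :: 'v set) \<A> \<X> J (A :: nat \<Rightarrow> 'v set). unif r V \<A> \<Longrightarrow> card V > 0 \<Longrightarrow> finite \<X> \<Longrightarrow> card \<X> \<le> K \<Longrightarrow>
      (\<And>X. X \<in> \<X> \<Longrightarrow> X \<subseteq> V \<and> fine V r \<A> \<delta> X) \<Longrightarrow> finite J \<Longrightarrow> card J \<le> m \<Longrightarrow>
      (\<And>j. j \<in> J \<Longrightarrow> A j \<subseteq> V \<and> c * real (card V) \<le> real (card (A j))) \<Longrightarrow>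
      \<exists>x. (\<forall>j\<in>J. x j \<in> A j) \<and> (\<forall>X\<in>\<X>. \<forall>I. I \<subseteq> J \<longrightarrow> fine V r \<A> \<delta>' (X \<union> x ` I))"
proof -
  define M where "M = real K * 2 ^ m * real r + 1"
  have M: "M > 0" unfolding M_def by (smt (verit) mult_nonneg_nonneg of_nat_0_le_iff zero_le_power)
  define \<rho> where "\<rho> = min 1 (c / (2 * M))"
  have \<rho>: "0 < \<rho>" "\<rho> \<le> 1" "\<rho> \<le> c / (2 * M)" using assms M by (auto simp: \<rho>_def)
  then have M\<rho>: "M * \<rho> \<le> c / 2" using M by (simp add: field_simps)
  show ?thesis
  proof (rule that[of "\<delta>' * \<rho> ^ m"])
    show "\<delta>' * \<rho> ^ m > 0" using assms \<rho> by simp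
    show "\<delta>' * \<rho> ^ m \<le> \<delta>'" using assms \<rho> by (simp add: mult_left_le power_le_one)
  next
    fix V :: "'v set" and \<A> \<X> J and A :: "nat \<Rightarrow> 'v set"
    assume *: "unif r V \<A>" "card V > 0" "finite \<X>" "card \<X> \<le> K"
      "\<And>X. X \<in> \<X> \<Longrightarrow> X \<subseteq> V \<and> fine V r \<A> (\<delta>' * \<rho> ^ m) X" "finite J" "card J \<le> m"
      "\<And>j. j \<in> J \<Longrightarrow> A j \<subseteq> V \<and> c * real (card V) \<le> real (card (A j))"
    have "real (card \<X>) * 2 ^ m * real r \<le> M"
      unfolding M_def using *(4) by (smt (verit) mult_right_mono of_nat_0_le_iff of_nat_mono zero_le_power)
    then have "real (card \<X>) * 2 ^ m * real r * \<rho> \<le> M * \<rho>" using \<rho> by (intro mult_right_mono) auto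
    then have "real (card \<X>) * 2 ^ m * real r * \<rho> < c" using M\<rho> assms by linarith
    then have "real (card \<X>) * 2 ^ m * real r * \<rho> * real (card V) < c * real (card V)"
      using *(2) by (intro mult_strict_right_mono) auto
    then have big: "A j \<subseteq> V \<and> real (card \<X>) * 2 ^ m * (real r * \<rho> * real (card V)) < real (card (A j))"
      if "j \<in> J" for j using *(8)[OF that] by (simp add: mult.assoc)
    have "\<exists>x. (\<forall>j\<in>J. x j \<in> A j) \<and>
      (\<forall>X\<in>\<X>. \<forall>I. I \<subseteq> J \<longrightarrow> fine V r \<A> (\<delta>' * \<rho> ^ m / \<rho> ^ card J) (X \<union> x ` I))"
      by (rule select_aux[OF *(1,3,5) \<rho>(1,2) _ *(6,7) big]) (use assms \<rho> in simp_all)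
    then obtain x where x: "\<forall>j\<in>J. x j \<in> A j"
      "\<forall>X\<in>\<X>. \<forall>I. I \<subseteq> J \<longrightarrow> fine V r \<A> (\<delta>' * \<rho> ^ m / \<rho> ^ card J) (X \<union> x ` I)"
      by blast
    have "\<delta>' * \<rho> ^ m / \<rho> ^ card J \<le> \<delta>'"
    proof -
      have "\<rho> ^ m \<le> \<rho> ^ card J" using \<rho> *(7) by (intro power_decreasing) auto
      then show ?thesis using assms \<rho> by (simp add: divide_le_eq)
    qed
    then have "fine V r \<A> \<delta>' (X \<union> x ` I)" if "X \<in> \<X>" "I \<subseteq> J" for X I
      using fine_mono x(2) that by metis
    then show "\<exists>x. (\<forall>j\<in>J. x j \<in> A j) \<and> (\<forall>X\<in>\<X>. \<forall>I. I \<subseteq> J \<longrightarrow> fine V r \<A> \<delta>' (X \<union> x ` I))"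
      using x(1) by metis
  qed
qed

abbreviation missing :: "nat \<Rightarrow> nat \<Rightarrow> ('v \<Rightarrow> nat) \<Rightarrow> 'v set \<Rightarrow> 'v set set \<Rightarrow> 'v set set" where
  "missing r t \<chi> V E \<equiv> transv \<chi> V {..<t} r - E"

lemma unif_missing: "finite V \<Longrightarrow> unif r V (missing r t \<chi> V E)"
  unfolding unif_def transv_def by auto

lemma transversal_extend:
  assumes "finite V" "X \<subseteq> V" "inj_on \<chi> X" "\<And>j. j \<in> I \<Longrightarrow> x j \<in> part \<chi> V j" "finite I" "I \<inter> \<chi> ` X = {}"
  shows "X \<union> x ` I \<subseteq> V" "inj_on \<chi> (X \<union> x ` I)" "card (X \<union> x ` I) = card X + card I"
    "\<chi> ` (X \<union> x ` I) = \<chi> ` X \<union> I"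
proof -
  have x: "x j \<in> V" "\<chi> (x j) = j" if "j \<in> I" for j using assms(4)[OF that] by (auto simp: part_def)
  show "X \<union> x ` I \<subseteq> V" using assms x by auto
  have im: "\<chi> ` x ` I = I" using x by force
  have ix: "inj_on x I" using x by (metis inj_onI)
  have i\<chi>: "inj_on \<chi> (x ` I)" using x by (auto simp: inj_on_def)
  show un: "\<chi> ` (X \<union> x ` I) = \<chi> ` X \<union> I" using im by (simp add: image_Un)
  have d: "X \<inter> x ` I = {}" using im assms(6) by blast
  show "inj_on \<chi> (X \<union> x ` I)"
    unfolding inj_on_Un using assms(3,6) i\<chi> im by blast
  show "card (X \<union> x ` I) = card X + card I"
    using d assms finite_subset[OF assms(2,1)] ix by (simp add: card_Un_disjoint card_image)
qed

text \<open>Outside \<open>Q\<close>, the pair is completed by selected vertices of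
  \<open>r - 2\<close> further colours. The resulting transversal \<open>r\<close>-set is fine with
  constant \<open>1/2\<close>, so it is not missing and therefore an edge.\<close>

lemma fine_pair_rich:
  fixes c :: real and q r t :: nat
  assumes c: "c > 0" and rt: "r \<ge> 2" "t \<ge> r"
  obtains \<delta> n0 where "\<delta> > 0"
    "\<And>(V :: 'v set) E \<chi> P. unif r V E \<Longrightarrow> n0 \<le> card V \<Longrightarrow>
      (\<And>i. i < t \<Longrightarrow> c * real (card V) \<le> real (card (part \<chi> V i))) \<Longrightarrow>
      P \<subseteq> V \<Longrightarrow> card P = 2 \<Longrightarrow> inj_on \<chi> P \<Longrightarrow> \<chi> ` P \<subseteq> {..<t} \<Longrightarrow> fine V r (missing r t \<chi> V E) \<delta> P \<Longrightarrow> rich q E P"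
proof -
  have c2: "c / 2 > 0" using c by simp
  obtain \<delta> where \<delta>: "\<delta> > 0"
    "\<And>(V :: 'v set) \<A> \<X> J (A :: nat \<Rightarrow> 'v set). unif r V \<A> \<Longrightarrow> card V > 0 \<Longrightarrow> finite \<X> \<Longrightarrow> card \<X> \<le> 1 \<Longrightarrow>
      (\<And>X. X \<in> \<X> \<Longrightarrow> X \<subseteq> V \<and> fine V r \<A> \<delta> X) \<Longrightarrow> finite J \<Longrightarrow> card J \<le> t \<Longrightarrow>
      (\<And>j. j \<in> J \<Longrightarrow> A j \<subseteq> V \<and> c / 2 * real (card V) \<le> real (card (A j))) \<Longrightarrow>
      \<exists>x. (\<forall>j\<in>J. x j \<in> A j) \<and> (\<forall>X\<in>\<X>. \<forall>I. I \<subseteq> J \<longrightarrow> fine V r \<A> (1/2) (X \<union> x ` I))"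
    using selection[OF c2, of "1/2" r 1 t] by (metis half_gt_zero zero_less_one)
  \<comment> \<open>Makes \<open>q\<close> at most \<open>c / 2 * n\<close>, so removing
    \<open>Q\<close> leaves at least half of the guaranteed size of each part.\<close>
  define n0 where "n0 = nat \<lceil>2 * real q / c\<rceil> + 1"
  show ?thesis
  proof (rule that[OF \<delta>(1), of n0])
    fix V :: "'v set" and E \<chi> P
    assume *: "unif r V E" "n0 \<le> card V"
      "\<And>i. i < t \<Longrightarrow> c * real (card V) \<le> real (card (part \<chi> V i))"
      "P \<subseteq> V" "card P = 2" "inj_on \<chi> P" "\<chi> ` P \<subseteq> {..<t}" "fine V r (missing r t \<chi> V E) \<delta> P"
    have V: "finite V" using *(1) by (simp add: unif_def)
    have "2 * real q / c \<le> real (card V)" using *(2) unfolding n0_def by linarith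
    then have big: "real q \<le> c / 2 * real (card V)" using c by (simp add: field_simps)
    have Vpos: "card V > 0" using *(2) by (simp add: n0_def)
    show "rich q E P"
      unfolding rich_def
    proof (intro allI impI)
      fix Q :: "'v set" assume Q: "finite Q" "card Q \<le> q"
      have "card (\<chi> ` P) = 2" using *(5,6) by (simp add: card_image)
      then have "card ({..<t} - \<chi> ` P) = t - 2" using *(7) by (simp add: card_Diff_subset finite_subset)
      then obtain J where J: "J \<subseteq> {..<t} - \<chi> ` P" "card J = r - 2" "finite J"
        using obtain_subset_with_card_n[of "r - 2" "{..<t} - \<chi> ` P"] rt
        by (metis diff_le_mono)
      have A: "part \<chi> V j - Q \<subseteq> V \<and> c / 2 * real (card V) \<le> real (card (part \<chi> V j - Q))" if "j \<in> J" for j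
      proof -
        have "card (part \<chi> V j) \<le> card (part \<chi> V j - Q) + card Q"
          using card_Un_le[of "part \<chi> V j - Q" Q] card_mono[of "part \<chi> V j - Q \<union> Q" "part \<chi> V j"] V Q(1)
          by (auto simp: part_def)
        moreover have "c * real (card V) \<le> real (card (part \<chi> V j))" using *(3) J that by auto
        ultimately show ?thesis using big Q(2) by (auto simp: part_def)
      qed
      have "\<exists>x. (\<forall>j\<in>J. x j \<in> part \<chi> V j - Q) \<and>
          (\<forall>X\<in>{P}. \<forall>I. I \<subseteq> J \<longrightarrow> fine V r (missing r t \<chi> V E) (1/2) (X \<union> x ` I))"
        by (rule \<delta>(2)) (use unif_missing[OF V] Vpos *(4,8) J rt A in auto)
      then obtain x where x: "\<And>j. j \<in> J \<Longrightarrow> x j \<in> part \<chi> V j - Q"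
        "fine V r (missing r t \<chi> V E) (1/2) (P \<union> x ` J)" by blast
      have "J \<inter> \<chi> ` P = {}" using J by blast
      note tv = transversal_extend[OF V *(4,6) _ J(3) this, of x]
      have tv': "P \<union> x ` J \<subseteq> V" "inj_on \<chi> (P \<union> x ` J)" "card (P \<union> x ` J) = r" "\<chi> ` (P \<union> x ` J) \<subseteq> {..<t}"
        using tv x(1) J *(5,7) rt by auto
      then have "P \<union> x ` J \<notin> missing r t \<chi> V E"
        using fine_not_mem[OF x(2)] Vpos V by (simp add: finite_transv)
      then have "P \<union> x ` J \<in> E" using tv' by (simp add: transv_def)
      moreover have "(P \<union> x ` J) \<inter> Q \<subseteq> P" using x(1) by blast
      ultimately show "\<exists>e\<in>E. P \<subseteq> e \<and> e \<inter> Q \<subseteq> P" by blast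
    qed
  qed
qed

section \<open>Two obstructions to freeness\<close>

text \<open>A complete \<open>r\<close>-graph on \<open>t\<close> vertices contains every
  \<open>r\<close>-graph with at most \<open>t\<close> vertices.\<close>

lemma inj_into_edges:
  assumes "rgraph r F" "card (verts F) \<le> t" "finite X" "card X = t"
    "\<And>R. R \<subseteq> X \<Longrightarrow> card R = r \<Longrightarrow> R \<in> E"
  obtains \<phi> where "inj_on \<phi> (verts F)" "\<phi> ` verts F \<subseteq> X" "\<And>e. e \<in> edges F \<Longrightarrow> \<phi> ` e \<in> E"
proof -
  have "finite (verts F)" using assms(1) by (simp add: rgraph_def)
  then obtain \<phi> where \<phi>: "inj_on \<phi> (verts F)" "\<phi> ` verts F \<subseteq> X"
    using card_le_inj[of "verts F" X] assms by auto
  have "\<phi> ` e \<in> E" if e: "e \<in> edges F" for e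
  proof (rule assms(5))
    have "e \<subseteq> verts F" "card e = r" using e assms(1) by (auto simp: rgraph_def)
    then show "\<phi> ` e \<subseteq> X" "card (\<phi> ` e) = r"
      using \<phi> by (auto simp: card_image inj_on_subset)
  qed
  then show ?thesis using that \<phi> by blast
qed

text \<open>If an edge contained \<open>x\<close> and \<open>y\<close>, then \<open>y\<close>, \<open>x\<close> and one vertex of each other colour would form the
  vertex set of a core whose pairs other than \<open>{x,y}\<close> are rich.\<close>

lemma same_colour_uncovered:
  fixes c :: real and r t :: nat and F :: "'a hgraph"
  assumes c: "c > 0" and rt: "r \<ge> 2" "t \<ge> r" and F: "rgraph r F" "card (verts F) \<le> t"
  obtains \<delta> n0 where "\<delta> > 0"
    "\<And>(V :: 'v set) E \<chi> x y. unif r V E \<Longrightarrow> \<not> embeds (Ext r (add_isolated (t + 1) F)) V E \<Longrightarrow>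
      n0 \<le> card V \<Longrightarrow> \<chi> ` V \<subseteq> {..<t} \<Longrightarrow>
      (\<And>i. i < t \<Longrightarrow> c * real (card V) \<le> real (card (part \<chi> V i))) \<Longrightarrow>
      fine V r (missing r t \<chi> V E) \<delta> {} \<Longrightarrow> x \<in> V \<Longrightarrow> y \<in> V \<Longrightarrow> x \<noteq> y \<Longrightarrow> \<chi> x = \<chi> y \<Longrightarrow>
      fine V r (missing r t \<chi> V E) \<delta> {x} \<Longrightarrow> fine V r (missing r t \<chi> V E) \<delta> {y} \<Longrightarrow> \<not> covered E x y"
proof -
  define q where "q = t + 1 + r + r * 2 ^ (t + 1)"
  obtain \<delta>1 n1 where \<delta>1: "\<delta>1 > 0"
    "\<And>(V :: 'v set) E \<chi> P. unif r V E \<Longrightarrow> n1 \<le> card V \<Longrightarrow>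
      (\<And>i. i < t \<Longrightarrow> c * real (card V) \<le> real (card (part \<chi> V i))) \<Longrightarrow>
      P \<subseteq> V \<Longrightarrow> card P = 2 \<Longrightarrow> inj_on \<chi> P \<Longrightarrow> \<chi> ` P \<subseteq> {..<t} \<Longrightarrow> fine V r (missing r t \<chi> V E) \<delta>1 P \<Longrightarrow> rich q E P"
    using fine_pair_rich[OF c rt, where q = q and ?'v = 'v] by metis
  \<comment> \<open>Fine pairs are rich below \<delta>1, and fine transversal \<open>r\<close>-sets
    are edges below \<open>1\<close>.\<close>
  define \<delta>' where "\<delta>' = min \<delta>1 (1/2)"
  have \<delta>': "\<delta>' > 0" "\<delta>' \<le> \<delta>1" "\<delta>' < 1" using \<delta>1(1) by (auto simp: \<delta>'_def)
  have c2: "c / 2 > 0" using c by simp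
  obtain \<delta> where \<delta>: "\<delta> > 0" "\<delta> \<le> \<delta>'"
    "\<And>(V :: 'v set) \<A> \<X> J (A :: nat \<Rightarrow> 'v set). unif r V \<A> \<Longrightarrow> card V > 0 \<Longrightarrow> finite \<X> \<Longrightarrow> card \<X> \<le> 3 \<Longrightarrow>
      (\<And>X. X \<in> \<X> \<Longrightarrow> X \<subseteq> V \<and> fine V r \<A> \<delta> X) \<Longrightarrow> finite J \<Longrightarrow> card J \<le> t \<Longrightarrow>
      (\<And>j. j \<in> J \<Longrightarrow> A j \<subseteq> V \<and> c / 2 * real (card V) \<le> real (card (A j))) \<Longrightarrow>
      \<exists>x. (\<forall>j\<in>J. x j \<in> A j) \<and> (\<forall>X\<in>\<X>. \<forall>I. I \<subseteq> J \<longrightarrow> fine V r \<A> \<delta>' (X \<union> x ` I))"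
    using selection[OF c2 \<delta>'(1), of r 3 t] by metis
  define n0 where "n0 = max (Suc n1) (nat \<lceil>2 * real r / c\<rceil>)"
  show ?thesis
  proof (rule that[OF \<delta>(1), of n0], rule notI)
    fix V :: "'v set" and E \<chi> x y
    assume E: "unif r V E" and nemb: "\<not> embeds (Ext r (add_isolated (t + 1) F)) V E"
      and n: "n0 \<le> card V" and \<chi>: "\<chi> ` V \<subseteq> {..<t}"
      and parts: "\<And>i. i < t \<Longrightarrow> c * real (card V) \<le> real (card (part \<chi> V i))"
      and f0: "fine V r (missing r t \<chi> V E) \<delta> {}"
      and xy: "x \<in> V" "y \<in> V" "x \<noteq> y" "\<chi> x = \<chi> y"
      and fx: "fine V r (missing r t \<chi> V E) \<delta> {x}" and fy: "fine V r (missing r t \<chi> V E) \<delta> {y}"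
      and cov: "covered E x y"
    let ?M = "missing r t \<chi> V E"
    have V: "finite V" using E by (simp add: unif_def)
    have "2 * real r / c \<le> real (card V)" using n unfolding n0_def by linarith
    then have big: "real r \<le> c / 2 * real (card V)" using c by (simp add: field_simps)
    have Vpos: "card V > 0" and n1: "n1 \<le> card V" using n by (auto simp: n0_def)
    obtain e0 where e0: "e0 \<in> E" "x \<in> e0" "y \<in> e0" using cov unfolding covered_def by blast
    have fe0: "finite e0" "card e0 = r" using e0 E V unfolding unif_def by (auto intro: finite_subset)
    define J where "J = {..<t} - {\<chi> x}"
    have \<chi>x: "\<chi> x < t" using \<chi> xy by auto
    have J: "finite J" "card J = t - 1" "card J \<le> t" using \<chi>x by (auto simp: J_def)
    have A: "part \<chi> V j - e0 \<subseteq> V \<and> c / 2 * real (card V) \<le> real (card (part \<chi> V j - e0))" if "j \<in> J" for j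
    proof -
      have "card (part \<chi> V j) \<le> card (part \<chi> V j - e0) + card e0"
        using card_Un_le[of "part \<chi> V j - e0" e0] card_mono[of "part \<chi> V j - e0 \<union> e0" "part \<chi> V j"] V fe0
        by (auto simp: part_def)
      moreover have "c * real (card V) \<le> real (card (part \<chi> V j))" using parts that by (auto simp: J_def)
      ultimately show ?thesis using big fe0 by (auto simp: part_def)
    qed
    \<comment> \<open>Three starting sets suffice, because no set containing both \<open>x\<close>
      and \<open>y\<close> is asked to be fine. Choosing outside \<open>e0\<close> makes
      \<open>e0\<close> meet the future core only in \<open>x\<close> and \<open>y\<close>.\<close>
    have "\<exists>z. (\<forall>j\<in>J. z j \<in> part \<chi> V j - e0) \<and>
        (\<forall>X\<in>{{},{x},{y}}. \<forall>I. I \<subseteq> J \<longrightarrow> fine V r ?M \<delta>' (X \<union> z ` I))"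
      by (rule \<delta>(3)) (use unif_missing[OF V] Vpos J A xy f0 fx fy in \<open>auto simp: card_insert_if\<close>)
    then obtain z where z: "\<And>j. j \<in> J \<Longrightarrow> z j \<in> part \<chi> V j" "\<And>j. j \<in> J \<Longrightarrow> z j \<notin> e0"
      "\<And>X I. X \<in> {{},{x},{y}} \<Longrightarrow> I \<subseteq> J \<Longrightarrow> fine V r ?M \<delta>' (X \<union> z ` I)" by blast
    define X where "X = insert x (z ` J)"
    define S where "S = insert y X"
    have dJ: "J \<inter> \<chi> ` {x} = {}" "J \<inter> \<chi> ` {y} = {}" using xy(4) by (auto simp: J_def)
    have eX: "X = {x} \<union> z ` J" by (simp add: X_def)
    have "card X = 1 + card J"
      using transversal_extend[OF V _ _ z(1) J(1) dJ(1)] xy eX by simp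
    then have cX: "card X = t" using J \<chi>x by simp
    have fX: "finite X" using J by (simp add: X_def)
    have XV: "X \<subseteq> V" using z(1) xy by (auto simp: X_def part_def)
    have yX: "y \<notin> X" using z(2) e0 xy by (auto simp: X_def)
    have S: "S \<subseteq> V" "card S = t + 1" using XV xy yX cX fX by (auto simp: S_def)
    have good: "fine V r ?M \<delta>' P \<and> inj_on \<chi> P \<and> \<chi> ` P \<subseteq> {..<t}" if P: "P \<subseteq> S" "\<not> {x,y} \<subseteq> P" for P
    proof -
      define X0 where "X0 = P \<inter> {x,y}"
      define I where "I = {j \<in> J. z j \<in> P}"
      have X0: "X0 \<in> {{},{x},{y}}" using P(2) by (auto simp: X0_def)
      have PI: "P = X0 \<union> z ` I" using P(1) by (auto simp: X0_def I_def S_def X_def)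
      have IJ: "I \<subseteq> J" by (auto simp: I_def)
      have X0V: "X0 \<subseteq> V" "inj_on \<chi> X0" "I \<inter> \<chi> ` X0 = {}" "\<chi> ` X0 \<subseteq> {..<t}"
        using X0 xy dJ IJ \<chi>x by auto
      have fI: "finite I" using IJ J finite_subset by blast
      have zI: "z j \<in> part \<chi> V j" if "j \<in> I" for j using z(1) IJ that by blast
      note te = transversal_extend[OF V X0V(1,2) zI fI X0V(3)]
      have "I \<subseteq> {..<t}" using IJ by (auto simp: J_def)
      then have "inj_on \<chi> P" "\<chi> ` P \<subseteq> {..<t}"
        unfolding PI using te(2,4) X0V(4) by simp_all
      then show ?thesis using z(3)[OF X0 IJ] PI by simp
    qed
    have RE: "R \<in> E" if R: "R \<subseteq> X" "card R = r" for R
    proof -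
      have "R \<subseteq> S" "\<not> {x,y} \<subseteq> R" using R yX by (auto simp: S_def)
      then have g: "fine V r ?M \<delta>' R" "inj_on \<chi> R" "\<chi> ` R \<subseteq> {..<t}" using good by blast+
      then have "R \<notin> ?M" using fine_not_mem[OF g(1) \<delta>'(3)] R Vpos V by (simp add: finite_transv)
      then show ?thesis using R XV g by (auto simp: transv_def)
    qed
    have rich: "rich q E P" if P: "P \<subseteq> S" "card P = 2" "P \<noteq> {x,y}" for P
    proof -
      have "\<not> {x,y} \<subseteq> P"
      proof
        assume "{x,y} \<subseteq> P"
        moreover have "finite P" using P(2) card.infinite by fastforce
        ultimately have "{x,y} = P" using P xy by (intro card_subset_eq) auto
        then show False using P by simp
      qed
      then have g: "fine V r ?M \<delta>' P" "inj_on \<chi> P" "\<chi> ` P \<subseteq> {..<t}" using good P by blast+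
      show ?thesis
        by (rule \<delta>1(2)[OF E n1 parts]) (use P S g fine_mono[OF g(1) \<delta>'(2)] in auto)
    qed
    \<comment> \<open>\<open>F\<close> is placed in \<open>X\<close>, the core without
      \<open>y\<close>, on which all \<open>r\<close>-sets are edges.\<close>
    obtain \<phi> where \<phi>: "inj_on \<phi> (verts F)" "\<phi> ` verts F \<subseteq> X" "\<And>e. e \<in> edges F \<Longrightarrow> \<phi> ` e \<in> E"
      using inj_into_edges[OF F fX cX RE] by blast
    have \<phi>S: "\<phi> ` verts F \<subseteq> S" using \<phi>(2) by (auto simp: S_def)
    have e0S: "e0 \<in> E \<and> {x,y} \<subseteq> e0 \<and> e0 \<inter> S \<subseteq> {x,y}"
      using e0 z(2) by (auto simp: S_def X_def)
    have "embeds (Ext r (add_isolated (t + 1) F)) V E"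
      by (rule core_embeds_Ext[OF rt(1) F E S \<phi>(1) \<phi>S \<phi>(3) fe0(1) _ _ rich])
        (use fe0 e0S in \<open>auto simp: q_def\<close>)
    then show False using nemb by blast
  qed
qed

text \<open>Otherwise \<open>v\<close> together with one suitable vertex of each colour would be a core with all pairs rich.\<close>

lemma exists_sparse_part:
  fixes c \<eta> :: real and r t :: nat and F :: "'a hgraph"
  assumes c: "c > 0" and \<eta>: "\<eta> > 0" and rt: "r \<ge> 2" "t \<ge> r" and F: "rgraph r F" "card (verts F) \<le> t"
  obtains \<delta> n0 where "\<delta> > 0"
    "\<And>(V :: 'v set) E \<chi> v. unif r V E \<Longrightarrow> \<not> embeds (Ext r (add_isolated (t + 1) F)) V E \<Longrightarrow>
      n0 \<le> card V \<Longrightarrow> \<chi> ` V \<subseteq> {..<t} \<Longrightarrow>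
      (\<And>i. i < t \<Longrightarrow> c * real (card V) \<le> real (card (part \<chi> V i))) \<Longrightarrow>
      fine V r (missing r t \<chi> V E) \<delta> {} \<Longrightarrow> v \<in> V \<Longrightarrow>
      \<exists>i<t. real (card {e \<in> E. v \<in> e \<and> (\<exists>w\<in>part \<chi> V i - {v}. w \<in> e)}) * real (card V) \<le> \<eta> * real (card V) ^ r"
proof -
  define q where "q = t + 1 + r + r * 2 ^ (t + 1)"
  obtain \<delta>1 n1 where \<delta>1: "\<delta>1 > 0"
    "\<And>(V :: 'v set) E \<chi> P. unif r V E \<Longrightarrow> n1 \<le> card V \<Longrightarrow>
      (\<And>i. i < t \<Longrightarrow> c * real (card V) \<le> real (card (part \<chi> V i))) \<Longrightarrow>
      P \<subseteq> V \<Longrightarrow> card P = 2 \<Longrightarrow> inj_on \<chi> P \<Longrightarrow> \<chi> ` P \<subseteq> {..<t} \<Longrightarrow> fine V r (missing r t \<chi> V E) \<delta>1 P \<Longrightarrow> rich q E P"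
    using fine_pair_rich[OF c rt, where q = q and ?'v = 'v] by metis
  define \<delta>' where "\<delta>' = min \<delta>1 (1/2)"
  have \<delta>': "\<delta>' > 0" "\<delta>' \<le> \<delta>1" "\<delta>' < 1" using \<delta>1(1) by (auto simp: \<delta>'_def)
  have \<eta>2: "\<eta> / 2 > 0" using \<eta> by simp
  obtain \<delta> where \<delta>: "\<delta> > 0" "\<delta> \<le> \<delta>'"
    "\<And>(V :: 'v set) \<A> \<X> J (A :: nat \<Rightarrow> 'v set). unif r V \<A> \<Longrightarrow> card V > 0 \<Longrightarrow> finite \<X> \<Longrightarrow> card \<X> \<le> 1 \<Longrightarrow>
      (\<And>X. X \<in> \<X> \<Longrightarrow> X \<subseteq> V \<and> fine V r \<A> \<delta> X) \<Longrightarrow> finite J \<Longrightarrow> card J \<le> t \<Longrightarrow>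
      (\<And>j. j \<in> J \<Longrightarrow> A j \<subseteq> V \<and> \<eta> / 2 * real (card V) \<le> real (card (A j))) \<Longrightarrow>
      \<exists>x. (\<forall>j\<in>J. x j \<in> A j) \<and> (\<forall>X\<in>\<X>. \<forall>I. I \<subseteq> J \<longrightarrow> fine V r \<A> \<delta>' (X \<union> x ` I))"
    using selection[OF \<eta>2 \<delta>'(1), of r 1 t] by metis
  \<comment> \<open>Gives \<open>q <\<close> \<eta>\<open>/2 * n\<close>. A pair of codegree at
    least \<eta>\<open>/2 * n^(r-2)\<close> is then rich by \<open>not_rich_deg\<close>, which
    handles the pairs containing \<open>v\<close>.\<close>
  define n0 where "n0 = max (Suc n1) (nat \<lceil>2 * real q / \<eta>\<rceil> + 1)"
  show ?thesis
  proof (rule that[OF \<delta>(1), of n0], rule ccontr)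
    fix V :: "'v set" and E \<chi> v
    assume E: "unif r V E" and nemb: "\<not> embeds (Ext r (add_isolated (t + 1) F)) V E"
      and n: "n0 \<le> card V" and \<chi>: "\<chi> ` V \<subseteq> {..<t}"
      and parts: "\<And>i. i < t \<Longrightarrow> c * real (card V) \<le> real (card (part \<chi> V i))"
      and f0: "fine V r (missing r t \<chi> V E) \<delta> {}" and v: "v \<in> V"
      and neg: "\<not> (\<exists>i<t. real (card {e \<in> E. v \<in> e \<and> (\<exists>w\<in>part \<chi> V i - {v}. w \<in> e)}) * real (card V)
        \<le> \<eta> * real (card V) ^ r)"
    let ?M = "missing r t \<chi> V E" and ?n = "real (card V)"
    have V: "finite V" using E by (simp add: unif_def)
    have fE: "finite E" using E by (rule unif_finite_edges)
    have "2 * real q / \<eta> < ?n" using n unfolding n0_def by linarith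
    then have big: "real q < \<eta> / 2 * ?n" using \<eta> by (simp add: field_simps)
    have Vpos: "card V > 0" and n1: "n1 \<le> card V" using n by (auto simp: n0_def)
    then have np: "?n > 0" by simp
    \<comment> \<open>Vertices of colour \<open>i\<close> with large codegree with \<open>v\<close>.
      If no part is sparse, averaging makes every \<open>A i\<close> linear in size: a vertex
      outside \<open>A i\<close> contributes at most \<eta>\<open>/2 * n^(r-2)\<close> edges, so
      these account for at most half of the count.\<close>
    define A where "A = (\<lambda>i. {w \<in> part \<chi> V i - {v}. \<eta> / 2 * ?n ^ r \<le> real (deg E {v,w}) * ?n ^ 2})"
    have A: "A i \<subseteq> V \<and> \<eta> / 2 * ?n \<le> real (card (A i))" if i: "i \<in> {..<t}" for i
    proof -
      let ?B = "part \<chi> V i - {v}"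
      have fB: "finite ?B" "?B \<subseteq> V" using V by (auto simp: part_def)
      have AB: "A i \<subseteq> ?B" by (auto simp: A_def)
      have "{e \<in> E. v \<in> e \<and> (\<exists>w\<in>?B. w \<in> e)} \<subseteq> (\<Union>w\<in>?B. {e \<in> E. {v,w} \<subseteq> e})" by auto
      then have "card {e \<in> E. v \<in> e \<and> (\<exists>w\<in>?B. w \<in> e)} \<le> card (\<Union>w\<in>?B. {e \<in> E. {v,w} \<subseteq> e})"
        by (rule card_mono[rotated]) (use fB fE in auto)
      also have "\<dots> \<le> (\<Sum>w\<in>?B. deg E {v,w})"
        unfolding deg_def by (rule card_UN_le) (use fB in auto)
      finally have le: "real (card {e \<in> E. v \<in> e \<and> (\<exists>w\<in>?B. w \<in> e)}) \<le> real (\<Sum>w\<in>?B. deg E {v,w})"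
        by (simp only: of_nat_le_iff)
      have "\<eta> * ?n ^ r < real (card {e \<in> E. v \<in> e \<and> (\<exists>w\<in>?B. w \<in> e)}) * ?n"
        using neg i by force
      also have "\<dots> \<le> real (\<Sum>w\<in>?B. deg E {v,w}) * ?n" using le by (rule mult_right_mono) simp
      finally have "\<eta> * ?n ^ r * ?n < real (\<Sum>w\<in>?B. deg E {v,w}) * ?n * ?n"
        using np by (rule mult_strict_right_mono)
      also have "\<dots> = (\<Sum>w\<in>?B. real (deg E {v,w}) * ?n ^ 2)"
        by (simp add: power2_eq_square sum_distrib_right mult.assoc)
      also have "\<dots> \<le> (\<Sum>w\<in>?B. (if w \<in> A i then ?n ^ r else 0) + \<eta> / 2 * ?n ^ r)"
      proof (rule sum_mono)
        fix w assume w: "w \<in> ?B"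
        then have "card {v,w} = 2" by auto
        then have "deg E {v,w} * card V ^ 2 \<le> card V ^ r" using deg_mult_le[OF E, of "{v,w}"] by simp
        then have "real (deg E {v,w}) * ?n ^ 2 \<le> ?n ^ r" by (metis of_nat_le_iff of_nat_mult of_nat_power)
        moreover have "real (deg E {v,w}) * ?n ^ 2 \<le> \<eta> / 2 * ?n ^ r" if "w \<notin> A i"
          using that w by (auto simp: A_def)
        moreover have "0 \<le> \<eta> / 2 * ?n ^ r" using \<eta> by simp
        ultimately show "real (deg E {v,w}) * ?n ^ 2 \<le> (if w \<in> A i then ?n ^ r else 0) + \<eta> / 2 * ?n ^ r"
          by auto
      qed
      also have "\<dots> = real (card (A i)) * ?n ^ r + real (card ?B) * (\<eta> / 2 * ?n ^ r)"
        using fB AB by (simp add: sum.distrib sum.If_cases Int_absorb1)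
      also have "real (card ?B) * (\<eta> / 2 * ?n ^ r) \<le> ?n * (\<eta> / 2 * ?n ^ r)"
        using card_mono[OF V fB(2)] \<eta> by (intro mult_right_mono) auto
      finally have "(\<eta> / 2 * ?n) * ?n ^ r < real (card (A i)) * ?n ^ r" by (simp add: algebra_simps)
      then have "\<eta> / 2 * ?n < real (card (A i))" using np by (simp add: mult_less_cancel_right)
      then show ?thesis using AB fB by auto
    qed
    have "\<exists>z. (\<forall>j\<in>{..<t}. z j \<in> A j) \<and>
        (\<forall>X\<in>{{}}. \<forall>I. I \<subseteq> {..<t} \<longrightarrow> fine V r ?M \<delta>' (X \<union> z ` I))"
      by (rule \<delta>(3)) (use unif_missing[OF V] Vpos A f0 in auto)
    then obtain z where z: "\<And>j. j < t \<Longrightarrow> z j \<in> A j"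
      "\<And>I. I \<subseteq> {..<t} \<Longrightarrow> fine V r ?M \<delta>' (z ` I)" by auto
    have zp: "z j \<in> part \<chi> V j" "z j \<noteq> v" if "j < t" for j using z(1)[OF that] by (auto simp: A_def)
    define X where "X = z ` {..<t}"
    define S where "S = insert v X"
    have fX: "finite X" by (simp add: X_def)
    note te = transversal_extend[OF V empty_subsetI, of \<chi> _ z, simplified]
    have cX: "card X = t" using te(3)[of "{..<t}"] zp by (simp add: X_def)
    have XV: "X \<subseteq> V" using te(1)[of "{..<t}"] zp by (simp add: X_def)
    have vX: "v \<notin> X" using zp by (auto simp: X_def)
    have S: "S \<subseteq> V" "card S = t + 1" using XV v vX cX fX by (auto simp: S_def)
    have good: "fine V r ?M \<delta>' P \<and> inj_on \<chi> P \<and> \<chi> ` P \<subseteq> {..<t}" if P: "P \<subseteq> X" for P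
    proof -
      define I where "I = {j \<in> {..<t}. z j \<in> P}"
      have PI: "P = z ` I" using P by (auto simp: I_def X_def)
      have IJ: "I \<subseteq> {..<t}" by (auto simp: I_def)
      then have fI: "finite I" using finite_subset by blast
      have zI: "z j \<in> part \<chi> V j" if "j \<in> I" for j using zp IJ that by blast
      show ?thesis using z(2)[OF IJ] te(2,4)[OF zI fI] IJ unfolding PI by simp
    qed
    have RE: "R \<in> E" if R: "R \<subseteq> X" "card R = r" for R
    proof -
      have g: "fine V r ?M \<delta>' R" "inj_on \<chi> R" "\<chi> ` R \<subseteq> {..<t}" using good R by blast+
      then have "R \<notin> ?M" using fine_not_mem[OF g(1) \<delta>'(3)] R Vpos V by (simp add: finite_transv)
      then show ?thesis using R XV g by (auto simp: transv_def)
    qed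
    have rich: "rich q E P" if P: "P \<subseteq> S" "card P = 2" "P \<noteq> {}" for P
    proof (cases "v \<in> P")
      case True
      have fP: "finite P" using P(2) card.infinite by fastforce
      then have "card (P - {v}) = 1" using P True by simp
      then obtain w where "P - {v} = {w}" using card_1_singletonE by blast
      then have w: "P = {v,w}" "w \<noteq> v" "w \<in> X" using True P(1) by (auto simp: S_def)
      then obtain j where j: "j < t" "w = z j" by (auto simp: X_def)
      then have dw: "\<eta> / 2 * ?n ^ r \<le> real (deg E {v,w}) * ?n ^ 2" using z(1) by (auto simp: A_def)
      show ?thesis
      proof (rule ccontr)
        assume "\<not> rich q E P"
        then have "deg E {v,w} * card V ^ 3 \<le> q * card V ^ r"
          using not_rich_deg[OF E, of v w q] w by simp
        then have "real (deg E {v,w}) * ?n ^ 3 \<le> real q * ?n ^ r"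
          by (metis of_nat_le_iff of_nat_mult of_nat_power)
        moreover have "\<eta> / 2 * ?n ^ r * ?n \<le> real (deg E {v,w}) * ?n ^ 2 * ?n"
          using dw by (rule mult_right_mono) simp
        ultimately have "(\<eta> / 2 * ?n) * ?n ^ r \<le> real q * ?n ^ r"
          by (simp add: power3_eq_cube power2_eq_square mult_ac)
        then have "\<eta> / 2 * ?n \<le> real q" using np by (simp add: mult_le_cancel_right)
        then show False using big by simp
      qed
    next
      case False
      then have PX: "P \<subseteq> X" using P by (auto simp: S_def)
      then have g: "fine V r ?M \<delta>' P" "inj_on \<chi> P" "\<chi> ` P \<subseteq> {..<t}" using good by blast+
      show ?thesis
        by (rule \<delta>1(2)[OF E n1 parts]) (use P PX XV g fine_mono[OF g(1) \<delta>'(2)] in auto)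
    qed
    obtain \<phi> where \<phi>: "inj_on \<phi> (verts F)" "\<phi> ` verts F \<subseteq> X" "\<And>e. e \<in> edges F \<Longrightarrow> \<phi> ` e \<in> E"
      using inj_into_edges[OF F fX cX RE] by blast
    have \<phi>S: "\<phi> ` verts F \<subseteq> S" using \<phi>(2) by (auto simp: S_def)
    have "embeds (Ext r (add_isolated (t + 1) F)) V E"
      by (rule core_embeds_Ext[OF rt(1) F E S \<phi>(1) \<phi>S \<phi>(3) _ _ _ rich, where ?e0.0 = "{}"])
        (auto simp: q_def)
    then show False using nemb by blast
  qed
qed

section \<open>Counting transversal sets\<close>

text \<open>Joining a vertex of colour \<open>j\<close> to a transversal set without
  \<open>j\<close> gives an \<open>r\<close>-set, and each \<open>r\<close>-set arises at most once
  for each of its \<open>r\<close> colours.\<close>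

lemma sum_part_mult_transv_le:
  assumes V: "finite V" and J: "finite J" and r: "r \<ge> 1"
  shows "(\<Sum>j\<in>J. card (part \<chi> V j) * card (transv \<chi> V (J - {j}) (r - 1))) \<le> r * card (transv \<chi> V J r)"
proof -
  have fT: "finite (transv \<chi> V J r)" using V by (rule finite_transv)
  have "card (part \<chi> V j) * card (transv \<chi> V (J - {j}) (r - 1)) \<le> card {A \<in> transv \<chi> V J r. j \<in> \<chi> ` A}"
    if j: "j \<in> J" for j
  proof -
    have "(\<lambda>(v,A). insert v A) ` (part \<chi> V j \<times> transv \<chi> V (J - {j}) (r - 1)) \<subseteq> {A \<in> transv \<chi> V J r. j \<in> \<chi> ` A}"
    proof clarify
      fix v A assume v: "v \<in> part \<chi> V j" and A: "A \<in> transv \<chi> V (J - {j}) (r - 1)"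
      have "v \<notin> A" "\<chi> v \<notin> \<chi> ` A" "finite A" using v A V by (auto simp: part_def transv_def intro: finite_subset)
      then show "insert v A \<in> transv \<chi> V J r \<and> j \<in> \<chi> ` insert v A"
        using v A j r by (auto simp: part_def transv_def)
    qed
    from card_mono[OF _ this] show ?thesis
      using card_transv_insert_pairs[OF V, of j "J - {j}" \<chi> "r - 1"] fT by simp
  qed
  then have "(\<Sum>j\<in>J. card (part \<chi> V j) * card (transv \<chi> V (J - {j}) (r - 1)))
    \<le> (\<Sum>j\<in>J. card {A \<in> transv \<chi> V J r. j \<in> \<chi> ` A})" by (rule sum_mono)
  also have "\<dots> = (\<Sum>A\<in>transv \<chi> V J r. card {j \<in> J. j \<in> \<chi> ` A})"
    unfolding card_eq_sum using J fT by (rule sum.swap_restrict)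
  also have "\<dots> = (\<Sum>A\<in>transv \<chi> V J r. r)"
  proof (rule sum.cong[OF refl])
    fix A assume A: "A \<in> transv \<chi> V J r"
    then have "{j \<in> J. j \<in> \<chi> ` A} = \<chi> ` A" by (auto simp: transv_def)
    then show "card {j \<in> J. j \<in> \<chi> ` A} = r" using A by (simp add: transv_def card_image)
  qed
  finally show ?thesis by (simp add: mult.commute)
qed

text \<open>Dropping colour \<open>i\<close> destroys at most \<open>n^(r-1)\<close> transversal
  sets per vertex of that part, while the surviving ones use only \<open>t - 1\<close>
  colours.\<close>

lemma card_part_ge:
  assumes V: "finite V" "card V > 0" and rt: "r \<ge> 2" "t \<ge> r" and i: "i < t"
    and ge: "(tdens r t - \<delta>) * real (card V) ^ r \<le> real (card (transv \<chi> V {..<t} r))"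
  shows "(tdens r t - tdens r (t - 1) - \<delta>) * real (card V) \<le> real (card (part \<chi> V i))"
proof -
  let ?n = "real (card V)" and ?T = "transv \<chi> V {..<t} r" and ?J = "{..<t} - {i}"
  have n: "?n > 0" using V by simp
  have uT: "unif r V ?T" using V unfolding unif_def transv_def by auto
  have fp: "finite (part \<chi> V i)" using V by (simp add: part_def)
  have "?T \<subseteq> transv \<chi> V ?J r \<union> (\<Union>w\<in>part \<chi> V i. {A \<in> ?T. {w} \<subseteq> A})"
    by (auto simp: transv_def part_def)
  then have "card ?T \<le> card (transv \<chi> V ?J r \<union> (\<Union>w\<in>part \<chi> V i. {A \<in> ?T. {w} \<subseteq> A}))"
    by (rule card_mono[rotated]) (use V fp in \<open>auto simp: finite_transv\<close>)
  also have "\<dots> \<le> card (transv \<chi> V ?J r) + (\<Sum>w\<in>part \<chi> V i. deg ?T {w})"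
    unfolding deg_def by (intro order_trans[OF card_Un_le] add_left_mono card_UN_le fp)
  finally have "real (card ?T) \<le> real (card (transv \<chi> V ?J r) + (\<Sum>w\<in>part \<chi> V i. deg ?T {w}))"
    by (simp only: of_nat_le_iff)
  then have "real (card ?T) \<le> real (card (transv \<chi> V ?J r)) + (\<Sum>w\<in>part \<chi> V i. real (deg ?T {w}))"
    by simp
  then have "real (card ?T) * ?n \<le> (real (card (transv \<chi> V ?J r)) + (\<Sum>w\<in>part \<chi> V i. real (deg ?T {w}))) * ?n"
    by (rule mult_right_mono) simp
  also have "\<dots> = real (card (transv \<chi> V ?J r)) * ?n + (\<Sum>w\<in>part \<chi> V i. real (deg ?T {w}) * ?n)"
    by (simp add: sum_distrib_right distrib_right)
  also have "(\<Sum>w\<in>part \<chi> V i. real (deg ?T {w}) * ?n) \<le> (\<Sum>w\<in>part \<chi> V i. ?n ^ r)"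
  proof (rule sum_mono)
    fix w
    have "deg ?T {w} * card V \<le> card V ^ r" using deg_mult_le[OF uT, of "{w}"] by simp
    then show "real (deg ?T {w}) * ?n \<le> ?n ^ r" by (metis of_nat_le_iff of_nat_mult of_nat_power)
  qed
  also have "(\<Sum>w\<in>part \<chi> V i. ?n ^ r) = real (card (part \<chi> V i)) * ?n ^ r" by simp
  also have "real (card (transv \<chi> V ?J r)) * ?n \<le> tdens r (t - 1) * ?n ^ r * ?n"
  proof (rule mult_right_mono)
    have "?J \<noteq> {}"
    proof
      assume "?J = {}"
      then have "card ?J = 0" by simp
      then show False using i rt by simp
    qed
    then show "real (card (transv \<chi> V ?J r)) \<le> tdens r (t - 1) * ?n ^ r"
      using card_transv_le[OF rt(1) V(1), of ?J \<chi>] i by simp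
  qed simp
  finally have "real (card ?T) * ?n \<le> tdens r (t - 1) * ?n ^ r * ?n + real (card (part \<chi> V i)) * ?n ^ r"
    by simp
  moreover have "(tdens r t - \<delta>) * ?n ^ r * ?n \<le> real (card ?T) * ?n" using ge by (rule mult_right_mono) simp
  ultimately have "((tdens r t - tdens r (t - 1) - \<delta>) * ?n) * ?n ^ r \<le> real (card (part \<chi> V i)) * ?n ^ r"
    by (simp add: algebra_simps)
  then show ?thesis using n by (simp add: mult_le_cancel_right)
qed

text \<open>Each of the pairs formed by \<open>v\<close> and a vertex of \<open>U\<close> lies in at
  most \<open>n^(r-2)\<close> edges.\<close>

lemma card_edges_through_atypical:
  assumes E: "unif r V E" and U: "finite U" "real (card U) \<le> s * real (card V)" and n: "card V > 0"
  shows "real (card {e \<in> E. v \<in> e \<and> (\<exists>u\<in>U - {v}. u \<in> e)}) * real (card V) \<le> s * real (card V) ^ r"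
proof -
  let ?n = "real (card V)" and ?N = "{e \<in> E. v \<in> e \<and> (\<exists>u\<in>U - {v}. u \<in> e)}"
  have np: "?n > 0" using n by simp
  have fE: "finite E" using E by (rule unif_finite_edges)
  have "?N \<subseteq> (\<Union>u\<in>U - {v}. {e \<in> E. {v,u} \<subseteq> e})" by auto
  then have "card ?N \<le> card (\<Union>u\<in>U - {v}. {e \<in> E. {v,u} \<subseteq> e})"
    by (rule card_mono[rotated]) (use U fE in auto)
  also have "\<dots> \<le> (\<Sum>u\<in>U - {v}. deg E {v,u})"
    unfolding deg_def by (rule card_UN_le) (use U in auto)
  finally have "real (card ?N) \<le> real (\<Sum>u\<in>U - {v}. deg E {v,u})"
    by (simp only: of_nat_le_iff)
  then have "real (card ?N) \<le> (\<Sum>u\<in>U - {v}. real (deg E {v,u}))"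
    by simp
  then have "real (card ?N) * ?n ^ 2 \<le> (\<Sum>u\<in>U - {v}. real (deg E {v,u})) * ?n ^ 2"
    by (rule mult_right_mono) simp
  also have "\<dots> = (\<Sum>u\<in>U - {v}. real (deg E {v,u}) * ?n ^ 2)" by (simp add: sum_distrib_right)
  also have "\<dots> \<le> (\<Sum>u\<in>U - {v}. ?n ^ r)"
  proof (rule sum_mono)
    fix u assume "u \<in> U - {v}"
    then have "card {v,u} = 2" by auto
    then have "deg E {v,u} * card V ^ 2 \<le> card V ^ r" using deg_mult_le[OF E, of "{v,u}"] by simp
    then show "real (deg E {v,u}) * ?n ^ 2 \<le> ?n ^ r" by (metis of_nat_le_iff of_nat_mult of_nat_power)
  qed
  also have "\<dots> = real (card (U - {v})) * ?n ^ r" by simp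
  also have "\<dots> \<le> real (card U) * ?n ^ r"
    using card_mono[OF U(1), of "U - {v}"] by (intro mult_right_mono) auto
  also have "\<dots> \<le> s * ?n * ?n ^ r" using U(2) by (rule mult_right_mono) simp
  finally have "(real (card ?N) * ?n) * ?n \<le> (s * ?n ^ r) * ?n" by (simp add: power2_eq_square mult_ac)
  then show ?thesis using np by (simp add: mult_le_cancel_right)
qed

text \<open>Apart from the exceptional edges in \<open>N\<close>, removing \<open>v\<close> turns
  the edges at \<open>v\<close> into transversal sets with colours in \<open>J\<close>.\<close>

lemma deg_le_transv:
  assumes E: "unif r V E" and rt: "r \<ge> 1" and N: "finite N"
    and sub: "\<And>e. e \<in> E \<Longrightarrow> v \<in> e \<Longrightarrow> e \<notin> N \<Longrightarrow> inj_on \<chi> (e - {v}) \<and> \<chi> ` (e - {v}) \<subseteq> J"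
  shows "card {e \<in> E. v \<in> e} \<le> card N + card {B \<in> transv \<chi> V J (r - 1). v \<notin> B \<and> insert v B \<in> E}"
proof -
  let ?C = "{B \<in> transv \<chi> V J (r - 1). v \<notin> B \<and> insert v B \<in> E}"
  have V: "finite V" using E by (simp add: unif_def)
  have fC: "finite ?C" using finite_transv[OF V] by auto
  have "{e \<in> E. v \<in> e} \<subseteq> N \<union> insert v ` ?C"
  proof
    fix e assume "e \<in> {e \<in> E. v \<in> e}"
    then have e: "e \<in> E" "v \<in> e" by auto
    then have e': "e \<subseteq> V" "card e = r" "finite e" using E V unfolding unif_def by (auto intro: finite_subset)
    show "e \<in> N \<union> insert v ` ?C"
    proof (cases "e \<in> N")
      case False
      then have "inj_on \<chi> (e - {v})" "\<chi> ` (e - {v}) \<subseteq> J" using sub e by auto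
      moreover have "card (e - {v}) = r - 1" using e' e by simp
      moreover have i: "insert v (e - {v}) = e" using e by auto
      ultimately have "e - {v} \<in> ?C" using e e' by (auto simp: transv_def)
      then have "insert v (e - {v}) \<in> insert v ` ?C" by (rule imageI)
      then show ?thesis unfolding i by (rule UnI2)
    qed simp
  qed
  then have "card {e \<in> E. v \<in> e} \<le> card (N \<union> insert v ` ?C)"
    by (rule card_mono[rotated]) (use N fC in auto)
  also have "\<dots> \<le> card N + card (insert v ` ?C)" by (rule card_Un_le)
  also have "card (insert v ` ?C) \<le> card ?C" by (rule card_image_le[OF fC])
  finally show ?thesis by simp
qed

text \<open>Once \<open>x\<close> and \<open>y\<close> both have colour \<open>i\<close>, a
  transversal set through \<open>x\<close> contains neither \<open>y\<close> nor any other vertex of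
  colour \<open>i\<close>. Its remaining vertices keep their old colours, so the count can be made
  in the old colouring.\<close>

lemma recoloured_missing:
  assumes V: "finite V" and xy: "x \<noteq> y" "i < t" and r: "r \<ge> 1"
  shows "deg (missing r t (\<chi>(x := i, y := i)) V E) {x}
    \<le> card {B \<in> transv \<chi> V ({..<t} - {i}) (r - 1). x \<notin> B \<and> insert x B \<notin> E}" (is "_ \<le> card ?C")
proof -
  let ?\<chi> = "\<chi>(x := i, y := i)"
  have fC: "finite ?C" using finite_transv[OF V] by auto
  have "{A \<in> missing r t ?\<chi> V E. {x} \<subseteq> A} \<subseteq> insert x ` ?C"
  proof
    fix A assume "A \<in> {A \<in> missing r t ?\<chi> V E. {x} \<subseteq> A}"
    then have A: "A \<subseteq> V" "card A = r" "inj_on ?\<chi> A" "?\<chi> ` A \<subseteq> {..<t}" "A \<notin> E" "x \<in> A"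
      by (auto simp: transv_def)
    have ni: "?\<chi> z \<noteq> i" if "z \<in> A" "z \<noteq> x" for z
    proof
      assume "?\<chi> z = i"
      then have "?\<chi> z = ?\<chi> x" by simp
      then show False using A(3,6) that unfolding inj_on_def by blast
    qed
    have yA: "y \<notin> A" using ni[of y] xy(1) by auto
    have eq\<chi>: "?\<chi> z = \<chi> z" if "z \<in> A - {x}" for z using that yA by auto
    have "inj_on \<chi> (A - {x})"
      using inj_on_cong[of "A - {x}" ?\<chi> \<chi>] eq\<chi> inj_on_subset[OF A(3), of "A - {x}"] by auto
    moreover have "\<chi> ` (A - {x}) \<subseteq> {..<t} - {i}" using A(4) eq\<chi> ni by fastforce
    moreover have "card (A - {x}) = r - 1" using A by simp
    moreover have ins: "insert x (A - {x}) = A" using A by auto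
    ultimately have "A - {x} \<in> ?C" using A by (auto simp: transv_def)
    then have "insert x (A - {x}) \<in> insert x ` ?C" by (rule imageI)
    then show "A \<in> insert x ` ?C" unfolding ins .
  qed
  then have "deg (missing r t ?\<chi> V E) {x} \<le> card (insert x ` ?C)"
    unfolding deg_def by (rule card_mono[rotated]) (use fC in auto)
  also have "\<dots> \<le> card ?C" by (rule card_image_le[OF fC])
  finally show ?thesis .
qed

lemma deg_empty: "deg \<A> {} = card \<A>"
  by (simp add: deg_def)

text \<open>Sets avoiding both recoloured vertices are missing for the new colouring only if they
  were missing before.\<close>

lemma recoloured_missing_empty:
  assumes V: "finite V"
  shows "deg (missing r t (\<chi>(x := i, y := j)) V E) {}
    \<le> deg (missing r t \<chi> V E) {} + deg (missing r t (\<chi>(x := i, y := j)) V E) {x}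
      + deg (missing r t (\<chi>(x := i, y := j)) V E) {y}"
proof -
  let ?\<chi> = "\<chi>(x := i, y := j)"
  let ?M = "missing r t \<chi> V E" and ?M' = "missing r t ?\<chi> V E"
  have fin: "finite ?M" "finite ?M'" using finite_transv[OF V] by auto
  have "?M' \<subseteq> ?M \<union> {A \<in> ?M'. {x} \<subseteq> A} \<union> {A \<in> ?M'. {y} \<subseteq> A}"
  proof
    fix A assume A: "A \<in> ?M'"
    show "A \<in> ?M \<union> {A \<in> ?M'. {x} \<subseteq> A} \<union> {A \<in> ?M'. {y} \<subseteq> A}"
    proof (cases "x \<in> A \<or> y \<in> A")
      case False
      then have eq\<chi>: "\<And>z. z \<in> A \<Longrightarrow> ?\<chi> z = \<chi> z" by auto
      have "inj_on ?\<chi> A = inj_on \<chi> A" by (rule inj_on_cong[OF eq\<chi>])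
      moreover have "?\<chi> ` A = \<chi> ` A" by (rule image_cong[OF refl eq\<chi>])
      ultimately
      show ?thesis using A by (auto simp: transv_def)
    qed (use A in auto)
  qed
  then have "card ?M' \<le> card (?M \<union> {A \<in> ?M'. {x} \<subseteq> A} \<union> {A \<in> ?M'. {y} \<subseteq> A})"
    by (rule card_mono[rotated]) (intro finite_UnI fin finite_subset[OF _ fin(2)]; blast)
  also have "\<dots> \<le> card ?M + card {A \<in> ?M'. {x} \<subseteq> A} + card {A \<in> ?M'. {y} \<subseteq> A}"
    by (intro order_trans[OF card_Un_le] add_right_mono) simp
  finally show ?thesis unfolding deg_empty unfolding deg_def .
qed

section \<open>Near-extremal graphs with large minimum degree are partite\<close>

text \<open>Vertices lying in few missing transversal sets are typical; two of them of the same colour are not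
  covered. Hence almost all edges at any vertex \<open>v\<close> are transversal apart from \<open>v\<close> itself, and they
  avoid the colour \<open>\<iota> v\<close> provided by the sparse part; after recolouring \<open>v\<close> by \<open>\<iota> v\<close> it is typical too.\<close>

lemma local_partite:
  fixes r t :: nat and F :: "'a hgraph"
  assumes rt: "r \<ge> 2" "t \<ge> r" and F: "rgraph r F" "card (verts F) \<le> t"
  obtains \<epsilon> \<delta> n0 where "\<epsilon> > 0" "\<delta> > 0"
    "\<And>(V :: 'v set) E \<chi>. unif r V E \<Longrightarrow> \<not> embeds (Ext r (add_isolated (t + 1) F)) V E \<Longrightarrow>
      n0 \<le> card V \<Longrightarrow> \<chi> ` V \<subseteq> {..<t} \<Longrightarrow>
      (tdens r t - \<delta>) * real (card V) ^ r \<le> real (card {e \<in> E. inj_on \<chi> e}) \<Longrightarrow>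
      (\<And>v. v \<in> V \<Longrightarrow> (tdens r t * real r - \<epsilon>) * real (card V) ^ r \<le> real (card {e \<in> E. v \<in> e}) * real (card V)) \<Longrightarrow>
      \<exists>\<iota>. \<iota> ` V \<subseteq> {..<t} \<and> (\<forall>e\<in>E. inj_on \<iota> e)"
proof -
  define a where "a = tdens r t"
  define g where "g = a - tdens r (t - 1)"
  have g: "g > 0" using tdens_less[OF rt] by (simp add: g_def a_def)
  \<comment> \<open>The parts will have at least \<open>3/4 * g * n\<close> vertices; the smaller
    constant leaves room for recolouring two vertices.\<close>
  define c where "c = g / 2"
  have c: "c > 0" using g by (simp add: c_def)
  obtain \<delta>2 n2 where \<delta>2: "\<delta>2 > 0"
    "\<And>(V :: 'v set) E \<chi> x y. unif r V E \<Longrightarrow> \<not> embeds (Ext r (add_isolated (t + 1) F)) V E \<Longrightarrow>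
      n2 \<le> card V \<Longrightarrow> \<chi> ` V \<subseteq> {..<t} \<Longrightarrow>
      (\<And>i. i < t \<Longrightarrow> c * real (card V) \<le> real (card (part \<chi> V i))) \<Longrightarrow>
      fine V r (missing r t \<chi> V E) \<delta>2 {} \<Longrightarrow> x \<in> V \<Longrightarrow> y \<in> V \<Longrightarrow> x \<noteq> y \<Longrightarrow> \<chi> x = \<chi> y \<Longrightarrow>
      fine V r (missing r t \<chi> V E) \<delta>2 {x} \<Longrightarrow> fine V r (missing r t \<chi> V E) \<delta>2 {y} \<Longrightarrow> \<not> covered E x y"
    using same_colour_uncovered[OF c rt F, where ?'v = 'v] by metis
  \<comment> \<open>The second entry makes \<open>2 * s / c + 3 * s\<close> at most half of
    \<delta>2. This sum is the total error in the count of bad sets at a vertex; \<open>s\<close>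
    also serves as the slack in the minimum degree.\<close>
  define s where "s = min (g / 2) (\<delta>2 / 2 / (2 / c + 3))"
  have D3: "2 / c + 3 > 0" using c by (simp add: add_pos_pos)
  have s: "s > 0" "s \<le> g / 2" "s \<le> \<delta>2 / 2 / (2 / c + 3)"
  proof -
    show "s > 0" using g \<delta>2(1) D3 by (simp add: s_def)
    show "s \<le> g / 2" unfolding s_def by (rule min.cobounded1)
    show "s \<le> \<delta>2 / 2 / (2 / c + 3)" unfolding s_def by (rule min.cobounded2)
  qed
  have s3: "2 * s / c + 3 * s \<le> \<delta>2 / 2"
  proof -
    have "s * (2 / c + 3) \<le> \<delta>2 / 2" using s(3) unfolding pos_le_divide_eq[OF D3] .
    then show ?thesis by (simp add: algebra_simps)
  qed
  obtain \<delta>1 n1 where \<delta>1: "\<delta>1 > 0"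
    "\<And>(V :: 'v set) E \<chi> v. unif r V E \<Longrightarrow> \<not> embeds (Ext r (add_isolated (t + 1) F)) V E \<Longrightarrow>
      n1 \<le> card V \<Longrightarrow> \<chi> ` V \<subseteq> {..<t} \<Longrightarrow>
      (\<And>i. i < t \<Longrightarrow> c * real (card V) \<le> real (card (part \<chi> V i))) \<Longrightarrow>
      fine V r (missing r t \<chi> V E) \<delta>1 {} \<Longrightarrow> v \<in> V \<Longrightarrow>
      \<exists>i<t. real (card {e \<in> E. v \<in> e \<and> (\<exists>w\<in>part \<chi> V i - {v}. w \<in> e)}) * real (card V) \<le> s * real (card V) ^ r"
    by (fact exists_sparse_part[OF c s(1) rt F, where ?'v = 'v])
  \<comment> \<open>The last entry bounds the number of atypical vertices by \<open>s * n\<close>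
    via \<open>few_bad\<close>.\<close>
  define \<delta> where "\<delta> = Min {g / 4, \<delta>2 / 2, \<delta>1, s * \<delta>2 / (2 * real r)}"
  have \<delta>: "\<delta> > 0" "\<delta> \<le> g / 4" "\<delta> \<le> \<delta>2 / 2" "\<delta> \<le> \<delta>1" "\<delta> \<le> s * \<delta>2 / (2 * real r)"
  proof -
    let ?S = "{g / 4, \<delta>2 / 2, \<delta>1, s * \<delta>2 / (2 * real r)}"
    have "0 < s * \<delta>2 / (2 * real r)" using \<delta>2(1) s(1) rt by simp
    then have "\<forall>x\<in>?S. 0 < x" using g \<delta>2(1) \<delta>1(1) by simp
    moreover have "Min ?S \<in> ?S" by (rule Min_in) auto
    ultimately show "\<delta> > 0" unfolding \<delta>_def by blast
    have le: "\<delta> \<le> x" if "x \<in> ?S" for x unfolding \<delta>_def by (rule Min_le[OF _ that]) simp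
    show "\<delta> \<le> g / 4" "\<delta> \<le> \<delta>2 / 2" "\<delta> \<le> \<delta>1" "\<delta> \<le> s * \<delta>2 / (2 * real r)"
      by (rule le, blast)+
  qed
  \<comment> \<open>From \<open>8 / g\<close> follows \<open>3/4 * g * n - 2 >= c * n\<close>: parts
    stay large when two vertices leave.\<close>
  define n0 where "n0 = Max {n1, n2, 2, nat \<lceil>8 / g\<rceil>}"
  show ?thesis
  proof (rule that[OF s(1) \<delta>(1), of n0])
    fix V :: "'v set" and E \<chi>
    assume E: "unif r V E" and nemb: "\<not> embeds (Ext r (add_isolated (t + 1) F)) V E"
      and n: "n0 \<le> card V" and \<chi>: "\<chi> ` V \<subseteq> {..<t}"
      and dense': "(tdens r t - \<delta>) * real (card V) ^ r \<le> real (card {e \<in> E. inj_on \<chi> e})"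
      and mindeg': "\<And>v. v \<in> V \<Longrightarrow> (tdens r t * real r - s) * real (card V) ^ r \<le> real (card {e \<in> E. v \<in> e}) * real (card V)"
    let ?n = "real (card V)" and ?T = "transv \<chi> V {..<t} r" and ?M = "missing r t \<chi> V E"
    note dense = dense'[folded a_def] and mindeg = mindeg'[folded a_def]
    have V: "finite V" using E by (simp add: unif_def)
    have fE: "finite E" using E by (rule unif_finite_edges)
    have n': "n1 \<le> card V" "n2 \<le> card V" "2 \<le> card V" "8 / g \<le> ?n"
      using n unfolding n0_def by (auto simp: le_nat_iff ceiling_le_iff) 
    then have Vpos: "card V > 0" and np: "?n > 0" "?n \<ge> 2" by auto
    define R where "R = ?n ^ r"
    have R: "R > 0" using np by (simp add: R_def)
    have fT: "finite ?T" using V by (rule finite_transv)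
    have sub: "{e \<in> E. inj_on \<chi> e} \<subseteq> ?T" using E \<chi> unfolding unif_def transv_def by blast
    have Tge: "(a - \<delta>) * R \<le> real (card ?T)"
      using dense card_mono[OF fT sub] unfolding R_def by linarith
    have "{..<t} \<noteq> {}" using rt by (auto simp: lessThan_empty_iff)
    then have Tle: "real (card ?T) \<le> a * R"
      using card_transv_le[OF rt(1) V, of "{..<t}" \<chi>] by (simp add: a_def R_def)
    have parts34: "3 / 4 * g * ?n \<le> real (card (part \<chi> V i))" if "i < t" for i
    proof -
      have "(g - \<delta>) * ?n \<le> real (card (part \<chi> V i))"
        using card_part_ge[OF V Vpos rt that] Tge unfolding a_def g_def R_def by simp
      moreover have "3 / 4 * g * ?n \<le> (g - \<delta>) * ?n"
        using \<delta>(2) np by (intro mult_right_mono) auto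
      ultimately show ?thesis by linarith
    qed
    have parts: "c * ?n \<le> real (card (part \<chi> V i))" if "i < t" for i
    proof -
      have "c * ?n \<le> 3 / 4 * g * ?n" unfolding c_def using g np by (intro mult_right_mono) auto
      then show ?thesis using parts34[OF that] by linarith
    qed
    have M0: "real (deg ?M {}) \<le> \<delta> * R"
    proof -
      have "deg ?M {} = card ?M" by (rule deg_empty)
      also have "\<dots> = card (?T - {e \<in> E. inj_on \<chi> e})"
        by (rule arg_cong[where f = card]) (auto simp: transv_def)
      also have "real \<dots> = real (card ?T) - real (card {e \<in> E. inj_on \<chi> e})"
        using card_mono[OF fT sub] fE by (simp add: card_Diff_subset[OF _ sub] of_nat_diff)
      also have "\<dots> \<le> \<delta> * R" using dense Tle by (simp add: algebra_simps R_def)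
      finally show ?thesis .
    qed
    then have f0: "fine V r ?M \<delta> {}" by (simp add: fine_def R_def)
    define U where "U = {w \<in> V. \<not> fine V r ?M (\<delta>2 / 2) {w}}"
    have fU: "finite U" using V by (simp add: U_def)
    have cU: "real (card U) \<le> s * ?n"
    proof -
      have "\<delta>2 / 2 * real (card U) \<le> real r * \<delta> * ?n"
        using few_bad[OF unif_missing[OF V] _ f0, of "\<delta>2 / 2"] \<delta>2(1) by (simp add: U_def)
      also have "\<dots> \<le> real r * (s * \<delta>2 / (2 * real r)) * ?n"
        using \<delta>(5) by (intro mult_right_mono mult_left_mono) auto
      also have "\<dots> = \<delta>2 / 2 * (s * ?n)" using rt by simp
      finally show ?thesis using \<delta>2(1) by simp
    qed
    have typical: "\<not> covered E x y"
      if "x \<in> V - U" "y \<in> V - U" "x \<noteq> y" "\<chi> x = \<chi> y" for x y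
    proof (rule \<delta>2(2)[OF E nemb n'(2) \<chi> parts])
      show "fine V r ?M \<delta>2 {}" by (rule fine_mono[OF f0]) (use \<delta> \<delta>2 in linarith)
      have h: "\<delta>2 / 2 \<le> \<delta>2" using \<delta>2(1) by simp
      show "fine V r ?M \<delta>2 {x}" "fine V r ?M \<delta>2 {y}"
        using that fine_mono[OF _ h, of V r ?M] by (auto simp: U_def)
    qed (use that in auto)
    define N where "N = (\<lambda>v. {e \<in> E. v \<in> e \<and> (\<exists>u\<in>U - {v}. u \<in> e)})"
    have fN: "finite (N v)" for v using fE by (simp add: N_def)
    have cN: "real (card (N v)) * ?n \<le> s * R" for v
      unfolding N_def R_def by (rule card_edges_through_atypical[OF E fU cU Vpos])
    have eV: "e \<subseteq> V" "finite e" if "e \<in> E" for e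
      using E V that unfolding unif_def by (auto intro: finite_subset)
    have inj_rest: "inj_on \<chi> (e - {v})" if e: "e \<in> E" "v \<in> e" "e \<notin> N v" for e v
    proof (rule inj_onI, rule ccontr)
      fix x y assume xy: "x \<in> e - {v}" "y \<in> e - {v}" "\<chi> x = \<chi> y" "x \<noteq> y"
      then have "x \<notin> U" "y \<notin> U" using e unfolding N_def by blast+
      then have "\<not> covered E x y" using typical xy eV[OF e(1)] by blast
      then show False using e xy unfolding covered_def by blast
    qed
    \<comment> \<open>\<open>D j\<close> counts the possible links of a vertex of colour
      \<open>j\<close>. It is shown to be about \<open>a * r * n^(r-1)\<close> for every
      \<open>j\<close>; the lower bound comes from the degree of a typical vertex \<open>w\<close>
      of that colour, of whose edges only those in \<open>N w\<close> are lost.\<close>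
    define D where "D = (\<lambda>j. real (card (transv \<chi> V ({..<t} - {j}) (r - 1))))"
    have Dge: "(a * real r - 2 * s) * R \<le> D j * ?n" if j: "j < t" for j
    proof -
      have "real (card U) < real (card (part \<chi> V j))"
      proof -
        have "s * ?n \<le> g / 2 * ?n" using s np by (intro mult_right_mono) auto
        also have "\<dots> < 3 / 4 * g * ?n" using g np by simp
        finally show ?thesis using cU parts34[OF j] by linarith
      qed
      then have "\<not> part \<chi> V j \<subseteq> U" using card_mono[OF fU, of "part \<chi> V j"] by auto
      then obtain w where w: "w \<in> part \<chi> V j" "w \<notin> U" by blast
      then have wV: "w \<in> V - U" "\<chi> w = j" by (auto simp: part_def)
      have "inj_on \<chi> (e - {w}) \<and> \<chi> ` (e - {w}) \<subseteq> {..<t} - {j}" if e: "e \<in> E" "w \<in> e" "e \<notin> N w" for e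
      proof -
        have "\<chi> u \<noteq> j" if u: "u \<in> e - {w}" for u
        proof
          assume "\<chi> u = j"
          moreover have "u \<in> V - U" using e u eV[OF e(1)] unfolding N_def by blast
          ultimately have "\<not> covered E w u" using typical[OF wV(1), of u] wV(2) u by auto
          then show False using e u unfolding covered_def by blast
        qed
        then show ?thesis using inj_rest[OF e] \<chi> eV[OF e(1)] by auto
      qed
      then have "card {e \<in> E. w \<in> e} \<le> card (N w) +
          card {B \<in> transv \<chi> V ({..<t} - {j}) (r - 1). w \<notin> B \<and> insert w B \<in> E}"
        using rt by (intro deg_le_transv[OF E _ fN]) auto
      also have "\<dots> \<le> card (N w) + card (transv \<chi> V ({..<t} - {j}) (r - 1))"
        by (intro add_left_mono card_mono finite_transv V) auto
      finally have "real (card {e \<in> E. w \<in> e}) \<le> real (card (N w)) + D j"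
        unfolding D_def by linarith
      then have "real (card {e \<in> E. w \<in> e}) * ?n \<le> (real (card (N w)) + D j) * ?n"
        by (rule mult_right_mono) simp
      then have "real (card {e \<in> E. w \<in> e}) * ?n \<le> real (card (N w)) * ?n + D j * ?n"
        by (simp only: distrib_right)
      then show ?thesis using mindeg[of w] cN[of w] wV(1) unfolding R_def by (simp add: algebra_simps)
    qed
    \<comment> \<open>The average of the \<open>D j\<close>, weighted by part sizes, is at most
      \<open>a * r * n^(r-1)\<close>. As no \<open>D j\<close> lies much below this value, none can
      lie much above it; dividing by a part size of at least \<open>c * n\<close> produces the term
      \<open>2 * s / c\<close>.\<close>
    have Dle: "D i * ?n \<le> (a * real r + 2 * s / c) * R" if i: "i < t" for i
    proof -
      define p where "p = (\<lambda>j. real (card (part \<chi> V j)))"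
      have sp: "(\<Sum>j<t. p j) = ?n"
        using sum_card_part[OF V finite_lessThan \<chi>] unfolding p_def by (simp flip: of_nat_sum)
      have "real (\<Sum>j<t. card (part \<chi> V j) * card (transv \<chi> V ({..<t} - {j}) (r - 1))) \<le> real (r * card ?T)"
        unfolding of_nat_le_iff by (rule sum_part_mult_transv_le[OF V]) (use rt in auto)
      then have "(\<Sum>j<t. p j * D j) \<le> real r * real (card ?T)" by (simp add: p_def D_def)
      also have "\<dots> \<le> real r * (a * R)" using Tle by (intro mult_left_mono) auto
      finally have "(\<Sum>j<t. p j * D j) * ?n \<le> real r * (a * R) * ?n" by (rule mult_right_mono) simp
      moreover have "(\<Sum>j<t. p j * (D j * ?n)) = (\<Sum>j<t. p j * D j) * ?n"
        by (simp only: sum_distrib_right mult.assoc)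
      ultimately have up: "(\<Sum>j<t. p j * (D j * ?n)) \<le> a * real r * R * ?n"
        by (simp only: mult_ac)
      define b where "b = (a * real r - 2 * s) * R"
      have ge: "p j * b \<le> p j * (D j * ?n)" if "j < t" for j
        unfolding b_def using Dge[OF that] by (intro mult_left_mono) (auto simp: p_def)
      have "p i * (D i * ?n) - p i * b = (\<Sum>j\<in>{i}. p j * (D j * ?n) - p j * b)" by simp
      also have "\<dots> \<le> (\<Sum>j<t. p j * (D j * ?n) - p j * b)"
        by (rule sum_mono2) (use i ge in auto)
      also have "\<dots> = (\<Sum>j<t. p j * (D j * ?n)) - ?n * b"
        by (simp add: sum_subtractf sp flip: sum_distrib_right)
      also have "\<dots> \<le> 2 * s * R * ?n" using up by (simp add: b_def algebra_simps)
      finally have 1: "p i * (D i * ?n - b) \<le> 2 * s * R * ?n" by (simp add: algebra_simps)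
      have "c * ?n * (D i * ?n - b) \<le> p i * (D i * ?n - b)"
        using parts[OF i] Dge[OF i] by (intro mult_right_mono) (auto simp: p_def b_def)
      then have "(c * (D i * ?n - b)) * ?n \<le> (2 * s * R) * ?n" using 1 by (simp add: mult_ac)
      then have "c * (D i * ?n - b) \<le> 2 * s * R" using np by simp
      then have "D i * ?n - b \<le> 2 * s * R / c" using c by (simp add: pos_le_divide_eq mult.commute)
      moreover have "b \<le> a * real r * R" unfolding b_def using s R by (intro mult_right_mono) auto
      ultimately show ?thesis by (simp add: algebra_simps)
    qed
    define Bad where "Bad = (\<lambda>v i. card {B \<in> transv \<chi> V ({..<t} - {i}) (r - 1). v \<notin> B \<and> insert v B \<notin> E})"
    \<comment> \<open>With \<open>i\<close> the sparse colour of \<open>v\<close>, almost all edges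
      at \<open>v\<close> come from the sets counted by \<open>D i\<close>. The degree of
      \<open>v\<close> nearly exhausts \<open>D i\<close>, so few of these sets fail to give an
      edge.\<close>
    have "\<exists>i<t. real (Bad v i) * ?n \<le> \<delta>2 / 2 * R" if v: "v \<in> V" for v
    proof -
      have f1: "fine V r ?M \<delta>1 {}" by (rule fine_mono[OF f0 \<delta>(4)])
      obtain i where i: "i < t"
        "real (card {e \<in> E. v \<in> e \<and> (\<exists>w\<in>part \<chi> V i - {v}. w \<in> e)}) * ?n \<le> s * ?n ^ r"
        using \<delta>1(2)[OF E nemb n'(1) \<chi> parts f1 v] by blast
      define Sp where "Sp = {e \<in> E. v \<in> e \<and> (\<exists>w\<in>part \<chi> V i - {v}. w \<in> e)}"
      let ?G = "{B \<in> transv \<chi> V ({..<t} - {i}) (r - 1). v \<notin> B \<and> insert v B \<in> E}"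
      let ?B = "{B \<in> transv \<chi> V ({..<t} - {i}) (r - 1). v \<notin> B \<and> insert v B \<notin> E}"
      have "inj_on \<chi> (e - {v}) \<and> \<chi> ` (e - {v}) \<subseteq> {..<t} - {i}"
        if e: "e \<in> E" "v \<in> e" "e \<notin> N v \<union> Sp" for e
      proof -
        have "\<chi> u \<noteq> i" if "u \<in> e - {v}" for u
          using that e eV[OF e(1)] unfolding Sp_def part_def by blast
        then show ?thesis using inj_rest[of e v] e \<chi> eV[OF e(1)] by auto
      qed
      then have "card {e \<in> E. v \<in> e} \<le> card (N v \<union> Sp) + card ?G"
        using rt fN fE by (intro deg_le_transv[OF E]) (auto simp: Sp_def)
      also have "card (N v \<union> Sp) \<le> card (N v) + card Sp" by (rule card_Un_le)
      finally have 1: "card {e \<in> E. v \<in> e} \<le> card (N v) + card Sp + card ?G" by simp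
      have ftr: "finite (transv \<chi> V ({..<t} - {i}) (r - 1))" by (rule finite_transv[OF V])
      have "card ?G + card ?B = card (?G \<union> ?B)"
        using ftr by (intro card_Un_disjoint[symmetric]) auto
      also have "\<dots> \<le> card (transv \<chi> V ({..<t} - {i}) (r - 1))"
        by (rule card_mono[OF ftr]) auto
      finally have "real (card ?G) + real (Bad v i) \<le> D i" unfolding D_def Bad_def by linarith
      then have "real (Bad v i) \<le> D i + real (card (N v)) + real (card Sp) - real (card {e \<in> E. v \<in> e})"
        using 1 by linarith
      then have "real (Bad v i) * ?n \<le>
          (D i + real (card (N v)) + real (card Sp) - real (card {e \<in> E. v \<in> e})) * ?n"
        by (rule mult_right_mono) simp
      also have "\<dots> = D i * ?n + real (card (N v)) * ?n + real (card Sp) * ?n - real (card {e \<in> E. v \<in> e}) * ?n"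
        by (simp only: distrib_right left_diff_distrib)
      also have "\<dots> \<le> (a * real r + 2 * s / c) * R + s * R + s * R - (a * real r - s) * R"
        using Dle[OF i(1)] cN[of v] i(2) mindeg[OF v] unfolding Sp_def R_def by linarith
      also have "\<dots> = (2 * s / c + 3 * s) * R" by (simp add: algebra_simps)
      also have "\<dots> \<le> \<delta>2 / 2 * R" using s3 R by (intro mult_right_mono) auto
      finally show ?thesis using i(1) by blast
    qed
    then obtain \<iota> where \<iota>: "\<And>v. v \<in> V \<Longrightarrow> \<iota> v < t" "\<And>v. v \<in> V \<Longrightarrow> real (Bad v (\<iota> v)) * ?n \<le> \<delta>2 / 2 * R"
      by metis
    \<comment> \<open>Only \<open>x\<close> and \<open>y\<close> are recoloured, for the sake of
      this one pair; all other vertices keep \<chi>. The new colouring \<iota> itself is never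
      checked against the missing sets.\<close>
    have unc: "\<not> covered E x y" if xy: "x \<in> V" "y \<in> V" "x \<noteq> y" "\<iota> x = \<iota> y" for x y
    proof -
      define \<chi>' where "\<chi>' = \<chi>(x := \<iota> x, y := \<iota> x)"
      let ?M' = "missing r t \<chi>' V E"
      have \<chi>': "\<chi>' ` V \<subseteq> {..<t}" using \<chi> \<iota>(1) xy unfolding \<chi>'_def by auto
      have r1: "r \<ge> 1" using rt by simp
      have dx: "deg ?M' {x} \<le> Bad x (\<iota> x)"
        unfolding \<chi>'_def Bad_def by (rule recoloured_missing[OF V xy(3) \<iota>(1)[OF xy(1)] r1])
      have "\<chi>' = \<chi>(y := \<iota> x, x := \<iota> x)" using xy(3) by (auto simp: \<chi>'_def)
      then have dy: "deg ?M' {y} \<le> Bad y (\<iota> x)"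
        using recoloured_missing[OF V xy(3)[symmetric] \<iota>(1)[OF xy(1)] r1, of \<chi> E] unfolding Bad_def by simp
      have Bx: "real (deg ?M' {x}) * ?n \<le> \<delta>2 / 2 * R"
      proof -
        have "real (deg ?M' {x}) * ?n \<le> real (Bad x (\<iota> x)) * ?n" using dx by (intro mult_right_mono) auto
        then show ?thesis using \<iota>(2)[OF xy(1)] by linarith
      qed
      have By: "real (deg ?M' {y}) * ?n \<le> \<delta>2 / 2 * R"
      proof -
        have "real (deg ?M' {y}) * ?n \<le> real (Bad y (\<iota> x)) * ?n" using dy by (intro mult_right_mono) auto
        then show ?thesis using \<iota>(2)[OF xy(2)] xy(4) by simp
      qed
      have eq: "\<chi>' x = \<chi>' y" unfolding \<chi>'_def by simp
      have half: "\<delta>2 / 2 \<le> \<delta>2" using \<delta>2(1) by simp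
      have fx: "fine V r ?M' \<delta>2 {x}" and fy: "fine V r ?M' \<delta>2 {y}"
        by (rule fine_mono[OF _ half], use Bx By in \<open>simp add: fine_def R_def\<close>)+
      have f0': "fine V r ?M' \<delta>2 {}"
      proof -
        \<comment> \<open>Uses \<open>n >= 2\<close>: each of the two degrees is at most a quarter
          of \<delta>2 \<open>* R\<close>, so the three contributions to the missing sets sum to at
          most \<delta>2 \<open>* R\<close>.\<close>
        have "2 * real (deg ?M' {x}) \<le> \<delta>2 / 2 * R" "2 * real (deg ?M' {y}) \<le> \<delta>2 / 2 * R"
          using Bx By np(2) mult_left_mono[OF np(2), of "real (deg ?M' {x})"]
            mult_left_mono[OF np(2), of "real (deg ?M' {y})"] by auto
        moreover have "deg ?M' {} \<le> deg ?M {} + deg ?M' {x} + deg ?M' {y}"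
          unfolding \<chi>'_def by (rule recoloured_missing_empty[OF V])
        moreover have "\<delta> * R \<le> \<delta>2 / 2 * R" using \<delta>(3) R by (intro mult_right_mono) auto
        ultimately have "real (deg ?M' {}) \<le> \<delta>2 * R" using M0 by simp
        then show ?thesis by (simp add: fine_def R_def)
      qed
      have parts': "c * ?n \<le> real (card (part \<chi>' V i))" if "i < t" for i
      proof -
        have "part \<chi> V i \<subseteq> part \<chi>' V i \<union> {x,y}" by (auto simp: part_def \<chi>'_def)
        then have "card (part \<chi> V i) \<le> card (part \<chi>' V i \<union> {x,y})"
          by (rule card_mono[rotated]) (use V in \<open>auto simp: part_def\<close>)
        also have "\<dots> \<le> card (part \<chi>' V i) + card {x,y}" by (rule card_Un_le)
        also have "card {x,y} = 2" using xy by simp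
        finally have "3 / 4 * g * ?n \<le> real (card (part \<chi>' V i)) + 2" using parts34[OF that] by linarith
        moreover have "8 \<le> g * ?n" using n'(4) g by (simp add: divide_le_eq mult.commute)
        ultimately show ?thesis by (simp add: c_def)
      qed
      show ?thesis
        by (rule \<delta>2(2)[OF E nemb n'(2) \<chi>' parts' f0' xy(1-3) eq fx fy])
    qed
    have "inj_on \<iota> e" if e: "e \<in> E" for e
    proof (rule inj_onI, rule ccontr)
      fix x y assume "x \<in> e" "y \<in> e" "\<iota> x = \<iota> y" "x \<noteq> y"
      moreover from this have "covered E x y" using e by (auto simp: covered_def)
      ultimately show False using unc eV[OF e] by blast
    qed
    then show "\<exists>\<iota>. \<iota> ` V \<subseteq> {..<t} \<and> (\<forall>e\<in>E. inj_on \<iota> e)" using \<iota>(1) by blast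
  qed
qed

section \<open>Passing to subgraphs of large minimum degree\<close>

lemma power_one_minus_le:
  fixes x :: real
  assumes "0 \<le> x" "x \<le> 1"
  shows "(1 - x) ^ k \<le> 1 - real k * x + (real k * x) ^ 2"
proof (induction k)
  case (Suc k)
  have "(1 - x) ^ Suc k \<le> (1 - x) * (1 - real k * x + (real k * x) ^ 2)"
    using Suc assms by (simp add: mult_left_mono)
  also have "\<dots> = 1 - real (Suc k) * x + (real k * x) ^ 2 + real k * x ^ 2 - (real k) ^ 2 * x ^ 3"
    by (simp add: algebra_simps power2_eq_square power3_eq_cube)
  also have "\<dots> \<le> 1 - real (Suc k) * x + (real (Suc k) * x) ^ 2"
  proof -
    have "(real (Suc k) * x) ^ 2 = (real k * x) ^ 2 + real k * x ^ 2 + real k * x ^ 2 + x ^ 2"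
      by (simp add: algebra_simps power2_eq_square)
    moreover have "0 \<le> (real k) ^ 2 * x ^ 3" "0 \<le> real k * x ^ 2" "0 \<le> x ^ 2" using assms by auto
    ultimately show ?thesis by linarith
  qed
  finally show ?case .
qed simp

text \<open>The expansion of \<open>(1 - 1/m) ^ r\<close> to second order. The factor
  \<open>m\<close> matches the form of the minimum degree condition in
  \<open>local_partite\<close>.\<close>

lemma power_diff_ge:
  assumes "m \<ge> (1::nat)"
  shows "(real r - (real r) ^ 2 / real m) * real m ^ r \<le> real m * (real m ^ r - (real m - 1) ^ r)"
proof -
  define x where "x = 1 / real m"
  have x: "0 \<le> x" "x \<le> 1" "real m * x = 1" using assms by (auto simp: x_def)
  have "(real m - 1) ^ r = (real m * (1 - x)) ^ r" using x(3) by (simp add: right_diff_distrib)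
  then have eq: "(real m - 1) ^ r = real m ^ r * (1 - x) ^ r" by (simp add: power_mult_distrib)
  have "real r * x - (real r * x) ^ 2 \<le> 1 - (1 - x) ^ r" using power_one_minus_le[OF x(1,2), of r] by linarith
  then have "real m * real m ^ r * (real r * x - (real r * x) ^ 2) \<le> real m * real m ^ r * (1 - (1 - x) ^ r)"
    by (rule mult_left_mono) simp
  moreover have e: "real r - (real r) ^ 2 / real m = real m * (real r * x - (real r * x) ^ 2)"
    using assms by (simp add: x_def field_simps power2_eq_square)
  have "(real r - (real r) ^ 2 / real m) * real m ^ r = real m * real m ^ r * (real r * x - (real r * x) ^ 2)"
    unfolding e by (simp only: mult_ac)
  moreover have "real m * (real m ^ r - (real m - 1) ^ r) = real m * real m ^ r * (1 - (1 - x) ^ r)"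
    unfolding eq by (simp add: algebra_simps)
  ultimately show ?thesis by (simp only:)
qed

lemma power_diff_le: "real (Suc m) ^ r - real m ^ r \<le> real r * real (Suc m) ^ (r - 1)"
proof (cases r)
  case (Suc k)
  define x where "x = 1 / real (Suc m)"
  have x: "x \<le> 1" "real (Suc m) * x = 1" by (auto simp: x_def)
  have "real m = real (Suc m) * (1 - x)" using x(2) by (simp add: right_diff_distrib)
  then have eq: "real m ^ r = real (Suc m) ^ r * (1 - x) ^ r" by (metis power_mult_distrib)
  have "1 + real r * (- x) \<le> (1 + - x) ^ r" by (rule Bernoulli_inequality) (use x in auto)
  then have "real (Suc m) ^ r * (1 - (1 - x) ^ r) \<le> real (Suc m) ^ r * (real r * x)"
    by (intro mult_left_mono) auto
  also have "\<dots> = real (Suc m) ^ (r - 1) * (real r * (real (Suc m) * x))" by (simp add: Suc)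
  finally show ?thesis unfolding eq x(2) by (simp add: algebra_simps)
qed simp

section \<open>Growth of the edge number of the balanced blowup\<close>

lemma tdens_pos: "r \<le> t \<Longrightarrow> t > 0 \<Longrightarrow> tdens r t > 0"
  by (simp add: tdens_def)

text \<open>A further vertex adds about \<open>a * r * m^(r-1)\<close> edges, the derivative of
  \<open>a * m^r\<close>. Summed over the missing vertices, this shows that an extremal graph cannot
  owe its edges to a proper subgraph.\<close>

lemma turan_num_growth:
  assumes rt: "r \<ge> 2" "t \<ge> r" and \<epsilon>: "\<epsilon> > 0" "\<epsilon> \<le> tdens r t"
  obtains M where "\<And>m n. M \<le> m \<Longrightarrow> m < n \<Longrightarrow>
    (tdens r t - \<epsilon>) * (real n ^ r - real m ^ r) < real (turan_num r t n) - real (turan_num r t m)"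
proof -
  define a where "a = tdens r t"
  have t: "t > 0" using rt by simp
  have a: "a > 0" using tdens_pos rt by (simp add: a_def)
  define M where "M = max t (nat \<lceil>a * real (r - 1) * (real t + 1) / \<epsilon>\<rceil>)"
  have choose: "real ((t - 1) choose (r - 1)) = a * real r * real t ^ (r - 1)"
  proof -
    have "r * (t choose r) = t * ((t - 1) choose (r - 1))"
      using times_binomial_minus1_eq[of r t] rt by simp
    then have "real r * real (t choose r) = real t * real ((t - 1) choose (r - 1))"
      by (metis of_nat_mult)
    moreover have "real t ^ r = real t * real t ^ (r - 1)" using rt by (cases r) auto
    then have "a * real r * real t ^ (r - 1) = real r * real (t choose r) / real t"
      using t by (simp add: a_def tdens_def)
    ultimately show ?thesis using t by (metis nonzero_mult_div_cancel_left of_nat_0_less_iff less_irrefl)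
  qed
  have step: "(a - \<epsilon>) * (real (Suc m) ^ r - real m ^ r) < real (turan_num r t (Suc m)) - real (turan_num r t m)"
    if m: "M \<le> m" for m
  proof -
    have mt: "m \<ge> t" using m by (simp add: M_def)
    \<comment> \<open>The relative error of replacing \<open>m div t\<close> by
      \<open>(m + 1) / t\<close>: rounding costs at most \<open>t\<close>, the shift costs
      \<open>1\<close>.\<close>
    define x where "x = (real t + 1) / real (Suc m)"
    have x: "x \<le> 1" "real (Suc m) * (1 - x) = real m - real t"
      using mt by (auto simp: x_def field_simps)
    have "real m - real t \<le> real t * real (m div t)"
    proof -
      have "m \<le> t * (m div t) + t"
        using mod_less_divisor[OF t, of m] mult_div_mod_eq[of t m] by linarith
      then have "real m \<le> real (t * (m div t) + t)" by (simp only: of_nat_le_iff)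
      then show ?thesis by simp
    qed
    then have pw: "(real m - real t) ^ (r - 1) \<le> (real t * real (m div t)) ^ (r - 1)"
      using mt by (intro power_mono) auto
    have "1 + real (r - 1) * (- x) \<le> (1 + - x) ^ (r - 1)" by (rule Bernoulli_inequality) (use x in auto)
    then have B: "1 - real (r - 1) * x \<le> (1 - x) ^ (r - 1)" by simp
    have "a * real (r - 1) * (real t + 1) / \<epsilon> < real (Suc m)" using m unfolding M_def by linarith
    then have "a * (real (r - 1) * x) < \<epsilon>" using \<epsilon> by (simp add: x_def field_simps)
    then have "a - \<epsilon> < a * (1 - real (r - 1) * x)" by (simp add: algebra_simps)
    also have "\<dots> \<le> a * (1 - x) ^ (r - 1)" using B a by (intro mult_left_mono) auto
    finally have "(a - \<epsilon>) * (real r * real (Suc m) ^ (r - 1)) < a * (1 - x) ^ (r - 1) * (real r * real (Suc m) ^ (r - 1))"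
      using rt by (intro mult_strict_right_mono) auto
    also have "\<dots> = a * real r * (real (Suc m) * (1 - x)) ^ (r - 1)" by (simp add: power_mult_distrib mult_ac)
    also have "\<dots> = a * real r * (real m - real t) ^ (r - 1)" by (simp only: x(2))
    also have "\<dots> \<le> a * real r * (real t * real (m div t)) ^ (r - 1)"
      using pw a by (intro mult_left_mono) auto
    also have "\<dots> = real (((t-1) choose (r-1)) * (m div t) ^ (r-1))"
      by (simp only: of_nat_mult of_nat_power choose power_mult_distrib mult_ac)
    also have "\<dots> \<le> real (turan_num r t (Suc m)) - real (turan_num r t m)"
      using turan_num_Suc[OF rt(1) t, of m] by linarith
    finally have "(a - \<epsilon>) * (real r * real (Suc m) ^ (r - 1)) < real (turan_num r t (Suc m)) - real (turan_num r t m)" .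
    moreover have "(a - \<epsilon>) * (real (Suc m) ^ r - real m ^ r) \<le> (a - \<epsilon>) * (real r * real (Suc m) ^ (r - 1))"
      using \<epsilon> by (intro mult_left_mono power_diff_le) (auto simp: a_def)
    ultimately show ?thesis by linarith
  qed
  show ?thesis
  proof (rule that[of M, folded a_def])
    fix m n :: nat assume "M \<le> m" "m < n"
    then show "(a - \<epsilon>) * (real n ^ r - real m ^ r) < real (turan_num r t n) - real (turan_num r t m)"
    proof (induction n)
      case (Suc n)
      show ?case
      proof (cases "m = n")
        case True
        then show ?thesis using step Suc by simp
      next
        case False
        then have "(a - \<epsilon>) * (real n ^ r - real m ^ r) < real (turan_num r t n) - real (turan_num r t m)"
          using Suc by simp
        moreover have "(a - \<epsilon>) * (real (Suc n) ^ r - real n ^ r) < real (turan_num r t (Suc n)) - real (turan_num r t n)"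
          using step Suc by simp
        ultimately show ?thesis by (simp add: algebra_simps)
      qed
    qed simp
  qed
qed

lemma turan_num_asymp:
  assumes rt: "r \<ge> 2" "t \<ge> r" and \<epsilon>: "\<epsilon> > 0"
  obtains M where "\<And>n. M \<le> n \<Longrightarrow> (tdens r t - \<epsilon>) * real n ^ r \<le> real (turan_num r t n)"
proof -
  define a where "a = tdens r t"
  have t: "t > 0" using rt by simp
  have a: "a > 0" using tdens_pos rt by (simp add: a_def)
  show ?thesis
  proof (rule that[of "max t (nat \<lceil>a * real r * real t / \<epsilon>\<rceil> + 1)", folded a_def])
    fix n assume n: "max t (nat \<lceil>a * real r * real t / \<epsilon>\<rceil> + 1) \<le> n"
    then have nt: "n \<ge> t" and n1: "a * real r * real t / \<epsilon> \<le> real n" and np: "real n > 0" by linarith+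
    define x where "x = real t / real n"
    have x: "x \<le> 1" using nt np by (simp add: x_def)
    have nx: "real n * (1 - x) = real n - real t" using np by (simp add: x_def right_diff_distrib)
    have "n \<le> t * (n div t) + t"
      using mod_less_divisor[OF t, of n] mult_div_mod_eq[of t n] by linarith
    then have "real n \<le> real (t * (n div t) + t)" by (simp only: of_nat_le_iff)
    then have le: "real n - real t \<le> real t * real (n div t)" by simp
    have "1 + real r * (- x) \<le> (1 + - x) ^ r" by (rule Bernoulli_inequality) (use x in auto)
    then have B: "1 - real r * x \<le> (1 - x) ^ r" by simp
    have "a * (real r * x) \<le> \<epsilon>" using n1 np \<epsilon> by (simp add: x_def field_simps)
    then have "a - \<epsilon> \<le> a * (1 - real r * x)" by (simp add: algebra_simps)
    also have "\<dots> \<le> a * (1 - x) ^ r" using B a by (intro mult_left_mono) auto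
    finally have "(a - \<epsilon>) * real n ^ r \<le> a * (1 - x) ^ r * real n ^ r" by (rule mult_right_mono) simp
    also have "\<dots> = a * (real n * (1 - x)) ^ r" by (simp add: power_mult_distrib mult_ac)
    also have "\<dots> \<le> a * (real t * real (n div t)) ^ r"
      unfolding nx using le nt a by (intro mult_left_mono power_mono) auto
    also have "\<dots> = real ((t choose r) * (n div t) ^ r)"
      using t by (simp add: a_def tdens_def power_mult_distrib)
    also have "\<dots> \<le> real (turan_num r t n)" using turan_num_ge[OF t, of r n] by (simp only: of_nat_le_iff)
    finally show "(a - \<epsilon>) * real n ^ r \<le> real (turan_num r t n)" .
  qed
qed

section \<open>Subgraphs of maximal surplus\<close>

lemma unif_card_le_pow: "unif r V E \<Longrightarrow> card E \<le> card V ^ r"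
proof -
  assume E: "unif r V E"
  then have "card E \<le> card {B. B \<subseteq> V \<and> card B = r}"
    by (intro card_mono) (auto simp: unif_def)
  then show ?thesis using card_subsets_le_pow[of V r] E by (auto simp: unif_def)
qed

text \<open>\<open>W\<close> maximises \<open>e(W) - b * |W|^r\<close>. Deleting a vertex does not
  increase this quantity, so each degree is at least the difference of the two powers, about
  \<open>b * r * |W|^(r-1)\<close>; comparison with \<open>V\<close> itself gives the other
  inequality.\<close>

lemma shrink:
  assumes E: "unif r V E"
  obtains W where "W \<subseteq> V"
    "real (card E) - b * real (card V) ^ r \<le> real (card {e \<in> E. e \<subseteq> W}) - b * real (card W) ^ r"
    "\<And>v. v \<in> W \<Longrightarrow> b * (real (card W) ^ r - (real (card W) - 1) ^ r) \<le> real (card {e \<in> {e \<in> E. e \<subseteq> W}. v \<in> e})"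
proof -
  have V: "finite V" and fE: "finite E" using E unif_finite_edges by (auto simp: unif_def)
  define \<Phi> where "\<Phi> = (\<lambda>W. real (card {e \<in> E. e \<subseteq> W}) - b * real (card W) ^ r)"
  obtain W where W: "W \<subseteq> V" "\<And>W'. W' \<subseteq> V \<Longrightarrow> \<Phi> W' \<le> \<Phi> W"
    using ex_max_on[of "Pow V" \<Phi>] V by auto
  have "{e \<in> E. e \<subseteq> V} = E" using E by (auto simp: unif_def)
  then have 1: "real (card E) - b * real (card V) ^ r \<le> real (card {e \<in> E. e \<subseteq> W}) - b * real (card W) ^ r"
    using W(2)[of V] by (simp add: \<Phi>_def)
  have 2: "b * (real (card W) ^ r - (real (card W) - 1) ^ r) \<le> real (card {e \<in> {e \<in> E. e \<subseteq> W}. v \<in> e})"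
    if v: "v \<in> W" for v
  proof -
    have fW: "finite W" using W V finite_subset by blast
    have c: "real (card (W - {v})) = real (card W) - 1"
      using v fW card_gt_0_iff[of W] by (auto simp: of_nat_diff Suc_leI)
    have "card {e \<in> E. e \<subseteq> W} = card ({e \<in> E. e \<subseteq> W - {v}} \<union> {e \<in> {e \<in> E. e \<subseteq> W}. v \<in> e})"
      by (rule arg_cong[where f = card]) auto
    also have "card ({e \<in> E. e \<subseteq> W - {v}} \<union> {e \<in> {e \<in> E. e \<subseteq> W}. v \<in> e})
      = card {e \<in> E. e \<subseteq> W - {v}} + card {e \<in> {e \<in> E. e \<subseteq> W}. v \<in> e}"
      using fE by (intro card_Un_disjoint) auto
    finally have "real (card {e \<in> E. e \<subseteq> W})
        = real (card {e \<in> E. e \<subseteq> W - {v}}) + real (card {e \<in> {e \<in> E. e \<subseteq> W}. v \<in> e})"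
      by (simp only: of_nat_add)
    moreover have "\<Phi> (W - {v}) \<le> \<Phi> W" using W by blast
    ultimately show ?thesis unfolding \<Phi>_def c right_diff_distrib by linarith
  qed
  show ?thesis using that[OF W(1) 1 2] .
qed

text \<open>Turns the degree bound of \<open>shrink\<close> into the one required by
  \<open>local_partite\<close>; half of \<epsilon>' absorbs \<epsilon> and half absorbs the
  second-order term of the power difference.\<close>

lemma min_degree_convert:
  assumes m: "m \<ge> 1" and \<epsilon>: "0 \<le> \<epsilon>" "\<epsilon> \<le> a" "\<epsilon> * real r \<le> \<epsilon>' / 2" "2 * a * (real r) ^ 2 \<le> \<epsilon>' * real m"
    and d: "(a - \<epsilon>) * (real m ^ r - (real m - 1) ^ r) \<le> d"
  shows "(a * real r - \<epsilon>') * real m ^ r \<le> d * real m"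
proof -
  define y where "y = (real r) ^ 2 / real m"
  have ge: "(real r - y) * real m ^ r \<le> real m * (real m ^ r - (real m - 1) ^ r)"
    unfolding y_def by (rule power_diff_ge[OF m])
  have "a * y \<le> \<epsilon>' / 2" using \<epsilon>(4) m by (simp add: y_def field_simps)
  moreover have "0 \<le> \<epsilon> * y" using \<epsilon>(1) by (simp add: y_def)
  ultimately have "a * real r - \<epsilon>' \<le> (a - \<epsilon>) * (real r - y)"
    using \<epsilon>(3) by (simp add: algebra_simps)
  then have "(a * real r - \<epsilon>') * real m ^ r \<le> (a - \<epsilon>) * (real r - y) * real m ^ r"
    by (rule mult_right_mono) simp
  also have "\<dots> = (a - \<epsilon>) * ((real r - y) * real m ^ r)" by (simp only: mult.assoc)
  also have "\<dots> \<le> (a - \<epsilon>) * (real m * (real m ^ r - (real m - 1) ^ r))"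
    using ge \<epsilon>(2) by (intro mult_left_mono) auto
  also have "\<dots> \<le> d * real m" using mult_right_mono[OF d, of "real m"] by (simp add: mult_ac)
  finally show ?thesis .
qed

text \<open>Symmetrization never loses edges, so it is enough to bound the terminal graph, which is
  \<open>t\<close>-partite or \<open>F\<close>-free.\<close>

lemma core_free_upper:
  fixes F :: "'a hgraph" and V :: "nat set"
  assumes rt: "r \<ge> 2" "t \<ge> r" and F: "rgraph r F" "covers_pairs F" "card (verts F) \<le> t"
    and \<kappa>: "\<kappa> > 0" "\<And>(V :: nat set) E. unif r V E \<Longrightarrow> card V \<ge> n1 \<Longrightarrow> \<not> embeds F V E \<Longrightarrow>
       real (card E) \<le> (tdens r t - \<kappa>) * real (card V) ^ r"
    and E: "unif r V E" "\<not> has_core t F V E" "n1 \<le> card V"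
  shows "real (card E) \<le> tdens r t * real (card V) ^ r"
  using E(1,2)
proof (induction rule: symmetrization_induct)
  case (terminal E)
  then consider \<chi> where "\<chi> ` V \<subseteq> {..<t}" "\<forall>e\<in>E. inj_on \<chi> e" | "\<not> embeds F V E"
    using symmetrized_structure[OF terminal(1,2) F] by blast
  then show ?case
  proof cases
    case 1
    have t: "t > 0" using rt by simp
    have "card E \<le> turan_num r t (card V)" by (rule partite_card_le[OF terminal(1) rt(1) t 1])
    then show ?thesis using turan_num_le_tdens[OF rt(1) t, of "card V"] by linarith
  next
    case 2
    have "(tdens r t - \<kappa>) * real (card V) ^ r \<le> tdens r t * real (card V) ^ r"
      using \<kappa>(1) by (intro mult_right_mono) auto
    then show ?thesis using \<kappa>(2)[OF terminal(1) E(3) 2] by linarith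
  qed
next
  case (step E E' v)
  then show ?case by linarith
qed

section \<open>Stability\<close>

text \<open>Backward induction along the symmetrization with one fixed error \<delta>'. Carrying the
  colouring back over a step triples the error at worst. \<open>local_partite\<close> then replaces
  it by an exact colouring of a subgraph \<open>W\<close>, whose edges alone already reach the error
  \<delta>' again.\<close>

lemma stability:
  fixes F :: "'a hgraph"
  assumes rt: "r \<ge> 2" "t \<ge> r" and F: "rgraph r F" "covers_pairs F" "card (verts F) \<le> t"
    and \<kappa>: "\<kappa> > 0" "\<And>(V :: nat set) E. unif r V E \<Longrightarrow> card V \<ge> n1 \<Longrightarrow> \<not> embeds F V E \<Longrightarrow>
       real (card E) \<le> (tdens r t - \<kappa>) * real (card V) ^ r"
    and \<eta>: "\<eta> > 0"
  obtains \<epsilon> N where "\<epsilon> > 0"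
    "\<And>(V :: nat set) E. unif r V E \<Longrightarrow> \<not> has_core t F V E \<Longrightarrow> N \<le> card V \<Longrightarrow>
      (tdens r t - \<epsilon>) * real (card V) ^ r \<le> real (card E) \<Longrightarrow>
      \<exists>\<chi>. \<chi> ` V \<subseteq> {..<t} \<and> (tdens r t - \<eta>) * real (card V) ^ r \<le> real (card {e \<in> E. inj_on \<chi> e})"
proof -
  define a where "a = tdens r t"
  have t: "t > 0" using rt by simp
  have a: "a > 0" using tdens_pos rt by (simp add: a_def)
  obtain \<epsilon>L \<delta>L nL where L: "\<epsilon>L > 0" "\<delta>L > 0"
    "\<And>(V :: nat set) E \<chi>. unif r V E \<Longrightarrow> \<not> embeds (Ext r (add_isolated (t + 1) F)) V E \<Longrightarrow>
      nL \<le> card V \<Longrightarrow> \<chi> ` V \<subseteq> {..<t} \<Longrightarrow>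
      (tdens r t - \<delta>L) * real (card V) ^ r \<le> real (card {e \<in> E. inj_on \<chi> e}) \<Longrightarrow>
      (\<And>v. v \<in> V \<Longrightarrow> (tdens r t * real r - \<epsilon>L) * real (card V) ^ r \<le> real (card {e \<in> E. v \<in> e}) * real (card V)) \<Longrightarrow>
      \<exists>\<iota>. \<iota> ` V \<subseteq> {..<t} \<and> (\<forall>e\<in>E. inj_on \<iota> e)"
    by (fact local_partite[OF rt F(1,3), where ?'v = nat])
  \<comment> \<open>Three errors \<delta>' add up before \<open>local_partite\<close> is applied:
    from the induction hypothesis, from the edges at \<open>v\<close>, and from the edges outside
    \<open>W\<close>.\<close>
  define \<delta>' where "\<delta>' = min \<eta> (\<delta>L / 4)"
  have \<delta>': "\<delta>' > 0" "\<delta>' \<le> \<eta>" "\<delta>' \<le> \<delta>L / 4" using \<eta> L(2) by (auto simp: \<delta>'_def)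
  \<comment> \<open>Bounds the relative loss of \<open>n^r\<close> in passing to \<open>W\<close>;
    \<open>a *\<close> \<theta> bounds the resulting loss of edges, and \<open>1/2\<close> keeps
    \<open>W\<close> large.\<close>
  define \<theta> where "\<theta> = min (1 / 2) (\<delta>' / (2 * a))"
  have \<theta>: "\<theta> > 0" "\<theta> \<le> 1 / 2" "\<theta> \<le> \<delta>' / (2 * a)" using \<delta>'(1) a by (simp_all add: \<theta>_def)
  have a\<theta>: "a * \<theta> \<le> \<delta>' / 2" using \<theta>(3) a by (simp add: field_simps)
  define \<epsilon> where "\<epsilon> = min a (\<epsilon>L / (2 * real r))"
  have \<epsilon>: "\<epsilon> > 0" "\<epsilon> \<le> a" "\<epsilon> \<le> \<epsilon>L / (2 * real r)"
  proof -
    show "\<epsilon> > 0" using a L(1) rt by (simp add: \<epsilon>_def)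
    show "\<epsilon> \<le> a" "\<epsilon> \<le> \<epsilon>L / (2 * real r)" by (simp_all add: \<epsilon>_def)
  qed
  have \<epsilon>r: "\<epsilon> * real r \<le> \<epsilon>L / 2" using \<epsilon>(3) rt by (simp add: field_simps)
  \<comment> \<open>The first entry excludes an \<open>F\<close>-free terminal graph, the second
    bounds the edges missing from \<open>W\<close>, the third forces \<open>W\<close> to be close to
    \<open>V\<close>.\<close>
  define \<epsilon>1 where "\<epsilon>1 = min (\<kappa> / 2) (min (\<delta>' / 2) (\<theta> * \<epsilon> / 2))"
  have \<epsilon>1: "\<epsilon>1 > 0" "\<epsilon>1 \<le> \<kappa> / 2" "\<epsilon>1 \<le> \<delta>' / 2" "\<epsilon>1 \<le> \<theta> * \<epsilon> / 2"
  proof -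
    have "\<theta> * \<epsilon> / 2 > 0" using \<theta>(1) \<epsilon>(1) by simp
    then show "\<epsilon>1 > 0" using \<kappa>(1) \<delta>'(1) by (simp add: \<epsilon>1_def)
    show "\<epsilon>1 \<le> \<kappa> / 2" "\<epsilon>1 \<le> \<delta>' / 2" "\<epsilon>1 \<le> \<theta> * \<epsilon> / 2" unfolding \<epsilon>1_def by linarith+
  qed
  define M where "M = nL + n1 + 1 + nat \<lceil>2 * a * (real r) ^ 2 / \<epsilon>L\<rceil>"
  \<comment> \<open>Covers the case that \<open>W\<close> has fewer than \<open>n1\<close> vertices,
    where \<open>core_free_upper\<close> does not apply.\<close>
  define C0 where "C0 = real n1 ^ r"
  define N where "N = n1 + 2 * M ^ r + 1 + nat \<lceil>1 / \<delta>'\<rceil> + nat \<lceil>2 * C0 / (\<theta> * \<epsilon>)\<rceil>"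
  have main: "(a - \<epsilon>1) * real (card V) ^ r \<le> real (card E) \<longrightarrow>
      (\<exists>\<chi>. \<chi> ` V \<subseteq> {..<t} \<and> (a - \<delta>') * real (card V) ^ r \<le> real (card {e \<in> E. inj_on \<chi> e}))"
    if VE: "unif r V E" "\<not> has_core t F V E" and n: "N \<le> card V" for V :: "nat set" and E
    using VE
  proof (induction rule: symmetrization_induct)
    case (terminal E)
    let ?R = "real (card V) ^ r"
    have R: "?R > 0" using n by (simp add: N_def)
    show ?case
    proof
      assume ge: "(a - \<epsilon>1) * ?R \<le> real (card E)"
      have "(a - \<kappa>) * ?R < (a - \<epsilon>1) * ?R" using \<epsilon>1(2) \<kappa>(1) R by (intro mult_strict_right_mono) auto
      moreover have "n1 \<le> card V" using n by (simp add: N_def)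
      ultimately have "embeds F V E" using \<kappa>(2)[OF terminal(1)] ge unfolding a_def
        by (meson not_le order_trans)
      then obtain \<chi> where \<chi>: "\<chi> ` V \<subseteq> {..<t}" "\<forall>e\<in>E. inj_on \<chi> e"
        using symmetrized_structure[OF terminal(1,2) F terminal(3)] by blast
      then have "{e \<in> E. inj_on \<chi> e} = E" by blast
      moreover have "(a - \<delta>') * ?R \<le> (a - \<epsilon>1) * ?R" using \<epsilon>1 \<delta>' R by (intro mult_right_mono) auto
      ultimately have "(a - \<delta>') * ?R \<le> real (card {e \<in> E. inj_on \<chi> e})" using ge by simp
      then show "\<exists>\<chi>. \<chi> ` V \<subseteq> {..<t} \<and> (a - \<delta>') * ?R \<le> real (card {e \<in> E. inj_on \<chi> e})" using \<chi> by blast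
    qed
  next
    case (step E E' v)
    let ?n = "real (card V)"
    define R where "R = ?n ^ r"
    have V: "finite V" using step(1) by (simp add: unif_def)
    have fE: "finite E" "finite E'"
      by (rule unif_finite_edges[OF step(1)], rule unif_finite_edges[OF step(3)])
    have np: "?n > 0" "?n \<ge> 1" using n by (auto simp: N_def)
    have R: "R > 0" using np by (simp add: R_def)
    have nR: "?n \<le> R" unfolding R_def using np rt by (intro self_le_power) auto
    show ?case
    proof
      assume "(a - \<epsilon>1) * ?n ^ r \<le> real (card E)"
      then have ge: "(a - \<epsilon>1) * R \<le> real (card E)" by (simp add: R_def)
      then have "(a - \<epsilon>1) * ?n ^ r \<le> real (card E')" using step(7) by (simp add: R_def)
      then obtain \<chi> where \<chi>: "\<chi> ` V \<subseteq> {..<t}" "(a - \<delta>') * R \<le> real (card {e \<in> E'. inj_on \<chi> e})"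
        using step(8) unfolding R_def by blast
      \<comment> \<open>The two graphs differ only in edges at \<open>v\<close>, of which there are
        at most \<open>n^(r-1)\<close>, hence at most \<delta>' \<open>* n^r\<close>.\<close>
      have "{e \<in> E'. inj_on \<chi> e} \<subseteq> {e \<in> E. inj_on \<chi> e} \<union> {e \<in> E'. {v} \<subseteq> e}" using step(6) by auto
      then have "card {e \<in> E'. inj_on \<chi> e} \<le> card ({e \<in> E. inj_on \<chi> e} \<union> {e \<in> E'. {v} \<subseteq> e})"
        by (rule card_mono[rotated]) (use fE in auto)
      also have "\<dots> \<le> card {e \<in> E. inj_on \<chi> e} + deg E' {v}" unfolding deg_def by (rule card_Un_le)
      finally have 1: "real (card {e \<in> E'. inj_on \<chi> e}) \<le> real (card {e \<in> E. inj_on \<chi> e}) + real (deg E' {v})"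
        by linarith
      have "deg E' {v} * card V \<le> card V ^ r" using deg_mult_le[OF step(3), of "{v}"] by simp
      then have d1: "real (deg E' {v}) * ?n \<le> R" unfolding R_def by (metis of_nat_le_iff of_nat_mult of_nat_power)
      have "1 / \<delta>' \<le> ?n" using n unfolding N_def by linarith
      then have "R \<le> \<delta>' * R * ?n" using \<delta>'(1) R by (simp add: field_simps)
      then have "real (deg E' {v}) * ?n \<le> (\<delta>' * R) * ?n" using d1 by linarith
      then have "real (deg E' {v}) \<le> \<delta>' * R" using np by simp
      then have tr2: "(a - 2 * \<delta>') * R \<le> real (card {e \<in> E. inj_on \<chi> e})"
        using 1 \<chi>(2) by (simp add: algebra_simps)
      obtain W where W: "W \<subseteq> V"
        "real (card E) - (a - \<epsilon>) * ?n ^ r \<le> real (card {e \<in> E. e \<subseteq> W}) - (a - \<epsilon>) * real (card W) ^ r"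
        "\<And>v. v \<in> W \<Longrightarrow> (a - \<epsilon>) * (real (card W) ^ r - (real (card W) - 1) ^ r)
          \<le> real (card {e \<in> {e \<in> E. e \<subseteq> W}. v \<in> e})"
        by (fact shrink[OF step(1)])
      define EW where "EW = {e \<in> E. e \<subseteq> W}"
      let ?m = "real (card W)"
      define S where "S = ?m ^ r"
      have uW: "unif r W EW" unfolding EW_def by (rule unif_restrict[OF step(1) W(1)])
      have EWE: "EW \<subseteq> E" by (auto simp: EW_def)
      have nc: "\<not> has_core t F W EW" using step(2) has_core_mono[OF _ W(1) EWE] by blast
      have mn: "card W \<le> card V" by (rule card_mono[OF V W(1)])
      have SR: "S \<le> R" unfolding S_def R_def using mn by (intro power_mono) auto
      have S0: "S \<ge> 0" by (simp add: S_def)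
      have up: "real (card EW) \<le> a * S + C0"
      proof (cases "n1 \<le> card W")
        case True
        then have "real (card EW) \<le> a * S"
          using core_free_upper[OF rt F \<kappa> uW nc] unfolding a_def S_def by blast
        moreover have "C0 \<ge> 0" by (simp add: C0_def)
        ultimately show ?thesis by linarith
      next
        case False
        have "real (card EW) \<le> S" using unif_card_le_pow[OF uW] unfolding S_def by (metis of_nat_le_iff of_nat_power)
        also have "S \<le> C0" unfolding S_def C0_def using False by (intro power_mono) auto
        finally show ?thesis using a S0 by (simp add: add_increasing)
      qed
      have W2: "real (card E) - (a - \<epsilon>) * R \<le> real (card EW) - (a - \<epsilon>) * S"
        using W(2) unfolding R_def S_def EW_def .
      have "2 * C0 / (\<theta> * \<epsilon>) \<le> ?n" using n unfolding N_def by linarith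
      then have "2 * C0 \<le> ?n * (\<theta> * \<epsilon>)" using \<theta>(1) \<epsilon>(1) by (simp add: divide_le_eq)
      also have "\<dots> \<le> R * (\<theta> * \<epsilon>)" using nR \<theta>(1) \<epsilon>(1) by (intro mult_right_mono) auto
      finally have C0: "C0 \<le> \<theta> * \<epsilon> / 2 * R" by (simp add: mult_ac)
      have e1R: "\<epsilon>1 * R \<le> \<theta> * \<epsilon> / 2 * R" using \<epsilon>1(4) R by (intro mult_right_mono) auto
      \<comment> \<open>The surplus of \<open>E\<close> over \<open>(a -\<close>
        \<epsilon>\<open>) * R\<close> is at least \<open>(\<close>\<epsilon> \<open>-\<close>
        \<epsilon>1\<open>) * R\<close>, whereas that of \<open>W\<close> is at most \<epsilon>
        \<open>* S + C0\<close>.\<close>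
      have "\<epsilon> * R - \<epsilon> * S \<le> \<theta> * \<epsilon> * R"
        using W2 up ge C0 e1R by (simp add: algebra_simps)
      then have "\<epsilon> * (R - S) \<le> \<epsilon> * (\<theta> * R)" by (simp add: algebra_simps)
      then have close: "R - S \<le> \<theta> * R" using \<epsilon>(1) by simp
      have "\<theta> * R \<le> 1 / 2 * R" using \<theta>(2) R by (intro mult_right_mono) auto
      then have "R / 2 \<le> S" using close by simp
      moreover have "2 * real M ^ r \<le> R"
      proof -
        have "2 * M ^ r \<le> card V" using n unfolding N_def by linarith
        then have "real (2 * M ^ r) \<le> ?n" by (simp only: of_nat_le_iff)
        then show ?thesis using nR by simp
      qed
      ultimately have "real M ^ r \<le> ?m ^ r" unfolding S_def by linarith
      then have "real M \<le> ?m" using rt by (intro power_le_imp_le_base[of "real M" "r - 1"]) auto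
      then have Mm: "M \<le> card W" by simp
      have m1: "card W \<ge> 1" using Mm by (simp add: M_def)
      have "2 * a * (real r) ^ 2 / \<epsilon>L \<le> ?m" using Mm unfolding M_def by linarith
      then have mL: "2 * a * (real r) ^ 2 \<le> \<epsilon>L * ?m" using L(1) by (simp add: divide_le_eq mult.commute)
      have mindeg: "(tdens r t * real r - \<epsilon>L) * ?m ^ r \<le> real (card {e \<in> EW. v \<in> e}) * ?m" if "v \<in> W" for v
        unfolding a_def[symmetric] EW_def
        by (rule min_degree_convert[OF m1 _ \<epsilon>(2) \<epsilon>r mL W(3)[OF that]]) (use \<epsilon> in simp)
      have "(a - \<epsilon>) * (R - S) \<le> a * (\<theta> * R)"
        using close SR \<epsilon> a by (intro mult_mono) auto
      then have EWge: "(a - \<epsilon>1 - a * \<theta>) * R \<le> real (card EW)"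
        using W2 ge by (simp add: algebra_simps)
      have EWge': "(a - \<delta>') * R \<le> real (card EW)"
      proof -
        have "(a - \<delta>') * R \<le> (a - \<epsilon>1 - a * \<theta>) * R" using \<epsilon>1(3) a\<theta> R by (intro mult_right_mono) auto
        then show ?thesis using EWge by linarith
      qed
      have Eup: "real (card E) \<le> a * R"
        using core_free_upper[OF rt F \<kappa> step(1,2)] n unfolding a_def R_def N_def by auto
      have "card {e \<in> E. inj_on \<chi> e} \<le> card ({e \<in> EW. inj_on \<chi> e} \<union> (E - EW))"
        by (rule card_mono) (use fE EWE in \<open>auto intro: finite_subset\<close>)
      also have "\<dots> \<le> card {e \<in> EW. inj_on \<chi> e} + card (E - EW)" by (rule card_Un_le)
      finally have "real (card {e \<in> E. inj_on \<chi> e}) \<le> real (card {e \<in> EW. inj_on \<chi> e}) + real (card (E - EW))"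
        by linarith
      moreover have "real (card (E - EW)) = real (card E) - real (card EW)"
        using EWE fE card_mono[OF fE(1) EWE] finite_subset[OF EWE fE(1)]
        by (simp add: card_Diff_subset of_nat_diff)
      ultimately have "(a - 3 * \<delta>') * R \<le> real (card {e \<in> EW. inj_on \<chi> e})"
        using tr2 EWge' Eup by (simp add: algebra_simps)
      moreover have "(a - \<delta>L) * R \<le> (a - 3 * \<delta>') * R" using \<delta>' L(2) R by (intro mult_right_mono) auto
      ultimately have tW: "(a - \<delta>L) * R \<le> real (card {e \<in> EW. inj_on \<chi> e})" by linarith
      \<comment> \<open>If \<open>a -\<close> \<delta>L is negative, passing from \<open>R\<close>
        to the smaller \<open>S\<close> reverses the inequality, but then the claim is
        trivial.\<close>
      have tW': "(tdens r t - \<delta>L) * ?m ^ r \<le> real (card {e \<in> EW. inj_on \<chi> e})"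
      proof (cases "a - \<delta>L \<ge> 0")
        case True
        then have "(a - \<delta>L) * S \<le> (a - \<delta>L) * R" using SR by (rule mult_left_mono[rotated])
        then show ?thesis using tW unfolding a_def S_def by linarith
      next
        case False
        then have "(a - \<delta>L) * S \<le> 0" using S0 by (simp add: mult_nonpos_nonneg)
        then show ?thesis unfolding a_def S_def by linarith
      qed
      have nemb: "\<not> embeds (Ext r (add_isolated (t + 1) F)) W EW"
        using nc embeds_Ext_imp_has_core[OF F(1,3)] by blast
      have nLm: "nL \<le> card W" using Mm by (simp add: M_def)
      have \<chi>W: "\<chi> ` W \<subseteq> {..<t}" using \<chi>(1) W(1) by blast
      obtain \<iota> where \<iota>: "\<iota> ` W \<subseteq> {..<t}" "\<forall>e\<in>EW. inj_on \<iota> e"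
        using L(3)[OF uW nemb nLm \<chi>W tW' mindeg] by blast
      \<comment> \<open>The colour outside \<open>W\<close> is arbitrary, since only edges inside
        \<open>W\<close> are counted.\<close>
      define \<chi>2 where "\<chi>2 = (\<lambda>v. if v \<in> W then \<iota> v else 0)"
      have "\<chi>2 ` V \<subseteq> {..<t}" using \<iota>(1) t by (auto simp: \<chi>2_def)
      moreover have "EW \<subseteq> {e \<in> E. inj_on \<chi>2 e}"
      proof
        fix e assume e: "e \<in> EW"
        then have "e \<subseteq> W" by (simp add: EW_def)
        then have "inj_on \<chi>2 e = inj_on \<iota> e" by (intro inj_on_cong) (auto simp: \<chi>2_def)
        then show "e \<in> {e \<in> E. inj_on \<chi>2 e}" using e \<iota>(2) EWE by blast
      qed
      then have "card EW \<le> card {e \<in> E. inj_on \<chi>2 e}" by (rule card_mono[rotated]) (use fE in auto)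
      then have "(a - \<delta>') * R \<le> real (card {e \<in> E. inj_on \<chi>2 e})" using EWge' by linarith
      ultimately show "\<exists>\<chi>. \<chi> ` V \<subseteq> {..<t} \<and> (a - \<delta>') * ?n ^ r \<le> real (card {e \<in> E. inj_on \<chi> e})"
        unfolding R_def by blast
    qed
  qed
  show ?thesis
  proof (rule that[OF \<epsilon>1(1), of N])
    fix V :: "nat set" and E
    assume *: "unif r V E" "\<not> has_core t F V E" "N \<le> card V" "(tdens r t - \<epsilon>1) * real (card V) ^ r \<le> real (card E)"
    obtain \<chi> where \<chi>: "\<chi> ` V \<subseteq> {..<t}" "(a - \<delta>') * real (card V) ^ r \<le> real (card {e \<in> E. inj_on \<chi> e})"
      using main[OF *(1-3)] *(4) unfolding a_def by blast
    have "(a - \<eta>) * real (card V) ^ r \<le> (a - \<delta>') * real (card V) ^ r"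
      using \<delta>'(2) by (intro mult_right_mono) auto
    then have "(tdens r t - \<eta>) * real (card V) ^ r \<le> real (card {e \<in> E. inj_on \<chi> e})"
      using \<chi>(2) unfolding a_def by linarith
    then show "\<exists>\<chi>. \<chi> ` V \<subseteq> {..<t} \<and> (tdens r t - \<eta>) * real (card V) ^ r \<le> real (card {e \<in> E. inj_on \<chi> e})"
      using \<chi>(1) by blast
  qed
qed

section \<open>Extremal graphs\<close>

text \<open>\<open>local_partite\<close> is applied to the surplus-maximal subgraph
  \<open>W\<close>. Its colouring comes from cleaning and stability, but the partite conclusion is
  for all edges inside \<open>W\<close>, cleaned away or not. Being \<open>t\<close>-partite,
  \<open>W\<close> has at most \<open>turan_num\<close> edges, and the growth of
  \<open>turan_num\<close> leaves only \<open>W = V\<close>.\<close>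

lemma extremal_partite:
  fixes F :: "'a hgraph"
  assumes rt: "r \<ge> 2" "t \<ge> r" and F: "rgraph r F" "covers_pairs F" "card (verts F) \<le> t"
    and dens: "turan_density r F < fact r * tdens r t"
  obtains N where
    "\<And>(V :: nat set) E. unif r V E \<Longrightarrow> \<not> embeds (Ext r (add_isolated (t + 1) F)) V E \<Longrightarrow>
      N \<le> card V \<Longrightarrow> turan_num r t (card V) \<le> card E \<Longrightarrow>
      \<exists>\<chi>. \<chi> ` V \<subseteq> {..<t} \<and> (\<forall>e\<in>E. inj_on \<chi> e)"
proof -
  define a where "a = tdens r t"
  have t: "t > 0" using rt by simp
  have a: "a > 0" using tdens_pos rt by (simp add: a_def)
  obtain \<kappa> n1 where \<kappa>: "\<kappa> > 0" "\<And>(V :: nat set) E. unif r V E \<Longrightarrow> card V \<ge> n1 \<Longrightarrow> \<not> embeds F V E \<Longrightarrow>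
       real (card E) \<le> (tdens r t - \<kappa>) * real (card V) ^ r"
    by (fact embeds_free_edge_bound[OF F(1) dens])
  obtain \<epsilon>L \<delta>L nL where L: "\<epsilon>L > 0" "\<delta>L > 0"
    "\<And>(V :: nat set) E \<chi>. unif r V E \<Longrightarrow> \<not> embeds (Ext r (add_isolated (t + 1) F)) V E \<Longrightarrow>
      nL \<le> card V \<Longrightarrow> \<chi> ` V \<subseteq> {..<t} \<Longrightarrow>
      (tdens r t - \<delta>L) * real (card V) ^ r \<le> real (card {e \<in> E. inj_on \<chi> e}) \<Longrightarrow>
      (\<And>v. v \<in> V \<Longrightarrow> (tdens r t * real r - \<epsilon>L) * real (card V) ^ r \<le> real (card {e \<in> E. v \<in> e}) * real (card V)) \<Longrightarrow>
      \<exists>\<iota>. \<iota> ` V \<subseteq> {..<t} \<and> (\<forall>e\<in>E. inj_on \<iota> e)"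
    by (fact local_partite[OF rt F(1,3), where ?'v = nat])
  obtain \<epsilon>S nS where S: "\<epsilon>S > 0"
    "\<And>(V :: nat set) E. unif r V E \<Longrightarrow> \<not> has_core t F V E \<Longrightarrow> nS \<le> card V \<Longrightarrow>
      (tdens r t - \<epsilon>S) * real (card V) ^ r \<le> real (card E) \<Longrightarrow>
      \<exists>\<chi>. \<chi> ` V \<subseteq> {..<t} \<and> (tdens r t - \<delta>L) * real (card V) ^ r \<le> real (card {e \<in> E. inj_on \<chi> e})"
  proof (rule stability[OF rt F \<kappa>(1) _ L(2), where ?n1.0 = n1], goal_cases)
    case (1 V E)
    show ?case by (rule \<kappa>(2)) (fact 1)+
  next
    case (2 \<epsilon> N)
    show ?case by (rule 2(1)[of \<epsilon> N]) (fact 2)+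
  qed
  \<comment> \<open>Half of \<epsilon>S leaves room for the \<epsilon> lost in the density of
    \<open>W\<close> and the \<epsilon>\<open>/2\<close> lost by cleaning.\<close>
  define \<epsilon> where "\<epsilon> = min a (min (\<epsilon>L / (2 * real r)) (\<epsilon>S / 2))"
  have \<epsilon>: "\<epsilon> > 0" "\<epsilon> \<le> a" "\<epsilon> \<le> \<epsilon>L / (2 * real r)" "\<epsilon> \<le> \<epsilon>S / 2"
  proof -
    have "\<epsilon>L / (2 * real r) > 0" using L(1) rt by simp
    then show "\<epsilon> > 0" using a S(1) by (simp add: \<epsilon>_def)
    show "\<epsilon> \<le> a" "\<epsilon> \<le> \<epsilon>L / (2 * real r)" "\<epsilon> \<le> \<epsilon>S / 2" unfolding \<epsilon>_def by linarith+
  qed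
  have \<epsilon>r: "\<epsilon> * real r \<le> \<epsilon>L / 2" using \<epsilon>(3) rt by (simp add: field_simps)
  have \<epsilon>2: "\<epsilon> / 2 > 0" using \<epsilon>(1) by simp
  obtain Mg where Mg: "\<And>m n. Mg \<le> m \<Longrightarrow> m < n \<Longrightarrow>
    (tdens r t - \<epsilon>) * (real n ^ r - real m ^ r) < real (turan_num r t n) - real (turan_num r t m)"
    by (fact turan_num_growth[OF rt \<epsilon>(1,2)[unfolded a_def]])
  obtain Ma where Ma: "\<And>n. Ma \<le> n \<Longrightarrow> (tdens r t - \<epsilon> / 2) * real n ^ r \<le> real (turan_num r t n)"
    by (fact turan_num_asymp[OF rt \<epsilon>2])
  define q where "q = t + 1 + r + r * 2 ^ (t + 1)"
  define M where "M = nL + nS + Mg + 1 + nat \<lceil>2 * a * (real r) ^ 2 / \<epsilon>L\<rceil> + nat \<lceil>2 * real (q + 1) / \<epsilon>\<rceil>"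
  define N where "N = Ma + 1 + nat \<lceil>2 * real M ^ r / \<epsilon>\<rceil>"
  show ?thesis
  proof (rule that[of N])
    fix V :: "nat set" and E
    assume E: "unif r V E" and nemb: "\<not> embeds (Ext r (add_isolated (t + 1) F)) V E"
      and n: "N \<le> card V" and many: "turan_num r t (card V) \<le> card E"
    let ?n = "real (card V)"
    define R where "R = ?n ^ r"
    have V: "finite V" using E by (simp add: unif_def)
    have np: "?n \<ge> 1" using n by (simp add: N_def)
    have nR: "?n \<le> R" unfolding R_def using np rt by (intro self_le_power) auto
    have ge: "(a - \<epsilon> / 2) * R \<le> real (turan_num r t (card V))"
      using Ma[of "card V"] n unfolding N_def a_def R_def by simp
    obtain W where W: "W \<subseteq> V"
      "real (card E) - (a - \<epsilon>) * ?n ^ r \<le> real (card {e \<in> E. e \<subseteq> W}) - (a - \<epsilon>) * real (card W) ^ r"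
      "\<And>v. v \<in> W \<Longrightarrow> (a - \<epsilon>) * (real (card W) ^ r - (real (card W) - 1) ^ r)
        \<le> real (card {e \<in> {e \<in> E. e \<subseteq> W}. v \<in> e})"
      by (fact shrink[OF E])
    define EW where "EW = {e \<in> E. e \<subseteq> W}"
    let ?m = "real (card W)"
    define S' where "S' = ?m ^ r"
    have uW: "unif r W EW" unfolding EW_def by (rule unif_restrict[OF E W(1)])
    have EWE: "EW \<subseteq> E" by (auto simp: EW_def)
    have nembW: "\<not> embeds (Ext r (add_isolated (t + 1) F)) W EW"
      using nemb embeds_mono[OF _ W(1) EWE] by blast
    have mn: "card W \<le> card V" by (rule card_mono[OF V W(1)])
    have S0: "S' \<ge> 0" by (simp add: S'_def)
    have W2: "real (card E) - (a - \<epsilon>) * R \<le> real (card EW) - (a - \<epsilon>) * S'"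
      using W(2) unfolding R_def S'_def EW_def .
    have "(a - \<epsilon> / 2) * R \<le> real (card E)" using ge many by linarith
    then have gain: "\<epsilon> / 2 * R \<le> real (card EW) - (a - \<epsilon>) * S'" using W2 by (simp add: algebra_simps)
    \<comment> \<open>\<open>W\<close> has at most \<open>|W|^r\<close> edges but carries a surplus
      of at least \<epsilon>\<open>/2 * R\<close>, which is unbounded in \<open>n\<close>.\<close>
    have Mm: "M \<le> card W"
    proof (rule ccontr)
      assume "\<not> M \<le> card W"
      then have "S' \<le> real M ^ r" unfolding S'_def by (intro power_mono) auto
      moreover have "real (card EW) \<le> S'"
        using unif_card_le_pow[OF uW] unfolding S'_def by (metis of_nat_le_iff of_nat_power)
      moreover have "0 \<le> (a - \<epsilon>) * S'" using \<epsilon> S0 by simp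
      ultimately have "\<epsilon> / 2 * R \<le> real M ^ r" using gain by linarith
      moreover have "2 * real M ^ r / \<epsilon> < ?n" using n unfolding N_def by linarith
      then have "real M ^ r < \<epsilon> / 2 * ?n" using \<epsilon>(1) by (simp add: field_simps)
      moreover have "\<epsilon> / 2 * ?n \<le> \<epsilon> / 2 * R" using nR \<epsilon>(1) by (intro mult_left_mono) auto
      ultimately show False by linarith
    qed
    have m1: "card W \<ge> 1" using Mm by (simp add: M_def)
    then have mp: "?m > 0" by simp
    have "2 * a * (real r) ^ 2 / \<epsilon>L \<le> ?m" using Mm unfolding M_def by linarith
    then have mL: "2 * a * (real r) ^ 2 \<le> \<epsilon>L * ?m" using L(1) by (simp add: divide_le_eq mult.commute)
    have mindeg: "(tdens r t * real r - \<epsilon>L) * ?m ^ r \<le> real (card {e \<in> EW. v \<in> e}) * ?m" if "v \<in> W" for v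
      unfolding a_def[symmetric] EW_def
      by (rule min_degree_convert[OF m1 _ \<epsilon>(2) \<epsilon>r mL W(3)[OF that]]) (use \<epsilon> in simp)
    have "0 \<le> \<epsilon> / 2 * R" using \<epsilon>(1) by (simp add: R_def)
    then have EWge: "(a - \<epsilon>) * S' \<le> real (card EW)" using gain by linarith
    \<comment> \<open>Stability concerns core-free graphs, whereas \<open>EW\<close> is merely free
      of the extension.\<close>
    obtain E' where E': "E' \<subseteq> EW" "\<And>x y. x \<noteq> y \<Longrightarrow> covered E' x y \<Longrightarrow> rich q E' {x,y}"
      "(real (card EW) - real (card E')) * ?m \<le> real (q + 1) * ?m ^ r"
      by (fact clean[OF uW rt(1)])
    have nc: "\<not> has_core t F W E'"
      by (rule rich_no_core[OF rt(1) F(1,3) uW nembW E'(1,2)]) (simp_all add: q_def)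
    have "2 * real (q + 1) / \<epsilon> \<le> ?m" using Mm unfolding M_def by linarith
    then have "real (q + 1) \<le> \<epsilon> / 2 * ?m" using \<epsilon>(1) by (simp add: field_simps)
    then have q: "real (q + 1) * S' \<le> \<epsilon> / 2 * ?m * S'" using S0 by (rule mult_right_mono)
    have "(real (card EW) - real (card E')) * ?m \<le> real (q + 1) * S'"
      using E'(3) unfolding S'_def .
    also note q
    also have "\<epsilon> / 2 * ?m * S' = (\<epsilon> / 2 * S') * ?m" by (simp only: mult_ac)
    finally have "real (card EW) - real (card E') \<le> \<epsilon> / 2 * S'" using mp by simp
    moreover have "\<epsilon> * S' + \<epsilon> / 2 * S' \<le> \<epsilon>S * S'"
    proof -
      have "(\<epsilon> + \<epsilon> / 2) * S' \<le> \<epsilon>S * S'" using \<epsilon> S0 by (intro mult_right_mono) auto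
      then show ?thesis by (simp only: distrib_right)
    qed
    ultimately have "(tdens r t - \<epsilon>S) * ?m ^ r \<le> real (card E')"
      using EWge unfolding a_def[symmetric] S'_def[symmetric] by (simp add: algebra_simps)
    then obtain \<chi> where \<chi>: "\<chi> ` W \<subseteq> {..<t}"
      "(tdens r t - \<delta>L) * ?m ^ r \<le> real (card {e \<in> E'. inj_on \<chi> e})"
      using S(2)[OF unif_mono[OF uW E'(1)] nc] Mm unfolding M_def by fastforce
    have fEW: "finite EW" using uW by (rule unif_finite_edges)
    have "card {e \<in> E'. inj_on \<chi> e} \<le> card {e \<in> EW. inj_on \<chi> e}"
      by (rule card_mono) (use fEW E'(1) in auto)
    then have tW: "(tdens r t - \<delta>L) * ?m ^ r \<le> real (card {e \<in> EW. inj_on \<chi> e})" using \<chi>(2) by linarith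
    have "nL \<le> card W" using Mm by (simp add: M_def)
    then obtain \<iota> where \<iota>: "\<iota> ` W \<subseteq> {..<t}" "\<forall>e\<in>EW. inj_on \<iota> e"
      using L(3)[OF uW nembW _ \<chi>(1) tW mindeg] by blast
    have le: "card EW \<le> turan_num r t (card W)" by (rule partite_card_le[OF uW rt(1) t \<iota>])
    \<comment> \<open>Both edge numbers are now compared with \<open>turan_num\<close>; a smaller
      \<open>W\<close> would lose more edges than the surplus inequality permits.\<close>
    have "card W = card V"
    proof (rule ccontr)
      assume "card W \<noteq> card V"
      then have "card W < card V" using mn by simp
      then have "(a - \<epsilon>) * (R - S') < real (turan_num r t (card V)) - real (turan_num r t (card W))"
        using Mg[of "card W" "card V"] Mm unfolding a_def R_def S'_def M_def by simp
      then show False using W2 many le by (simp add: algebra_simps)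
    qed
    then have "W = V" using W(1) V by (simp add: card_subset_eq)
    moreover from this have "EW = E" using E by (auto simp: EW_def unif_def)
    ultimately show "\<exists>\<chi>. \<chi> ` V \<subseteq> {..<t} \<and> (\<forall>e\<in>E. inj_on \<chi> e)" using \<iota> by blast
  qed
qed

section \<open>The balanced blowup: freeness, uniqueness, existence\<close>

lemma partite_no_core:
  assumes "\<chi> ` V \<subseteq> {..<t}" "\<And>e. e \<in> E \<Longrightarrow> inj_on \<chi> e"
  shows "\<not> has_core t F V E"
proof
  assume "has_core t F V E"
  then show False
  proof (rule has_coreE)
    fix S \<phi> assume S: "S \<subseteq> V" "card S = t + 1" "\<And>x y. x \<in> S \<Longrightarrow> y \<in> S \<Longrightarrow> x \<noteq> y \<Longrightarrow> covered E x y"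
    \<comment> \<open>Pairwise covered vertices receive distinct colours, but \<open>S\<close> has
      one vertex more than there are colours.\<close>
    have "inj_on \<chi> S"
    proof (rule inj_onI, rule ccontr)
      fix x y assume xy: "x \<in> S" "y \<in> S" "\<chi> x = \<chi> y" "x \<noteq> y"
      then obtain e where "e \<in> E" "x \<in> e" "y \<in> e" using S(3) unfolding covered_def by blast
      then show False using assms(2)[of e] xy unfolding inj_on_def by blast
    qed
    then have "card S = card (\<chi> ` S)" by (simp add: card_image)
    also have "\<dots> \<le> card {..<t}" by (rule card_mono) (use assms(1) S(1) in auto)
    finally show False using S(2) by simp
  qed
qed

text \<open>A permutation of the colours matches parts of equal size; bijections between matched
  parts are glued to one map of the vertex sets, which preserves and reflects equality of
  colours.\<close>

lemma transversal_iso: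
  assumes V: "finite V" "\<chi> ` V \<subseteq> {..<t}" "near_equal t n (\<lambda>i. card (part \<chi> V i))"
    and V': "finite V'" "\<chi>' ` V' \<subseteq> {..<t}" "near_equal t n (\<lambda>i. card (part \<chi>' V' i))"
  shows "hg_iso \<lparr>verts = V, edges = transv \<chi> V {..<t} r\<rparr> \<lparr>verts = V', edges = transv \<chi>' V' {..<t} r\<rparr>"
proof -
  obtain \<sigma> where \<sigma>: "bij_betw \<sigma> {..<t} {..<t}"
    "\<And>i. i < t \<Longrightarrow> card (part \<chi> V i) = card (part \<chi>' V' (\<sigma> i))"
    using near_equal_perm[OF V(3) V'(3)] by metis
  have fin: "finite (part \<chi> V i)" "finite (part \<chi>' V' i)" for i using V V' by (auto simp: part_def)
  have "\<exists>f. bij_betw f (part \<chi> V i) (part \<chi>' V' (\<sigma> i))" if "i < t" for i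
    using finite_same_card_bij[OF fin \<sigma>(2)[OF that]] .
  then obtain f where f: "\<And>i. i < t \<Longrightarrow> bij_betw (f i) (part \<chi> V i) (part \<chi>' V' (\<sigma> i))" by metis
  define g where "g = (\<lambda>v. f (\<chi> v) v)"
  have \<sigma>t: "\<sigma> i < t" if "i < t" for i using \<sigma>(1) that unfolding bij_betw_def by blast
  have \<sigma>i: "\<sigma> i = \<sigma> j \<longleftrightarrow> i = j" if "i < t" "j < t" for i j
    using \<sigma>(1) that unfolding bij_betw_def inj_on_def by auto
  have \<chi>t: "\<chi> v < t" if "v \<in> V" for v using V(2) that by blast
  have vp: "v \<in> part \<chi> V (\<chi> v)" if "v \<in> V" for v using that by (simp add: part_def)
  have gp: "g v \<in> part \<chi>' V' (\<sigma> (\<chi> v))" if "v \<in> V" for v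
    using f[OF \<chi>t[OF that]] vp[OF that] unfolding g_def bij_betw_def by blast
  then have gV: "g v \<in> V'" "\<chi>' (g v) = \<sigma> (\<chi> v)" if "v \<in> V" for v using that by (auto simp: part_def)
  have gi: "inj_on g V"
  proof (rule inj_onI)
    fix v w assume vw: "v \<in> V" "w \<in> V" "g v = g w"
    then have "\<sigma> (\<chi> v) = \<sigma> (\<chi> w)" using gV by metis
    then have c: "\<chi> v = \<chi> w" using \<sigma>i \<chi>t vw by blast
    then show "v = w"
      using f[OF \<chi>t[OF vw(1)]] vp[OF vw(1)] vp[OF vw(2)] vw(3)
      unfolding g_def bij_betw_def inj_on_def by auto
  qed
  have gs: "g ` V = V'"
  proof (intro equalityI subsetI)
    fix w assume w: "w \<in> V'"
    then have "\<chi>' w < t" using V'(2) by blast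
    then obtain i where i: "i < t" "\<sigma> i = \<chi>' w" using \<sigma>(1) unfolding bij_betw_def by (metis imageE lessThan_iff)
    then have "w \<in> f i ` part \<chi> V i" using f[OF i(1)] w unfolding bij_betw_def part_def by auto
    then obtain v where "v \<in> part \<chi> V i" "w = f i v" by blast
    then have "v \<in> V" "w = g v" by (auto simp: part_def g_def)
    then show "w \<in> g ` V" by blast
  qed (use gV in auto)
  have inj_iff: "inj_on \<chi>' (g ` A) \<longleftrightarrow> inj_on \<chi> A" if A: "A \<subseteq> V" for A
  proof -
    have "\<chi>' (g v) = \<chi>' (g w) \<longleftrightarrow> \<chi> v = \<chi> w" if "v \<in> A" "w \<in> A" for v w
      using gV(2) \<sigma>i \<chi>t A that by (metis subsetD)
    moreover have "g v = g w \<longleftrightarrow> v = w" if "v \<in> A" "w \<in> A" for v w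
      using gi A that by (meson inj_onD subsetD)
    ultimately show ?thesis unfolding inj_on_def by auto
  qed
  have "(\<lambda>e. g ` e) ` transv \<chi> V {..<t} r = transv \<chi>' V' {..<t} r"
  proof (intro equalityI subsetI)
    fix e assume "e \<in> (\<lambda>e. g ` e) ` transv \<chi> V {..<t} r"
    then obtain A where A: "A \<subseteq> V" "card A = r" "inj_on \<chi> A" "e = g ` A" by (auto simp: transv_def)
    have "card e = r" using A gi by (simp add: card_image inj_on_subset)
    then show "e \<in> transv \<chi>' V' {..<t} r" using A gs V'(2) inj_iff[OF A(1)] by (auto simp: transv_def)
  next
    fix e assume "e \<in> transv \<chi>' V' {..<t} r"
    then have e: "e \<subseteq> V'" "card e = r" "inj_on \<chi>' e" by (auto simp: transv_def)
    then have "e \<subseteq> g ` V" using gs by simp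
    then obtain A where A: "A \<subseteq> V" "e = g ` A" by (auto elim: subset_imageE)
    have "card A = r" using e(2) A card_image[OF inj_on_subset[OF gi A(1)]] by simp
    then have "A \<in> transv \<chi> V {..<t} r" using A e(3) inj_iff[OF A(1)] V(2) by (auto simp: transv_def)
    then show "e \<in> (\<lambda>e. g ` e) ` transv \<chi> V {..<t} r" using A(2) by blast
  qed
  then show ?thesis unfolding hg_iso_def using gi gs by (intro exI[of _ g]) (simp add: bij_betw_def)
qed

lemma ceiling_div_cases:
  assumes "t > 0"
  shows "\<lceil>real n / real t\<rceil> = int (n div t) + (if n mod t = 0 then 0 else 1)"
proof (cases "n mod t = 0")
  case True
  then have "n = t * (n div t)" using mult_div_mod_eq[of t n] by simp
  then have "real n = real t * real (n div t)" by (metis of_nat_mult)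
  then have "real n / real t = of_int (int (n div t))" using assms by simp
  then have "\<lceil>real n / real t\<rceil> = int (n div t)" by (simp only: ceiling_of_int)
  then show ?thesis using True by simp
next
  case False
  have "n = t * (n div t) + n mod t" by simp
  then have eq: "real n = real t * real (n div t) + real (n mod t)" by (metis of_nat_add of_nat_mult)
  have "\<lceil>real n / real t\<rceil> = int (n div t) + 1"
  proof (rule ceiling_unique)
    show "of_int (int (n div t) + 1) - 1 < real n / real t"
      using eq False assms by (simp add: less_divide_eq mult.commute)
    have "n mod t < t" using assms by simp
    then show "real n / real t \<le> of_int (int (n div t) + 1)"
      using eq assms by (simp add: divide_le_eq algebra_simps)
  qed
  then show ?thesis using False by simp
qed

text \<open>The parts become the fibres of a colouring. Rounding \<open>n / t\<close> down or up
  gives exactly the sizes permitted by \<open>near_equal\<close>; they coincide when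
  \<open>t\<close> divides \<open>n\<close>.\<close>

lemma blowup_colouring:
  assumes K: "is_balanced_blowup r t n K" and t: "t > 0"
  obtains \<chi> where "finite (verts K)" "card (verts K) = n" "\<chi> ` verts K \<subseteq> {..<t}"
    "near_equal t n (\<lambda>i. card (part \<chi> (verts K) i))" "edges K = transv \<chi> (verts K) {..<t} r"
proof -
  from K obtain P :: "nat \<Rightarrow> 'a set" where V: "finite (verts K)" "card (verts K) = n"
    and P: "disjoint_family_on P {..<t}" "(\<Union>i<t. P i) = verts K"
      "\<forall>i<t. int (card (P i)) \<in> {\<lfloor>real n / real t\<rfloor>, \<lceil>real n / real t\<rceil>}"
      "edges K = {e. e \<subseteq> verts K \<and> card e = r \<and> (\<forall>i<t. card (e \<inter> P i) \<le> 1)}"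
    unfolding is_balanced_blowup_def by blast
  have "\<exists>i<t. v \<in> P i" if "v \<in> verts K" for v using P(2) that by blast
  then obtain \<chi> where \<chi>: "\<And>v. v \<in> verts K \<Longrightarrow> \<chi> v < t \<and> v \<in> P (\<chi> v)" by metis
  have uniq: "\<chi> v = i" if "v \<in> verts K" "v \<in> P i" "i < t" for v i
    using P(1) \<chi>[OF that(1)] that unfolding disjoint_family_on_def by blast
  have pt: "part \<chi> (verts K) i = P i" if i: "i < t" for i
    using \<chi> uniq P(2) i unfolding part_def by blast
  have \<chi>t: "\<chi> ` verts K \<subseteq> {..<t}" using \<chi> by auto
  have ne: "near_equal t n (\<lambda>i. card (part \<chi> (verts K) i))"
    unfolding near_equal_def
  proof (intro conjI allI impI)
    show "(\<Sum>i<t. card (part \<chi> (verts K) i)) = n"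
      using sum_card_part[OF V(1) finite_lessThan \<chi>t] V(2) by simp
    fix i assume i: "i < t"
    have "\<lfloor>real n / real t\<rfloor> = int (n div t)" by (rule floor_divide_of_nat_eq)
    then show "card (part \<chi> (verts K) i) = n div t \<or> card (part \<chi> (verts K) i) = n div t + 1"
      using P(3) i ceiling_div_cases[OF t, of n] unfolding pt[OF i] by (auto split: if_splits)
  qed
  have "(\<forall>i<t. card (e \<inter> P i) \<le> 1) \<longleftrightarrow> inj_on \<chi> e" if e: "e \<subseteq> verts K" for e
  proof -
    have fe: "finite (e \<inter> P i)" for i using e V(1) by (auto intro: finite_subset)
    have "(\<forall>i<t. card (e \<inter> P i) \<le> 1) \<longleftrightarrow> (\<forall>i<t. \<forall>x\<in>e \<inter> P i. \<forall>y\<in>e \<inter> P i. x = y)"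
      using card_le_Suc0_iff_eq[OF fe] by simp
    also have "\<dots> \<longleftrightarrow> inj_on \<chi> e"
    proof
      assume *: "\<forall>i<t. \<forall>x\<in>e \<inter> P i. \<forall>y\<in>e \<inter> P i. x = y"
      show "inj_on \<chi> e"
      proof (rule inj_onI)
        fix x y assume xy: "x \<in> e" "y \<in> e" "\<chi> x = \<chi> y"
        have "x \<in> P (\<chi> x)" "y \<in> P (\<chi> x)" "\<chi> x < t"
          using \<chi>[of x] \<chi>[of y] xy e by auto
        then show "x = y" using * xy by blast
      qed
    next
      assume inj: "inj_on \<chi> e"
      show "\<forall>i<t. \<forall>x\<in>e \<inter> P i. \<forall>y\<in>e \<inter> P i. x = y"
      proof (intro allI impI ballI)
        fix i x y assume "i < t" "x \<in> e \<inter> P i" "y \<in> e \<inter> P i"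
        then have "\<chi> x = i" "\<chi> y = i" "x \<in> e" "y \<in> e" using uniq e by blast+
        then show "x = y" using inj by (simp add: inj_on_def)
      qed
    qed
    finally show ?thesis .
  qed
  then have "edges K = transv \<chi> (verts K) {..<t} r" unfolding P(4) transv_def using \<chi>t by blast
  then show ?thesis using that V \<chi>t ne by blast
qed

text \<open>A disjoint union of sets of the even sizes is carried to an initial segment of the
  naturals by a bijection.\<close>

lemma balanced_blowup_exists:
  assumes t: "t > 0"
  shows "\<exists>K :: nat hgraph. is_balanced_blowup r t n K"
proof -
  let ?N = "even_parts t n"
  define X where "X = Sigma {..<t} (\<lambda>i. {..<?N i})"
  have "card X = (\<Sum>i<t. ?N i)" unfolding X_def by (subst card_SigmaI) auto
  then have "card X = card {..<n}" using near_equal_even_parts[OF t, of n] by (simp add: near_equal_def)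
  moreover have "finite X" by (simp add: X_def)
  ultimately obtain h where h: "bij_betw h X {..<n}" using finite_same_card_bij[of X "{..<n}"] by auto
  define P where "P = (\<lambda>i. h ` ({i} \<times> {..<?N i}))"
  have sub: "{i} \<times> {..<?N i} \<subseteq> X" if "i < t" for i using that by (auto simp: X_def)
  have hi: "inj_on h X" and hs: "h ` X = {..<n}" using h by (auto simp: bij_betw_def)
  have cP: "card (P i) = ?N i" if "i < t" for i
    unfolding P_def using card_image[OF inj_on_subset[OF hi sub[OF that]]] by (simp add: card_cartesian_product)
  have dP: "disjoint_family_on P {..<t}"
    unfolding disjoint_family_on_def
  proof (intro ballI impI)
    fix i j assume ij: "i \<in> {..<t}" "j \<in> {..<t}" "i \<noteq> j"
    have "P i \<inter> P j = h ` (({i} \<times> {..<?N i}) \<inter> ({j} \<times> {..<?N j}))"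
      unfolding P_def using inj_on_image_Int[OF hi sub sub] ij by simp
    then show "P i \<inter> P j = {}" using ij by auto
  qed
  have uP: "(\<Union>i<t. P i) = {..<n}"
  proof -
    have "X = (\<Union>i<t. {i} \<times> {..<?N i})" by (auto simp: X_def)
    then have "h ` X = (\<Union>i<t. P i)" unfolding P_def by (simp add: image_UN)
    then show ?thesis using hs by simp
  qed
  have fl: "\<lfloor>real n / real t\<rfloor> = int (n div t)" by (rule floor_divide_of_nat_eq)
  have bP: "int (card (P i)) \<in> {\<lfloor>real n / real t\<rfloor>, \<lceil>real n / real t\<rceil>}" if "i < t" for i
    unfolding fl ceiling_div_cases[OF t] cP[OF that] by (auto simp: even_parts_def)
  define K :: "nat hgraph" where "K = \<lparr>verts = {..<n}, edges = {e. e \<subseteq> {..<n} \<and> card e = r \<and> (\<forall>i<t. card (e \<inter> P i) \<le> 1)}\<rparr>"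
  have "is_balanced_blowup r t n K"
    unfolding is_balanced_blowup_def K_def using dP uP bP by auto
  then show ?thesis by blast
qed

theorem theorem1p5:
  fixes r t :: nat and F :: "'a hgraph"
  assumes "r \<ge> 2"
    and "rgraph r F"
    and "covers_pairs F"
    and "card (verts F) \<le> t"
    and "turan_density r F < fact r * (1 / real t ^ r) * real (t choose r)"
  shows "\<exists>n0. \<forall>n\<ge>n0.
           (\<exists>K :: nat hgraph. is_balanced_blowup r t n K) \<and>
           (\<forall>K :: nat hgraph. is_balanced_blowup r t n K \<longrightarrow>
              extremal r n (Ext r (add_isolated (t + 1) F)) K \<and>
              (\<forall>G. extremal r n (Ext r (add_isolated (t + 1) F)) G \<longrightarrow> hg_iso G K))"
proof -
  let ?H = "Ext r (add_isolated (t + 1) F)"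
  \<comment> \<open>For \<open>t < r\<close> the threshold is zero, which the nonnegative density
    cannot undercut.\<close>
  have rt: "t \<ge> r"
  proof (rule ccontr)
    assume "\<not> t \<ge> r"
    then have "turan_density r F < 0" using assms(5) by (simp add: binomial_eq_0)
    then show False using turan_density_nonneg[of r F] by simp
  qed
  have t: "t > 0" using rt assms(1) by simp
  have dens: "turan_density r F < fact r * tdens r t" using assms(5) by (simp add: tdens_def)
  obtain N where N: "\<And>(V :: nat set) E. unif r V E \<Longrightarrow> \<not> embeds ?H V E \<Longrightarrow>
      N \<le> card V \<Longrightarrow> turan_num r t (card V) \<le> card E \<Longrightarrow>
      \<exists>\<chi>. \<chi> ` V \<subseteq> {..<t} \<and> (\<forall>e\<in>E. inj_on \<chi> e)"
    by (fact extremal_partite[OF assms(1) rt assms(2-4) dens])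
  have free: "hg_free ?H G \<longleftrightarrow> \<not> embeds ?H (verts G) (edges G)" for G :: "nat hgraph"
    by (rule hg_free_iff_embeds) (use edges_Ext_subset edges_add_isolated_subset[OF assms(2)] in metis)
  have rg: "rgraph r G \<longleftrightarrow> unif r (verts G) (edges G)" for G :: "nat hgraph"
    by (simp add: rgraph_def unif_def)
  have upper: "card (edges G) \<le> turan_num r t n"
    and partite: "turan_num r t n \<le> card (edges G) \<Longrightarrow>
      \<exists>\<chi>. \<chi> ` verts G \<subseteq> {..<t} \<and> (\<forall>e\<in>edges G. inj_on \<chi> e)"
    if G: "G \<in> free_rgraphs r n ?H" and n: "N \<le> n" for G n
  proof -
    have u: "unif r (verts G) (edges G)" "card (verts G) = n" "\<not> embeds ?H (verts G) (edges G)"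
      using G unfolding free_rgraphs_def free rg by auto
    show p: "\<exists>\<chi>. \<chi> ` verts G \<subseteq> {..<t} \<and> (\<forall>e\<in>edges G. inj_on \<chi> e)" if "turan_num r t n \<le> card (edges G)"
      using N[OF u(1,3)] u(2) n that by blast
    \<comment> \<open>A graph exceeding the bound would also be \<open>t\<close>-partite by the same
      result, and partite graphs obey the bound.\<close>
    show "card (edges G) \<le> turan_num r t n"
    proof (rule ccontr)
      assume neg: "\<not> card (edges G) \<le> turan_num r t n"
      then obtain \<chi> where "\<chi> ` verts G \<subseteq> {..<t}" "\<forall>e\<in>edges G. inj_on \<chi> e" using p by auto
      then show False using partite_card_le(2)[OF u(1) assms(1) t] u(2) neg by blast
    qed
  qed
  \<comment> \<open>The condition \<open>t <= n\<close> is there for uniqueness: it makes the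
    optimal part sizes unique up to order.\<close>
  have main: "extremal r n ?H K \<and> (\<forall>G. extremal r n ?H G \<longrightarrow> hg_iso G K)"
    if n: "max N t \<le> n" and K: "is_balanced_blowup r t n K" for n and K :: "nat hgraph"
  proof -
    obtain \<chi> where \<chi>: "finite (verts K)" "card (verts K) = n" "\<chi> ` verts K \<subseteq> {..<t}"
      "near_equal t n (\<lambda>i. card (part \<chi> (verts K) i))" "edges K = transv \<chi> (verts K) {..<t} r"
      by (fact blowup_colouring[OF K t])
    have cK: "card (edges K) = turan_num r t n"
      unfolding \<chi>(5) card_transv[OF \<chi>(1) finite_lessThan] by (rule esym_near_equal[OF t \<chi>(4)])
    have "\<not> has_core t F (verts K) (edges K)"
      by (rule partite_no_core[OF \<chi>(3)]) (auto simp: \<chi>(5) transv_def)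
    then have "\<not> embeds ?H (verts K) (edges K)"
      using embeds_Ext_imp_has_core[OF assms(2,4)] by blast
    then have Kfree: "K \<in> free_rgraphs r n ?H"
      unfolding free_rgraphs_def free rgraph_def using \<chi>(1,2) by (auto simp: \<chi>(5) transv_def)
    have ext: "extremal r n ?H K"
      unfolding extremal_def cK using Kfree upper n by auto
    have "hg_iso G K" if G: "extremal r n ?H G" for G
    proof -
      have Gf: "G \<in> free_rgraphs r n ?H" using G by (simp add: extremal_def)
      have ge: "turan_num r t n \<le> card (edges G)" using G Kfree cK unfolding extremal_def by metis
      then obtain \<chi>G where \<chi>G: "\<chi>G ` verts G \<subseteq> {..<t}" "\<forall>e\<in>edges G. inj_on \<chi>G e"
        using partite[OF Gf] n by auto
      have u: "unif r (verts G) (edges G)" "card (verts G) = n"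
        using Gf unfolding free_rgraphs_def rg by auto
      have V: "finite (verts G)" using u by (simp add: unif_def)
      have sub: "edges G \<subseteq> transv \<chi>G (verts G) {..<t} r" by (rule partite_card_le(1)[OF u(1) assms(1) t \<chi>G])
      have s: "(\<Sum>i<t. card (part \<chi>G (verts G) i)) = n"
        using sum_card_part[OF V finite_lessThan \<chi>G(1)] u(2) by simp
      have c: "card (transv \<chi>G (verts G) {..<t} r) = esym r {..<t} (\<lambda>i. card (part \<chi>G (verts G) i))"
        by (rule card_transv[OF V finite_lessThan])
      have le: "card (edges G) \<le> card (transv \<chi>G (verts G) {..<t} r)"
        by (rule card_mono[OF finite_transv[OF V] sub])
      have ub: "esym r {..<t} (\<lambda>i. card (part \<chi>G (verts G) i)) \<le> turan_num r t n"
        by (rule esym_le_turan_num[OF assms(1) t s])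
      \<comment> \<open>The chain from \<open>turan_num\<close> through \<open>edges G\<close> and
        all transversal sets back to \<open>turan_num\<close> collapses: every transversal set is an
        edge and the part sizes are optimal.\<close>
      have eq: "edges G = transv \<chi>G (verts G) {..<t} r"
        by (rule card_subset_eq[OF finite_transv[OF V] sub]) (use c le ub ge in linarith)
      have "near_equal t n (\<lambda>i. card (part \<chi>G (verts G) i))"
        by (rule esym_eq_turan_num_imp[OF assms(1) rt s]) (use c le ub ge n in auto)
      then have "hg_iso \<lparr>verts = verts G, edges = transv \<chi>G (verts G) {..<t} r\<rparr>
          \<lparr>verts = verts K, edges = transv \<chi> (verts K) {..<t} r\<rparr>"
        using transversal_iso[OF V \<chi>G(1) _ \<chi>(1,3,4)] by blast
      then show ?thesis unfolding eq[symmetric] \<chi>(5)[symmetric] by (simp add: hg_iso_def)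
    qed
    then show ?thesis using ext by blast
  qed
  show ?thesis using main balanced_blowup_exists[OF t] by blast
qed

end
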